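(* Let $M$ be a smooth manifold of dimension $m$, let $f_1,\dots,f_d\in C^\infty(M)$ have no common zero, and let $\mathcal{X}=\xi_1f_1+\dots+\xi_df_d$ with $\xi_i$ i.i.d. standard real Gaussian variables; assume that $\mathcal{X}$ is non-degenerate. Let $f_0\in C^\infty(M)$ be linearly independent of $f_1,\dots,f_d$ (i.e. not in their span), and let $\mathcal{X}_0=\mathcal{X}+\xi_0f_0$ with $\xi_0$ a standard Gaussian variable independent of $\mathcal{X}$. Then for every open set $U\subset M$, $$\mathbb{E}\mathbb{S}\{\mathcal{X}_0;U\}-\mathbb{E}\mathbb{S}\{\mathcal{X};U\}=c_m\int_U(\Psi(x)-1)\,dM(x),$$ where $c_m>0$ is a constant depending only on the dimension $m$, $dM$ denotes integration with respect to the Riemannian volume of the Adler–Taylor metric of $\mathcal{X}$, and $$\Psi(x)=\left(\frac{K(x)}{K(x)+f_0(x)^2}\right)^{\frac m2}\sqrt{1+g^x(\tau(x))}.$$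
   Context: $\mathbb{E}\mathbb{S}\{\mathcal{X};U\}$ denotes the (possibly infinite) expected number of points $x\in U$ with $\mathcal{X}_1(x)=\dots=\mathcal{X}_m(x)=0$, where $\mathcal{X}_1,\dots,\mathcal{X}_m$ are i.i.d. copies of $\mathcal{X}$. Notation: $K(x)=\mathbb{E}[\mathcal{X}(x)^2]=\sum_{i=1}^df_i(x)^2>0$; the moment map is the one-form $\mu(x)=D_x\big(\frac12\log K\big)$; the Adler–Taylor metric of $\mathcal{X}$ is the quadratic form on $T_xM$ $$g_x(v)=\frac{1}{K(x)}\mathbb{E}\big[(D_x\mathcal{X}(v))^2\big]-\langle\mu(x),v\rangle^2=\frac1{K(x)}\sum_{i=1}^d\big(D_xf_i(v)-f_i(x)\langle\mu(x),v\rangle\big)^2 .$$ $\mathcal{X}$ is called non-degenerate if $g_x$ is positive definite for every $x\in M$, so that $g$ is a Riemannian metric. $g^x$ is the dual quadratic form on $T_x^*M$, $g^x(u)=\sup\{\langle u,v\rangle^2\mid g_x(v)\le1\}$. The one-form $\tau$ is $$\tau(x)=\frac{1}{\sqrt{K(x)+f_0(x)^2}}\big(f_0(x)\mu(x)-D_xf_0\big).$$ *)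

theory Defs
  imports "HOL-Probability.Probability"
begin

section \<open>Smooth functions and smooth manifolds\<close>

primrec C_k_on :: "nat \<Rightarrow> 'b::real_normed_vector set \<Rightarrow> ('b \<Rightarrow> 'c::real_normed_vector) \<Rightarrow> bool" where
  "C_k_on 0 S f \<longleftrightarrow> continuous_on S f"
| "C_k_on (Suc k) S f \<longleftrightarrow>
     (\<forall>x\<in>S. f differentiable (at x)) \<and>
     (\<forall>v. C_k_on k S (\<lambda>x. frechet_derivative f (at x) v))"

text \<open>Only used for open subsets of Euclidean spaces, where quantifying over the directional
  derivatives one by one gives the usual classes.\<close>

definition smooth_on :: "'b::real_normed_vector set \<Rightarrow> ('b \<Rightarrow> 'c::real_normed_vector) \<Rightarrow> bool" where
  "smooth_on S f \<longleftrightarrow> (\<forall>k. C_k_on k S f)"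

text \<open>A chart is a pair of a domain and a coordinate map; the coordinate map is a total function
  whose values outside the domain are irrelevant.\<close>

type_synonym ('a, 'm) chart = "'a set \<times> ('a \<Rightarrow> real ^ 'm)"

definition chart_inv :: "('a, 'm) chart \<Rightarrow> real ^ 'm \<Rightarrow> 'a" where
  "chart_inv c = inv_into (fst c) (snd c)"

text \<open>The manifold is the whole type \<open>'a\<close>, whose type classes say that it is Hausdorff and second
  countable; the atlas need not be maximal. The dimension is \<open>CARD('m)\<close>.\<close>

definition smooth_atlas ::
    "('a::{t2_space,second_countable_topology}, 'm::finite) chart set \<Rightarrow> bool" where
  "smooth_atlas A \<longleftrightarrow>
     (\<Union>c\<in>A. fst c) = UNIV \<and>
     (\<forall>c\<in>A. open (fst c) \<and> open (snd c ` fst c) \<and>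
        homeomorphism (fst c) (snd c ` fst c) (snd c) (chart_inv c)) \<and>
     (\<forall>c\<in>A. \<forall>c'\<in>A. smooth_on (snd c ` (fst c \<inter> fst c')) (snd c' \<circ> chart_inv c))"

definition smooth_fun_on ::
    "('a::topological_space, 'm::finite) chart set \<Rightarrow> 'a set \<Rightarrow> ('a \<Rightarrow> real) \<Rightarrow> bool" where
  "smooth_fun_on A W h \<longleftrightarrow> (\<forall>c\<in>A. smooth_on (snd c ` (fst c \<inter> W)) (h \<circ> chart_inv c))"

abbreviation smooth_fun ::
    "('a::topological_space, 'm::finite) chart set \<Rightarrow> ('a \<Rightarrow> real) \<Rightarrow> bool" where
  "smooth_fun A \<equiv> smooth_fun_on A UNIV"


section \<open>Tangent vectors\<close>

text \<open>A tangent vector at \<open>x\<close> is the operator of differentiation along it, acting on the functions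
  that are smooth near \<open>x\<close>; so \<open>D\<^sub>x h (v)\<close> is \<open>v h\<close>. On all other functions it is \<open>0\<close>, which makes
  equality of tangent vectors (in particular being the zero vector) the intended one.\<close>

type_synonym 'a tangent = "('a \<Rightarrow> real) \<Rightarrow> real"

definition chart_vector ::
    "('a::topological_space, 'm::finite) chart set \<Rightarrow> ('a, 'm) chart \<Rightarrow> 'a \<Rightarrow> real ^ 'm \<Rightarrow> 'a tangent" where
  "chart_vector A c x w =
     (\<lambda>h. if \<exists>W. open W \<and> x \<in> W \<and> smooth_fun_on A W h
          then frechet_derivative (h \<circ> chart_inv c) (at (snd c x)) w else 0)"

definition tangent_space ::
    "('a::topological_space, 'm::finite) chart set \<Rightarrow> 'a \<Rightarrow> 'a tangent set" where
  "tangent_space A x = {chart_vector A c x w | c w. c \<in> A \<and> x \<in> fst c}"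

definition differential :: "('a \<Rightarrow> real) \<Rightarrow> 'a tangent \<Rightarrow> real" where
  "differential h v = v h"


section \<open>Quadratic forms on tangent spaces and the Riemannian volume\<close>

definition positive_definite_form ::
    "('a::topological_space, 'm::finite) chart set \<Rightarrow> ('a \<Rightarrow> 'a tangent \<Rightarrow> real) \<Rightarrow> bool" where
  "positive_definite_form A g \<longleftrightarrow>
     (\<forall>x. \<forall>v\<in>tangent_space A x. v \<noteq> (\<lambda>_. 0) \<longrightarrow> g x v > 0)"

definition dual_form ::
    "('a::topological_space, 'm::finite) chart set \<Rightarrow> ('a \<Rightarrow> 'a tangent \<Rightarrow> real) \<Rightarrow>
     'a \<Rightarrow> ('a tangent \<Rightarrow> real) \<Rightarrow> real" where
  "dual_form A g x u = Sup {(u v)\<^sup>2 | v. v \<in> tangent_space A x \<and> g x v \<le> 1}"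

text \<open>The Gram matrix of the coordinate vector fields, by polarization of the quadratic form.\<close>

definition gram_matrix ::
    "('a::topological_space, 'm::finite) chart set \<Rightarrow> ('a \<Rightarrow> 'a tangent \<Rightarrow> real) \<Rightarrow>
     ('a, 'm) chart \<Rightarrow> 'a \<Rightarrow> real ^ 'm ^ 'm" where
  "gram_matrix A g c x =
     (let q = (\<lambda>w. g x (chart_vector A c x w))
      in \<chi> i j. (q (axis i 1 + axis j 1) - q (axis i 1) - q (axis j 1)) / 2)"

text \<open>The unique Borel measure that has density \<open>sqrt (det G)\<close> in every chart.\<close>

definition riemannian_volume ::
    "('a::topological_space, 'm::finite) chart set \<Rightarrow> ('a \<Rightarrow> 'a tangent \<Rightarrow> real) \<Rightarrow> 'a measure" where
  "riemannian_volume A g =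
     (THE \<nu>. sets \<nu> = sets borel \<and>
        (\<forall>c\<in>A. \<forall>B\<in>sets borel. B \<subseteq> fst c \<longrightarrow>
           emeasure \<nu> B =
             (\<integral>\<^sup>+ y \<in> snd c ` B. ennreal (sqrt (det (gram_matrix A g c (chart_inv c y)))) \<partial>lborel)))"

text \<open>Lebesgue integral in the extended sense: it may be infinite, and it is meaningful as soon as
  the integral of the positive part or that of the negative part is finite.\<close>

definition extended_integral :: "'a measure \<Rightarrow> 'a set \<Rightarrow> ('a \<Rightarrow> real) \<Rightarrow> ereal" where
  "extended_integral \<nu> U h =
     enn2ereal (\<integral>\<^sup>+ x \<in> U. ennreal (h x) \<partial>\<nu>) - enn2ereal (\<integral>\<^sup>+ x \<in> U. ennreal (- h x) \<partial>\<nu>)"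


section \<open>Random functions\<close>

text \<open>A random function on \<open>'a\<close> is a map \<open>X :: 'w \<Rightarrow> 'a \<Rightarrow> real\<close> on a probability space \<open>P\<close>. The
  independent copies \<open>X\<^sub>1, \<dots>, X\<^sub>m\<close> are realized on the \<open>m\<close>-fold product of \<open>P\<close>, the copy with
  index \<open>j\<close> depending on the factor \<open>j\<close> only. \<open>count_space\<close> counts infinite sets as \<open>\<infinity>\<close>.\<close>

definition expected_zeros :: "'w measure \<Rightarrow> nat \<Rightarrow> ('w \<Rightarrow> 'a \<Rightarrow> real) \<Rightarrow> 'a set \<Rightarrow> ennreal" where
  "expected_zeros P m X U =
     (\<integral>\<^sup>+ \<omega>. emeasure (count_space UNIV) {x \<in> U. \<forall>j<m. X (\<omega> j) x = 0} \<partial>(\<Pi>\<^sub>M j\<in>{..<m}. P))"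

definition second_moment :: "'w measure \<Rightarrow> ('w \<Rightarrow> 'a \<Rightarrow> real) \<Rightarrow> 'a \<Rightarrow> real" where
  "second_moment P X x = (\<integral>\<omega>. (X \<omega> x)\<^sup>2 \<partial>P)"

text \<open>\<open>moment_map P X v\<close> is \<open>\<langle>\<mu>(x), v\<rangle>\<close> for \<open>v\<close> a tangent vector at \<open>x\<close>; the base point enters only
  through \<open>v\<close>.\<close>

definition moment_map :: "'w measure \<Rightarrow> ('w \<Rightarrow> 'a \<Rightarrow> real) \<Rightarrow> 'a tangent \<Rightarrow> real" where
  "moment_map P X v = differential (\<lambda>y. 1 / 2 * ln (second_moment P X y)) v"

definition adler_taylor_metric ::
    "'w measure \<Rightarrow> ('w \<Rightarrow> 'a \<Rightarrow> real) \<Rightarrow> 'a \<Rightarrow> 'a tangent \<Rightarrow> real" where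
  "adler_taylor_metric P X x v =
     1 / second_moment P X x * (\<integral>\<omega>. (differential (X \<omega>) v)\<^sup>2 \<partial>P) - (moment_map P X v)\<^sup>2"

definition nondegenerate ::
    "('a::topological_space, 'm::finite) chart set \<Rightarrow> 'w measure \<Rightarrow> ('w \<Rightarrow> 'a \<Rightarrow> real) \<Rightarrow> bool" where
  "nondegenerate A P X \<longleftrightarrow> positive_definite_form A (adler_taylor_metric P X)"

definition tau ::
    "'w measure \<Rightarrow> ('w \<Rightarrow> 'a \<Rightarrow> real) \<Rightarrow> ('a \<Rightarrow> real) \<Rightarrow> 'a \<Rightarrow> 'a tangent \<Rightarrow> real" where
  "tau P X f0 x v =
     1 / sqrt (second_moment P X x + (f0 x)\<^sup>2) * (f0 x * moment_map P X v - differential f0 v)"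

definition Psi ::
    "('a::topological_space, 'm::finite) chart set \<Rightarrow> 'w measure \<Rightarrow> ('w \<Rightarrow> 'a \<Rightarrow> real) \<Rightarrow>
     ('a \<Rightarrow> real) \<Rightarrow> 'a \<Rightarrow> real" where
  "Psi A P X f0 x =
     (second_moment P X x / (second_moment P X x + (f0 x)\<^sup>2)) powr (real CARD('m) / 2) *
     sqrt (1 + dual_form A (adler_taylor_metric P X) x (tau P X f0 x))"

text \<open>The dimensional constant is \<open>2 / vol(S\<^sup>m)\<close>, where the unit sphere of \<open>\<real>\<^sup>m\<^sup>+\<^sup>1\<close> has volume
  \<open>(m + 1) * unit_ball_vol (m + 1)\<close>. It is given by a closed term because an existentially
  quantified constant could not be prevented from depending on the type variables of a theorem.\<close>

definition zeros_constant :: "nat \<Rightarrow> real" where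
  "zeros_constant m = 2 / (real (m + 1) * unit_ball_vol (real (m + 1)))"

end

theory Submission
  imports Defs
begin

text \<open>
  Let \<open>h\<close> be the density of expected zeros with respect to coordinate Lebesgue measure. Near a point
  where \<open>f\<^sub>p \<noteq> 0\<close> one divides by \<open>f\<^sub>p\<close>; the common zeros are then the points where the map given by
  the other terms takes the independent Gaussian value of the coefficients of \<open>f\<^sub>p\<close>. Integrating out
  these coefficients with the area formula, and reducing the remaining Gaussian determinant to the
  covariance of value and gradient, gives \<open>h = c\<^sub>m * sqrt (det G)\<close>, where \<open>G\<close> is the Gram matrix of the
  Adler--Taylor metric; so the expected number of zeros is \<open>c\<^sub>m\<close> times the volume of this metric. This
  applies to \<open>X\<close> and to \<open>X\<^sub>0\<close> alike.

  A computation gives \<open>g\<^sub>0 = K / (K + f\<^sub>0\<^sup>2) * (g + \<tau>\<^sup>2)\<close> for the metric \<open>g\<^sub>0\<close> of \<open>X\<^sub>0\<close>, and by the matrix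
  determinant lemma \<open>det (g + \<tau>\<^sup>2) = det g * (1 + g\<^sup>x(\<tau>))\<close>. Hence \<open>\<Psi>\<close> is the ratio of the two volume
  densities.
\<close>

section \<open>Change of variables\<close>

text \<open>The density formula is geometric: the Adler--Taylor metric is the pullback of the round
  metric under x -> [f_1(x) : ... : f_d(x)], and a random system cuts the image with a random
  projective subspace of codimension m. For the functions 1, x_1, ..., x_m the image is projective
  m-space up to a null set and there is almost surely one solution, so c_m is the inverse of the
  volume of this space, which is half the volume of the unit sphere. The mean absolute Gaussian
  determinant is evaluated only through this comparison.

  Two obstacles shape the probabilistic part. The number of zeros is not measurable for the
  sigma-algebra generated by evaluations; on continuous paths it is replaced by a functional of
  countably many values, and for this the zeros are counted over sets that decompose into compact
  ones. Moreover \<open>\<xi>0\<close> is independent of the random function \<open>X\<close>, not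
  of its coefficients, so the transfer to a Gaussian model goes through laws on path space.
  Expectations may be infinite; all integrals stay nonnegative and extended until the final
  subtraction.\<close>

lemma emeasure_isometry_le:
  fixes f :: "'a::euclidean_space \<Rightarrow> 'b::euclidean_space"
  assumes f: "linear f" "\<And>x. norm (f x) = norm x" "surj f" and S: "open S"
  shows "emeasure lborel S \<le> emeasure lborel (f -` S)"
proof -
  have inj: "inj f"
    using f linear_injective_0 by (metis norm_eq_zero)
  have dim: "DIM('a) = DIM('b)"
    using f(1,3) inj by (metis dim_UNIV dim_image_eq inj_on_subset subset_UNIV)
  have dist: "dist (f x) (f y) = dist x y" for x y
    by (simp add: dist_norm f(2) flip: linear_diff[OF f(1)])
  have vball: "f -` ball (f c) r = ball c r" for c r
    by (auto simp: dist)
  have ball: "emeasure lborel (ball a r) = emeasure lborel (f -` ball a r)" for a r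
  proof -
    obtain c where "a = f c" using f(3) by auto
    then show ?thesis
      by (cases "r \<ge> 0") (simp_all add: vball emeasure_ball dim ball_empty)
  qed
  have [measurable]: "f \<in> borel \<rightarrow>\<^sub>M borel"
    using f(1) by (simp add: borel_measurable_continuous_onI linear_continuous_on linear_conv_bounded_linear)
  \<comment> \<open>A ball and its preimage have the same volume, so \<open>S\<close> is filled up
    to a null set by countably many disjoint balls (Vitali). The preimage of the null remainder is
    not yet known to be null, so only an inequality results.\<close>
  let ?K = "{(a, r). r > 0 \<and> ball a r \<subseteq> S}"
  obtain C where C: "countable C" "C \<subseteq> ?K"
    "pairwise (\<lambda>i j. disjnt (ball (fst i) (snd i)) (ball (fst j) (snd j))) C"
    "negligible (S - (\<Union>i\<in>C. ball (fst i) (snd i)))"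
  proof (rule Vitali_covering_theorem_balls[of S ?K fst snd])
    fix x and d :: real assume "x \<in> S" "0 < d"
    moreover obtain e where "e > 0" "ball x e \<subseteq> S" using S \<open>x \<in> S\<close> openE by blast
    ultimately show "\<exists>i. i \<in> ?K \<and> x \<in> ball (fst i) (snd i) \<and> snd i < d"
      by (intro exI[of _ "(x, min e (d/2))"]) auto
  qed blast
  let ?U = "\<Union>i\<in>C. ball (fst i) (snd i)"
  have CS: "?U \<subseteq> S"
  proof (rule UN_least)
    fix i assume "i \<in> C"
    then have "i \<in> ?K" using C(2) by blast
    then show "ball (fst i) (snd i) \<subseteq> S" by (simp add: case_prod_beta)
  qed
  have disj: "disjoint_family_on (\<lambda>i. ball (fst i) (snd i)) C"
    using C(3) unfolding disjoint_family_on_def pairwise_def disjnt_def by auto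
  have disj': "disjoint_family_on (\<lambda>i. f -` ball (fst i) (snd i)) C"
    using disj unfolding disjoint_family_on_def by blast
  have ms: "f -` ball a r \<in> sets lborel" for a r
    using measurable_sets[of f borel borel "ball a r"] by simp
  have "S - ?U \<in> sets lborel"
    using S by (metis (no_types, lifting) borel_open open_UN open_ball sets.Diff sets_lborel)
  then have "S - ?U \<in> null_sets lborel"
    using C(4) null_sets_completion_iff[of "S - ?U" lborel] by (simp add: negligible_iff_null_sets)
  then have "emeasure lborel S = emeasure lborel (S \<inter> ?U)"
    using S by (metis Diff_Diff_Int borel_open emeasure_Diff_null_set sets_lborel)
  also have "S \<inter> ?U = ?U" using CS by blast
  also have "emeasure lborel ?U = (\<integral>\<^sup>+i. emeasure lborel (ball (fst i) (snd i)) \<partial>count_space C)"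
    by (rule emeasure_UN_countable) (use C(1) disj in auto)
  also have "\<dots> = (\<integral>\<^sup>+i. emeasure lborel (f -` ball (fst i) (snd i)) \<partial>count_space C)"
    by (simp add: ball)
  also have "\<dots> = emeasure lborel (\<Union>i\<in>C. f -` ball (fst i) (snd i))"
    by (rule emeasure_UN_countable[symmetric]) (use C(1) disj' ms in auto)
  also have "\<dots> \<le> emeasure lborel (f -` S)"
    by (rule emeasure_mono) (use CS S measurable_sets[of f borel borel S] in \<open>auto simp del: mem_ball\<close>)
  finally show ?thesis .
qed

text \<open>The inequality for open sets, applied to \<open>f\<close> and to its inverse, gives
  equality on boxes, and these determine Lebesgue measure. The two spaces may be different types of
  the same dimension, as for a relabelling of coordinates.\<close>

lemma distr_lborel_isometry:
  fixes f :: "'a::euclidean_space \<Rightarrow> 'b::euclidean_space"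
  assumes f: "linear f" "\<And>x. norm (f x) = norm x" "surj f"
  shows "distr lborel borel f = lborel"
proof (rule lborel_eqI[symmetric])
  have m: "f \<in> borel \<rightarrow>\<^sub>M borel"
    using f(1) by (simp add: borel_measurable_continuous_onI linear_continuous_on linear_conv_bounded_linear)
  have inj: "inj f"
    using f linear_injective_0 by (metis norm_eq_zero)
  define g where "g = inv f"
  have fg: "f (g y) = y" for y using f(3) by (simp add: g_def surj_f_inv_f)
  have gf: "g (f x) = x" for x using inj by (simp add: g_def)
  have g: "linear g"
    using gf[of "g x + g y" for x y] gf[of "c *\<^sub>R g x" for c x] f(1)
    by (intro linearI) (auto simp: linear_add linear_scale fg)
  have gn: "norm (g y) = norm y" for y by (metis f(2) fg)
  have gs: "surj g" by (metis gf surjI)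
  fix l u :: 'b assume lu: "\<And>b. b \<in> Basis \<Longrightarrow> l \<bullet> b \<le> u \<bullet> b"
  have o: "open (f -` box l u)"
    by (rule open_vimage) (use f(1) in \<open>auto simp: linear_continuous_on linear_conv_bounded_linear\<close>)
  have "emeasure lborel (f -` box l u) = emeasure lborel (box l u)"
  proof (rule antisym)
    show "emeasure lborel (f -` box l u) \<le> emeasure lborel (box l u)"
      using emeasure_isometry_le[OF g gn gs o] by (simp add: vimage_def fg)
    show "emeasure lborel (box l u) \<le> emeasure lborel (f -` box l u)"
      by (rule emeasure_isometry_le[OF f open_box])
  qed
  then show "emeasure (distr lborel borel f) (box l u) = (\<Prod>b\<in>Basis. (u - l) \<bullet> b)"
    using m lu by (simp add: emeasure_distr emeasure_lborel_box_eq)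
qed simp

text \<open>The library's change of variables formula is stated for coordinates indexed by a
  well-ordered type.\<close>

typedef 'i indexed = "UNIV :: 'i set" by simp

text \<open>The order is pulled back along an arbitrary injection into the naturals and put on a
  wrapped copy, so that no order is imposed on the index type itself.\<close>

definition index_rank :: "'i::finite indexed \<Rightarrow> nat" where
  "index_rank = (SOME r. inj r)"

lemma inj_index_rank: "inj (index_rank :: 'i::finite indexed \<Rightarrow> nat)"
proof -
  have "finite (UNIV :: 'i indexed set)"
    using type_definition.univ[OF type_definition_indexed] by (metis finite_imageI finite)
  then have "\<exists>r :: 'i indexed \<Rightarrow> nat. inj r"
    using finite_imp_inj_to_nat_seg by blast
  then show ?thesis unfolding index_rank_def by (rule someI_ex)
qed

instance indexed :: (finite) finite
proof
  show "finite (UNIV :: 'a indexed set)"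
    using type_definition.univ[OF type_definition_indexed] by (metis finite_imageI finite)
qed

instantiation indexed :: (finite) wellorder
begin

definition less_eq_indexed :: "'a indexed \<Rightarrow> 'a indexed \<Rightarrow> bool" where
  "less_eq_indexed x y \<longleftrightarrow> index_rank x \<le> index_rank y"

definition less_indexed :: "'a indexed \<Rightarrow> 'a indexed \<Rightarrow> bool" where
  "less_indexed x y \<longleftrightarrow> index_rank x < index_rank y"

instance
proof
  fix x y :: "'a indexed"
  show "x \<le> y \<Longrightarrow> y \<le> x \<Longrightarrow> x = y"
    unfolding less_eq_indexed_def by (rule injD[OF inj_index_rank]) simp
next
  fix P :: "'a indexed \<Rightarrow> bool" and a
  assume *: "\<And>x. (\<And>y. y < x \<Longrightarrow> P y) \<Longrightarrow> P x"
  show "P a"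
  proof (induction a rule: measure_induct_rule[of index_rank])
    case (less x)
    show ?case by (rule *, rule less, simp only: less_indexed_def)
  qed
qed (simp_all only: less_eq_indexed_def less_indexed_def less_le_not_le, auto)

end

section \<open>Relabelling of coordinates\<close>

definition reindex :: "real ^ 'i \<Rightarrow> real ^ 'i indexed" where
  "reindex x = (\<chi> i. x $ Rep_indexed i)"

definition unindex :: "real ^ 'i indexed \<Rightarrow> real ^ 'i" where
  "unindex y = (\<chi> i. y $ Abs_indexed i)"

lemma unindex_reindex [simp]: "unindex (reindex x) = x"
  by (simp add: reindex_def unindex_def vec_eq_iff Abs_indexed_inverse)

lemma reindex_unindex [simp]: "reindex (unindex x) = x"
  by (simp add: reindex_def unindex_def vec_eq_iff Rep_indexed_inverse)

lemma bij_Rep_indexed: "bij Rep_indexed"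
  by (rule bijI') (auto simp: Rep_indexed_inject intro: Abs_indexed_inverse[OF UNIV_I, symmetric])

lemma linear_reindex: "linear reindex"
  by (rule linearI) (auto simp: reindex_def vec_eq_iff)

lemma linear_unindex: "linear unindex"
  by (rule linearI) (auto simp: unindex_def vec_eq_iff)

lemma norm_reindex: "norm (reindex x) = norm (x :: real ^ 'i::finite)"
  unfolding norm_vec_def L2_set_def reindex_def
  by (simp add: sum.reindex_bij_betw[OF bij_Rep_indexed, of "\<lambda>i. \<bar>x $ i\<bar>^2", simplified])

lemma norm_unindex: "norm (unindex x) = norm (x :: real ^ 'i::finite indexed)"
  by (metis norm_reindex reindex_unindex)

lemma distr_lborel_unindex: "distr lborel borel (unindex :: real ^ 'i::finite indexed \<Rightarrow> _) = lborel"
  by (rule distr_lborel_isometry[OF linear_unindex norm_unindex]) (metis unindex_reindex surjI)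

text \<open>Conjugation by the relabelling bijection maps the permutations of one index set onto
  those of the other and preserves signs, so the Leibniz sums agree term by term.\<close>

lemma det_reindex:
  fixes A :: "real ^ 'i::finite ^ 'i"
  shows "det (\<chi> i j. A $ Rep_indexed i $ Rep_indexed j) = det A"
proof -
  let ?m = "map_permutation (UNIV :: 'i indexed set) Rep_indexed"
  let ?p = "map_permutation (UNIV :: 'i set) Abs_indexed"
  have R: "bij_betw Rep_indexed UNIV (UNIV :: 'i set)" by (rule bij_Rep_indexed)
  have A: "bij_betw Abs_indexed (UNIV :: 'i set) UNIV"
    by (rule bijI') (auto simp: Abs_indexed_inject intro: Rep_indexed_inverse[symmetric])
  have eq: "of_int (sign q) * (\<Prod>i\<in>UNIV. (\<chi> i j. A $ Rep_indexed i $ Rep_indexed j) $ i $ q i) =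
      of_int (sign (?m q)) * (\<Prod>i\<in>UNIV. A $ i $ ?m q i)" if "q permutes UNIV" for q
  proof -
    have "?m q (Rep_indexed i) = Rep_indexed (q i)" for i
      by (rule map_permutation_apply) (use R in \<open>auto simp: bij_betw_def\<close>)
    then have "(\<Prod>i\<in>UNIV. A $ i $ ?m q i) = (\<Prod>i\<in>UNIV. A $ Rep_indexed i $ Rep_indexed (q i))"
      using prod.reindex_bij_betw[OF R, of "\<lambda>i. A $ i $ ?m q i"] by simp
    moreover have "sign (?m q) = sign q"
      by (rule sign_map_permutation) (use R that in \<open>auto simp: bij_betw_def\<close>)
    ultimately show ?thesis by simp
  qed
  show ?thesis unfolding det_def
  proof (rule sum.reindex_bij_witness[of _ ?p ?m])
    fix q :: "'i indexed \<Rightarrow> 'i indexed" assume q: "q \<in> {p. p permutes UNIV}"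
    then show "?p (?m q) = q"
      by (intro map_permutation_compose_inv[OF R]) (auto simp: Rep_indexed_inverse)
    show "?m q \<in> {p. p permutes UNIV}"
      using map_permutation_permutes[OF R] q by auto
    show "of_int (sign (?m q)) * (\<Prod>i\<in>UNIV. A $ i $ ?m q i) =
       of_int (sign q) * (\<Prod>i\<in>UNIV. (\<chi> i j. A $ Rep_indexed i $ Rep_indexed j) $ i $ q i)"
      using eq q by simp
  next
    fix q :: "'i \<Rightarrow> 'i" assume q: "q \<in> {p. p permutes UNIV}"
    then show "?m (?p q) = q"
      by (intro map_permutation_compose_inv[OF A]) (auto simp: Abs_indexed_inverse)
    show "?p q \<in> {p. p permutes UNIV}"
      using map_permutation_permutes[OF A] q by auto
  qed
qed

text \<open>The underlying theorem is an equivalence: the image has finite measure \<open>r\<close>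
  exactly if the absolute Jacobian has integral \<open>r\<close>. Hence an infinite value on one
  side forces an infinite value on the other, and the equation holds in the extended sense.\<close>

lemma emeasure_image_indexed:
  fixes h :: "real ^ 'n::{finite,wellorder} \<Rightarrow> real ^ 'n::{finite,wellorder}"
  assumes S: "S \<in> sets borel" and hS: "h ` S \<in> sets borel"
    and der: "\<And>x. x \<in> S \<Longrightarrow> (h has_derivative (\<lambda>v. J x *v v)) (at x)"
    and J: "J \<in> borel_measurable (restrict_space borel S)"
    and inj: "inj_on h S"
  shows "emeasure lborel (h ` S) = (\<integral>\<^sup>+x. ennreal \<bar>det (J x)\<bar> * indicator S x \<partial>lborel)"
proof -
  have m: "(\<lambda>x. \<bar>det (J x)\<bar> * indicator S x) \<in> borel_measurable borel"
  proof -
    have "continuous_on UNIV (\<lambda>A :: real^'n::{finite,wellorder}^'n::{finite,wellorder}. det A)"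
      unfolding det_def by (intro continuous_intros)
    then have "(\<lambda>x. det (J x)) \<in> borel_measurable (restrict_space borel S)"
      by (rule measurable_compose[OF J borel_measurable_continuous_onI])
    then show ?thesis
      using S borel_measurable_abs[of "\<lambda>x. det (J x) * indicator S x" borel]
      by (simp add: borel_measurable_restrict_space_iff mult.commute abs_mult)
  qed
  have der': "(h has_derivative (\<lambda>v. J x *v v)) (at x within S)" if "x \<in> S" for x
    using der[OF that] by (rule has_derivative_at_withinI)
  have iff: "h ` S \<in> lmeasurable \<and> measure lebesgue (h ` S) = r \<longleftrightarrow>
      ((\<lambda>x. \<bar>det (J x)\<bar>) has_integral r) S" for r
    using has_measure_differentiable_image[OF _ der' inj] S by simp
  have iff2: "((\<lambda>x. \<bar>det (J x)\<bar>) has_integral r) S \<longleftrightarrow>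
      (\<integral>\<^sup>+x. ennreal (\<bar>det (J x)\<bar> * indicator S x) \<partial>lborel) = ennreal r \<and> 0 \<le> r" for r
  proof -
    have "((\<lambda>x. \<bar>det (J x)\<bar>) has_integral r) S \<longleftrightarrow> ((\<lambda>x. \<bar>det (J x)\<bar> * indicator S x) has_integral r) UNIV"
    proof -
      have "(\<lambda>x. \<bar>det (J x)\<bar> * indicator S x) = (\<lambda>x. if x \<in> S then \<bar>det (J x)\<bar> else 0)"
        by auto
      then show ?thesis by (simp only: has_integral_restrict_UNIV)
    qed
    also have "\<dots> \<longleftrightarrow> (\<integral>\<^sup>+x. ennreal (\<bar>det (J x)\<bar> * indicator S x) \<partial>lborel) = ennreal r \<and> 0 \<le> r"
      using m by (subst has_integral_iff_nn_integral_lebesgue)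
        (simp_all add: nn_integral_completion measurable_completion)
    finally show ?thesis .
  qed
  have eq: "(\<integral>\<^sup>+x. ennreal (\<bar>det (J x)\<bar> * indicator S x) \<partial>lborel) =
      (\<integral>\<^sup>+x. ennreal \<bar>det (J x)\<bar> * indicator S x \<partial>lborel)"
    by (intro nn_integral_cong) (auto split: split_indicator)
  show ?thesis
  proof (cases "(\<integral>\<^sup>+x. ennreal (\<bar>det (J x)\<bar> * indicator S x) \<partial>lborel)")
    case (real r)
    then have "h ` S \<in> lmeasurable" "measure lebesgue (h ` S) = r"
      using iff[of r] iff2[of r] by blast+
    then have "emeasure lebesgue (h ` S) = ennreal r"
      by (simp add: emeasure_eq_measure2)
    then show ?thesis using eq real hS by simp
  next
    case top
    then have "\<not> h ` S \<in> lmeasurable"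
      using iff iff2 by (metis ennreal_neq_top)
    then have "emeasure lborel (h ` S) = \<infinity>"
      using hS by (simp add: fmeasurable_def less_top[symmetric])
    then show ?thesis using eq top by simp
  qed
qed

lemma det_matrix_reindex:
  fixes A :: "real ^ 'i::finite ^ 'i"
  shows "(\<lambda>v. reindex (A *v unindex v)) = (\<lambda>v. (\<chi> i j. A $ Rep_indexed i $ Rep_indexed j) *v v)"
proof
  fix v :: "real ^ 'i indexed"
  show "reindex (A *v unindex v) = (\<chi> i j. A $ Rep_indexed i $ Rep_indexed j) *v v"
    unfolding reindex_def unindex_def matrix_vector_mult_def vec_eq_iff
    using sum.reindex_bij_betw[OF bij_Rep_indexed, of "\<lambda>j. A $ Rep_indexed i $ j * v $ Abs_indexed j" for i]
    by (simp add: Rep_indexed_inverse)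
qed

lemma measurable_reindex [measurable]: "reindex \<in> borel \<rightarrow>\<^sub>M borel"
  "unindex \<in> borel \<rightarrow>\<^sub>M borel" for dummy :: "'i::finite"
  by (auto intro!: borel_measurable_continuous_onI linear_continuous_on
      simp: linear_reindex linear_unindex linear_conv_bounded_linear[symmetric])

text \<open>Conjugation with \<open>unindex\<close> preserves Lebesgue measure on both sides and
  does not change the Jacobian determinant.\<close>

lemma emeasure_image:
  fixes h :: "real ^ 'm::finite \<Rightarrow> real ^ 'm"
  assumes S: "S \<in> sets borel" and hS: "h ` S \<in> sets borel"
    and der: "\<And>x. x \<in> S \<Longrightarrow> (h has_derivative (\<lambda>v. J x *v v)) (at x)"
    and J: "J \<in> borel_measurable (restrict_space borel S)"
    and inj: "inj_on h S"
  shows "emeasure lborel (h ` S) = (\<integral>\<^sup>+x. ennreal \<bar>det (J x)\<bar> * indicator S x \<partial>lborel)"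
proof -
  define k where "k = reindex \<circ> h \<circ> unindex"
  define T where "T = unindex -` S"
  define L where "L y = (\<chi> i j. J (unindex y) $ Rep_indexed i $ Rep_indexed j)" for y
  have T: "T \<in> sets borel"
    unfolding T_def using measurable_sets[OF measurable_reindex(2) S] by simp
  have kT: "k ` T = reindex ` (h ` S)"
  proof -
    have "k ` T = reindex ` (h ` (unindex ` T))" by (simp add: k_def image_comp o_assoc)
    also have "unindex ` T = S" unfolding T_def
      by (rule surj_image_vimage_eq) (metis unindex_reindex surjI)
    finally show ?thesis .
  qed
  have img: "k ` T = unindex -` (h ` S)"
    unfolding kT
  proof (intro set_eqI iffI)
    fix y assume "y \<in> unindex -` (h ` S)"
    then show "y \<in> reindex ` (h ` S)" by (metis image_eqI reindex_unindex vimageD)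
  qed auto
  have m: "unindex \<in> restrict_space borel T \<rightarrow>\<^sub>M restrict_space borel S"
    by (rule measurable_restrict_space3) (auto simp: T_def)
  have "emeasure lborel (k ` T) = (\<integral>\<^sup>+x. ennreal \<bar>det (L x)\<bar> * indicator T x \<partial>lborel)"
  proof (rule emeasure_image_indexed)
    show "k ` T \<in> sets borel"
      unfolding img using measurable_sets[OF measurable_reindex(2) hS] by simp
    show "inj_on k T"
    proof (rule inj_onI)
      fix x y assume xy: "x \<in> T" "y \<in> T" "k x = k y"
      then have "unindex (k x) = unindex (k y)" by simp
      then have "unindex x = unindex y"
        using inj xy unfolding k_def T_def inj_on_def by auto
      then show "x = y" by (metis reindex_unindex)
    qed
    fix x assume x: "x \<in> T"
    have "(h has_derivative (\<lambda>v. J (unindex x) *v v)) (at (unindex x))"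
      using der x by (auto simp: T_def)
    then have "(h \<circ> unindex has_derivative (\<lambda>v. J (unindex x) *v unindex v)) (at x)"
      using diff_chain_at[of unindex unindex x h "\<lambda>v. J (unindex x) *v v"]
      by (simp add: o_def linear_imp_has_derivative linear_unindex)
    then have "(k has_derivative (\<lambda>v. reindex (J (unindex x) *v unindex v))) (at x)"
      unfolding k_def
      using diff_chain_at[of "h \<circ> unindex" _ x reindex reindex]
      by (simp add: o_def linear_imp_has_derivative linear_reindex)
    then show "(k has_derivative (\<lambda>v. L x *v v)) (at x)"
      by (simp add: det_matrix_reindex L_def)
  next
    have c: "continuous_on UNIV (\<lambda>A :: real^'m^'m. \<chi> i j. A $ Rep_indexed i $ Rep_indexed j)"
      by (intro continuous_on_vec_lambda continuous_intros)
    show "L \<in> borel_measurable (restrict_space borel T)"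
      unfolding L_def
      by (rule measurable_compose[OF measurable_compose[OF m J] borel_measurable_continuous_onI[OF c]])
  qed (rule T)
  also have "emeasure lborel (k ` T) = emeasure (distr lborel borel unindex) (h ` S)"
    unfolding img using hS by (simp add: emeasure_distr)
  also have "\<dots> = emeasure lborel (h ` S)" by (simp add: distr_lborel_unindex)
  also have "(\<integral>\<^sup>+x. ennreal \<bar>det (L x)\<bar> * indicator T x \<partial>lborel) =
      (\<integral>\<^sup>+x. ennreal \<bar>det (J (unindex x))\<bar> * indicator S (unindex x) \<partial>lborel)"
    by (intro nn_integral_cong) (simp add: L_def det_reindex T_def indicator_def)
  also have "\<dots> = (\<integral>\<^sup>+x. ennreal \<bar>det (J x)\<bar> * indicator S x \<partial>distr lborel borel unindex)"
  proof -
    have "continuous_on UNIV (\<lambda>A :: real^'m^'m. \<bar>det A\<bar>)"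
      unfolding det_def by (intro continuous_intros)
    then have "(\<lambda>x. \<bar>det (J x)\<bar>) \<in> borel_measurable (restrict_space borel S)"
      by (rule measurable_compose[OF J borel_measurable_continuous_onI])
    then have "(\<lambda>x. ennreal \<bar>det (J x)\<bar> * indicator S x) \<in> borel_measurable borel"
      using S measurable_restrict_space_iff[of S borel "0::ennreal" borel "\<lambda>x. ennreal \<bar>det (J x)\<bar>"]
      by (simp add: indicator_def of_bool_def if_distrib[of "\<lambda>u. _ * u"] cong: if_cong)
    then show ?thesis by (subst nn_integral_distr) simp_all
  qed
  also have "\<dots> = (\<integral>\<^sup>+x. ennreal \<bar>det (J x)\<bar> * indicator S x \<partial>lborel)"
    by (simp add: distr_lborel_unindex)
  finally show ?thesis .
qed

text \<open>Sard's theorem for equal dimensions, where differentiability is enough. The negligible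
  set is carried back by \<open>unindex\<close>, a differentiable map between spaces of the same
  dimension.\<close>

lemma negligible_critical_values:
  fixes h :: "real ^ 'm::finite \<Rightarrow> real ^ 'm"
  assumes der: "\<And>x. x \<in> S \<Longrightarrow> (h has_derivative (\<lambda>v. J x *v v)) (at x)"
    and crit: "\<And>x. x \<in> S \<Longrightarrow> det (J x) = 0"
  shows "negligible (h ` S)"
proof -
  define k where "k = reindex \<circ> h \<circ> unindex"
  define T where "T = unindex -` S"
  define L where "L y = (\<chi> i j. J (unindex y) $ Rep_indexed i $ Rep_indexed j)" for y
  have "negligible (k ` T)"
  proof (rule baby_Sard[where f' = "\<lambda>x v. L x *v v"])
    fix x assume x: "x \<in> T"
    have "(h has_derivative (\<lambda>v. J (unindex x) *v v)) (at (unindex x))"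
      using der x by (auto simp: T_def)
    then have "(h \<circ> unindex has_derivative (\<lambda>v. J (unindex x) *v unindex v)) (at x)"
      using diff_chain_at[of unindex unindex x h "\<lambda>v. J (unindex x) *v v"]
      by (simp add: o_def linear_imp_has_derivative linear_unindex)
    then have "(k has_derivative (\<lambda>v. reindex (J (unindex x) *v unindex v))) (at x)"
      unfolding k_def
      using diff_chain_at[of "h \<circ> unindex" _ x reindex reindex]
      by (simp add: o_def linear_imp_has_derivative linear_reindex)
    then show "(k has_derivative (\<lambda>v. L x *v v)) (at x within T)"
      unfolding det_matrix_reindex L_def by (rule has_derivative_at_withinI)
    have "det (L x) = 0" using crit x by (simp add: L_def det_reindex T_def)
    then show "rank (matrix (\<lambda>v. L x *v v)) < CARD('m indexed)"
      by (simp add: det_eq_0_rank)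
  qed simp
  then have "negligible (unindex ` (k ` T))"
  proof (rule negligible_differentiable_image_negligible[rotated])
    have c: "CARD('m indexed) = CARD('m)"
      using bij_betw_same_card[OF bij_Rep_indexed] by simp
    show "DIM((real, 'm indexed) vec) \<le> DIM((real, 'm) vec)" by (simp add: c)
    show "unindex differentiable_on k ` T"
      by (simp add: linear_imp_differentiable_on linear_unindex)
  qed
  also have "unindex ` (k ` T) = h ` (unindex ` T)"
    by (simp add: k_def image_image)
  also have "unindex ` T = S" unfolding T_def
    by (rule surj_image_vimage_eq) (metis unindex_reindex surjI)
  finally show ?thesis .
qed

section \<open>Local inversion and the area formula\<close>

lemma continuous_on_det [continuous_intros]:
  fixes f :: "'a::topological_space \<Rightarrow> real ^ 'm::finite ^ 'm"
  assumes "continuous_on S f"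
  shows "continuous_on S (\<lambda>x. det (f x))"
proof -
  have "continuous_on UNIV (\<lambda>A :: real ^ 'm ^ 'm. det A)"
    unfolding det_def by (intro continuous_intros)
  from continuous_on_compose2[OF this assms] show ?thesis by simp
qed

lemma continuous_on_matrix_vector [continuous_intros]:
  fixes f :: "'a::topological_space \<Rightarrow> real ^ 'm::finite ^ 'n::finite"
  assumes "continuous_on S f"
  shows "continuous_on S (\<lambda>x. f x *v v)"
proof -
  have "continuous_on UNIV (\<lambda>A :: real ^ 'm ^ 'n. A *v v)"
    unfolding matrix_vector_mult_def by (intro continuous_on_vec_lambda continuous_intros)
  from continuous_on_compose2[OF this assms] show ?thesis by simp
qed

lemma locally_invertible:
  fixes h :: "real ^ 'm::finite \<Rightarrow> real ^ 'm"
  assumes V: "open V" and der: "\<And>x. x \<in> V \<Longrightarrow> (h has_derivative (\<lambda>v. J x *v v)) (at x)"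
    and J: "continuous_on V J" and x: "x \<in> V" and det: "det (J x) \<noteq> 0"
  obtains U g where "open U" "U \<subseteq> V" "x \<in> U" "open (h ` U)" "homeomorphism U (h ` U) h g"
proof -
  \<comment> \<open>The inverse function theorem takes the derivative as a continuous map into the
    space of bounded linear operators; continuity there is checked on single vectors, which suffices
    in finite dimension.\<close>
  define h' where "h' y = Blinfun (\<lambda>v. J y *v v)" for y
  have app: "blinfun_apply (h' y) = (\<lambda>v. J y *v v)" for y
    unfolding h'_def by (rule bounded_linear_Blinfun_apply) (simp add: matrix_vector_mul_bounded_linear)
  obtain L where L: "L ** J x = mat 1"
    using det by (metis invertible_det_nz invertible_def)
  define invf where "invf = Blinfun (\<lambda>v. L *v v)"
  have app2: "blinfun_apply invf = (\<lambda>v. L *v v)"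
    unfolding invf_def by (rule bounded_linear_Blinfun_apply) (simp add: matrix_vector_mul_bounded_linear)
  have inv: "invf o\<^sub>L h' x = id_blinfun"
    by (rule blinfun_eqI) (simp add: app app2 matrix_vector_mul_assoc L)
  have cont: "continuous_on V h'"
    by (rule continuous_blinfun_componentwiseI1 continuous_on_blinfun_componentwise)
      (auto simp: app intro!: continuous_intros J)
  have der': "(h has_derivative blinfun_apply (h' y)) (at y)" if "y \<in> V" for y
    using der[OF that] by (simp add: app)
  obtain U W g g' where "open U" "U \<subseteq> V" "x \<in> U" "open W" "h x \<in> W" "homeomorphism U W h g"
    by (rule inverse_function_theorem[OF V der' cont x inv]) blast+
  moreover from this have "W = h ` U" by (metis homeomorphism_image1)
  ultimately show ?thesis using that by blast
qed

text \<open>The volume formula for images says that the density \<open>\<bar>det (J x)\<bar>\<close>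
  on \<open>U\<close> is pushed forward by \<open>h\<close> to Lebesgue measure on the image. The
  formula for integrals is this equality of measures, integrated.\<close>

lemma change_of_variables_homeomorphism:
  fixes h :: "real ^ 'm::finite \<Rightarrow> real ^ 'm"
  assumes U: "open U" and hU: "open (h ` U)" and hom: "homeomorphism U (h ` U) h g"
    and der: "\<And>x. x \<in> U \<Longrightarrow> (h has_derivative (\<lambda>v. J x *v v)) (at x)"
    and J: "continuous_on U J"
    and F: "F \<in> borel_measurable borel"
  shows "(\<integral>\<^sup>+z. F z * indicator (h ` U) z \<partial>lborel) =
     (\<integral>\<^sup>+x. F (h x) * ennreal \<bar>det (J x)\<bar> * indicator U x \<partial>lborel)"
proof -
  have Jm: "J \<in> borel_measurable (restrict_space borel U)"
    by (rule borel_measurable_continuous_on_restrict[OF J])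
  have inj: "inj_on h U"
    by (rule inj_on_inverseI[of _ g]) (use hom in \<open>simp add: homeomorphism_def\<close>)
  \<comment> \<open>A global Borel extension of \<open>h\<close>; its values outside
    \<open>U\<close> carry no mass under the density \<open>D\<close>.\<close>
  define k where "k x = (if x \<in> U then h x else 0)" for x
  define D where "D x = ennreal \<bar>det (J x)\<bar> * indicator U x" for x
  have conth: "continuous_on U h" using hom by (simp add: homeomorphism_def)
  have k [measurable]: "k \<in> borel \<rightarrow>\<^sub>M borel"
    unfolding k_def by (rule borel_measurable_continuous_on_if[OF _ conth]) (use U in auto)
  have cd: "continuous_on U (\<lambda>x. \<bar>det (J x)\<bar>)"
    by (intro continuous_intros J)
  have D [measurable]: "D \<in> borel_measurable borel"
  proof -
    have "(\<lambda>x. if x \<in> U then \<bar>det (J x)\<bar> else 0) \<in> borel_measurable borel"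
      by (rule borel_measurable_continuous_on_if[OF _ cd]) (use U in auto)
    then have "(\<lambda>x. ennreal (if x \<in> U then \<bar>det (J x)\<bar> else 0)) \<in> borel_measurable borel"
      by measurable
    also have "(\<lambda>x. ennreal (if x \<in> U then \<bar>det (J x)\<bar> else 0)) = D"
      by (auto simp: D_def fun_eq_iff)
    finally show ?thesis .
  qed
  have Fm [measurable]: "F \<in> borel_measurable borel" by (rule F)
  have eq: "distr (density lborel D) borel k = density lborel (indicator (h ` U))"
  proof (rule measure_eqI)
    fix A :: "(real ^ 'm) set" assume "A \<in> sets (distr (density lborel D) borel k)"
    then have A [measurable]: "A \<in> sets borel" by simp
    let ?S = "U \<inter> h -` A"
    have "?S = U \<inter> k -` A" by (auto simp: k_def)
    then have S: "?S \<in> sets borel"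
      using U measurable_sets[OF k A] by auto
    have im: "h ` ?S = A \<inter> h ` U" by auto
    have "emeasure (distr (density lborel D) borel k) A = (\<integral>\<^sup>+x. D x * indicator (k -` A) x \<partial>lborel)"
      using measurable_sets[OF k A] by (simp add: emeasure_distr emeasure_density)
    also have "\<dots> = (\<integral>\<^sup>+x. ennreal \<bar>det (J x)\<bar> * indicator ?S x \<partial>lborel)"
      by (intro nn_integral_cong) (auto simp: D_def k_def split: split_indicator)
    also have "\<dots> = emeasure lborel (h ` ?S)"
    proof (rule emeasure_image[symmetric])
      show "h ` ?S \<in> sets borel" unfolding im using hU by auto
      show "J \<in> borel_measurable (restrict_space borel ?S)"
        using Jm by (rule measurable_restrict_mono) auto
      show "inj_on h ?S" using inj by (rule inj_on_subset) auto
    qed (use S der in auto)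
    also have "\<dots> = emeasure (density lborel (indicator (h ` U))) A"
      unfolding im using hU by (simp add: emeasure_density Int_commute flip: indicator_inter_arith)
    finally show "emeasure (distr (density lborel D) borel k) A = emeasure (density lborel (indicator (h ` U))) A" .
  qed simp
  have "(\<integral>\<^sup>+z. F z * indicator (h ` U) z \<partial>lborel) = (\<integral>\<^sup>+z. F z \<partial>density lborel (indicator (h ` U)))"
    using hU by (subst nn_integral_density) (auto simp: mult.commute)
  also have "\<dots> = (\<integral>\<^sup>+x. D x * F (k x) \<partial>lborel)"
    unfolding eq[symmetric] by (simp add: nn_integral_distr nn_integral_density)
  also have "\<dots> = (\<integral>\<^sup>+x. F (h x) * ennreal \<bar>det (J x)\<bar> * indicator U x \<partial>lborel)"
    by (intro nn_integral_cong) (auto simp: D_def k_def mult_ac split: split_indicator)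
  finally show ?thesis .
qed

text \<open>The regular points are covered by countably many open sets on which \<open>h\<close> is
  a homeomorphism onto an open image, and there the formula is a change of variables. Critical
  points contribute to neither side: their values form a null set by Sard, and their Jacobian
  vanishes.\<close>

lemma area_formula:
  fixes h :: "real ^ 'm::finite \<Rightarrow> real ^ 'm"
  assumes V: "open V" and B: "B \<in> sets borel" "B \<subseteq> V"
    and der: "\<And>x. x \<in> V \<Longrightarrow> (h has_derivative (\<lambda>v. J x *v v)) (at x)"
    and J: "continuous_on V J"
    and \<rho> [measurable]: "\<rho> \<in> borel_measurable borel"
  shows "(\<integral>\<^sup>+z. \<rho> z * emeasure (count_space UNIV) {x \<in> B. h x = z} \<partial>lborel) =
     (\<integral>\<^sup>+x. \<rho> (h x) * ennreal \<bar>det (J x)\<bar> * indicator B x \<partial>lborel)"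
proof -
  define R where "R = {x \<in> V. det (J x) \<noteq> 0}"
  let ?C = "{x \<in> V. det (J x) = 0}"
  define \<F> where "\<F> = {U. open U \<and> U \<subseteq> R \<and> open (h ` U) \<and> (\<exists>g. homeomorphism U (h ` U) h g)}"
  have cd: "continuous_on V (\<lambda>x. det (J x))"
    by (intro continuous_intros J)
  have R: "open R"
  proof -
    have "R = V \<inter> (\<lambda>x. det (J x)) -` (- {0})" by (auto simp: R_def)
    then show ?thesis using continuous_open_preimage[OF cd V, of "- {0}"] by (simp add: open_Compl)
  qed
  have un: "\<Union>\<F> = R"
  proof
    show "R \<subseteq> \<Union>\<F>"
    proof
      fix x assume x: "x \<in> R"
      obtain U g where "open U" "U \<subseteq> R" "x \<in> U" "open (h ` U)" "homeomorphism U (h ` U) h g"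
        by (rule locally_invertible[OF R _ continuous_on_subset[OF J] x])
          (use x der in \<open>auto simp: R_def\<close>)
      then show "x \<in> \<Union>\<F>" unfolding \<F>_def by blast
    qed
  qed (auto simp: \<F>_def)
  obtain \<G> where \<G>: "\<G> \<subseteq> \<F>" "countable \<G>" "\<Union>\<G> = R"
    using Lindelof[of \<F>] un unfolding \<F>_def by (metis (no_types, lifting) mem_Collect_eq)
  \<comment> \<open>The empty set is adjoined so that the enumeration exists even if there are no
    regular points.\<close>
  define U where "U = from_nat_into (insert {} \<G>)"
  have rU: "range U = insert {} \<G>"
    unfolding U_def by (rule range_from_nat_into) (use \<G> in auto)
  have UF: "U k \<in> \<F>" for k
  proof -
    have "{} \<in> \<F>" by (auto simp: \<F>_def homeomorphism_def)
    moreover have "U k \<in> insert {} \<G>" unfolding rU[symmetric] by simp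
    ultimately show ?thesis using \<G>(1) by auto
  qed
  then have "\<forall>k. \<exists>g. homeomorphism (U k) (h ` U k) h g" by (simp add: \<F>_def)
  then have "\<exists>g. \<forall>k. homeomorphism (U k) (h ` U k) h (g k)" by (rule choice)
  then obtain g where g: "\<And>k. homeomorphism (U k) (h ` U k) h (g k)" by blast
  have oU: "open (U k)" "open (h ` U k)" "U k \<subseteq> R" for k using UF[of k] unfolding \<F>_def by auto
  define Q where "Q k = B \<inter> disjointed U k" for k
  have Qm [measurable]: "Q k \<in> sets borel" for k
  proof -
    have "range U \<subseteq> sets borel" using oU by auto
    then have "disjointed U k \<in> sets borel"
      using sets.range_disjointed_sets[of U borel] by auto
    then show ?thesis unfolding Q_def using B by auto
  qed
  have QU: "Q k \<subseteq> U k" for k unfolding Q_def using disjointed_subset[of U k] by blast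
  have disjQ: "disjoint_family Q"
    using disjoint_family_disjointed[of U] unfolding Q_def disjoint_family_on_def by blast
  have UQ: "(\<Union>k. Q k) = B \<inter> R"
    unfolding Q_def using \<G>(3) rU by (simp flip: Int_UN_distrib add: UN_disjointed_eq)
  have QB: "x \<in> B \<Longrightarrow> x \<in> R \<Longrightarrow> \<exists>k. x \<in> Q k" for x using UQ by blast
  \<comment> \<open>The number, 0 or 1, of preimages of \<open>z\<close> in \<open>Q k\<close>,
    written with the local inverse. In this form it is visibly Borel; the full count agrees with the
    sum of these off the critical values.\<close>
  define G where "G k z = (indicator (h ` U k) z * indicator (Q k) (g k z) :: ennreal)" for k z
  have Gm [measurable]: "(\<lambda>z. (G k z :: ennreal)) \<in> borel_measurable borel" for k
  proof -
    have "continuous_on (h ` U k) (g k)" using g[of k] by (simp add: homeomorphism_def)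
    then have "(\<lambda>z. if z \<in> h ` U k then g k z else 0) \<in> borel \<rightarrow>\<^sub>M borel"
      by (rule borel_measurable_continuous_on_if[rotated]) (use oU in auto)
    then have "(\<lambda>z. indicator (Q k) (if z \<in> h ` U k then g k z else 0) :: ennreal) \<in> borel_measurable borel"
      by measurable
    then have "(\<lambda>z. indicator (h ` U k) z * indicator (Q k) (if z \<in> h ` U k then g k z else 0) :: ennreal)
        \<in> borel_measurable borel"
      using oU(2)[of k] by (intro borel_measurable_times_ennreal) auto
    also have "(\<lambda>z. indicator (h ` U k) z * indicator (Q k) (if z \<in> h ` U k then g k z else 0) :: ennreal) = G k"
      by (auto simp: G_def fun_eq_iff split: split_indicator)
    finally show ?thesis .
  qed
  have cnt: "emeasure (count_space UNIV) {x \<in> Q k. h x = z} = G k z" for k z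
  proof (cases "\<exists>x\<in>Q k. h x = z")
    case True
    then obtain x where x: "x \<in> Q k" "h x = z" by blast
    have gx: "g k z = x" using x QU g[of k] by (metis homeomorphism_apply1 subsetD)
    have "{x \<in> Q k. h x = z} = {x}"
    proof -
      have "y = x" if "y \<in> Q k" "h y = z" for y
        using that gx QU g[of k] by (metis homeomorphism_apply1 subsetD)
      then show ?thesis using x by blast
    qed
    moreover have "z \<in> h ` U k" using x QU by blast
    ultimately show ?thesis using x gx by (simp add: G_def)
  next
    case False
    then have "{x \<in> Q k. h x = z} = {}" by blast
    moreover have "G k z = 0"
    proof (rule ccontr)
      assume "G k z \<noteq> 0"
      then have "z \<in> h ` U k" "g k z \<in> Q k" by (auto simp: G_def split: split_indicator_asm)
      then have "h (g k z) = z" using g[of k] by (metis homeomorphism_apply2)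
      then show False using False \<open>g k z \<in> Q k\<close> by blast
    qed
    ultimately show ?thesis by (simp only: emeasure_empty)
  qed
  have "negligible (h ` ?C)"
    by (rule negligible_critical_values[where J = J]) (use der in auto)
  then have "AE z in lebesgue. z \<notin> h ` ?C"
    by (simp add: negligible_iff_null_sets AE_not_in)
  then have AE: "AE z in lborel. z \<notin> h ` ?C"
    by (simp only: AE_completion_iff)
  have count: "emeasure (count_space UNIV) {x \<in> B. h x = z} = (\<Sum>k. G k z)" if z: "z \<notin> h ` ?C" for z
  proof -
    have "{x \<in> B. h x = z} = (\<Union>k. {x \<in> Q k. h x = z})"
    proof -
      have "x \<in> R" if "x \<in> B" "h x = z" for x
        using z that B(2) unfolding R_def by blast
      then show ?thesis using QB UQ by blast
    qed
    also have "emeasure (count_space UNIV) \<dots> = (\<Sum>k. emeasure (count_space UNIV) {x \<in> Q k. h x = z})"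
      by (rule suminf_emeasure[symmetric]) (use disjQ in \<open>auto simp: disjoint_family_on_def\<close>)
    finally show ?thesis by (simp add: cnt)
  qed
  have "(\<integral>\<^sup>+z. \<rho> z * emeasure (count_space UNIV) {x \<in> B. h x = z} \<partial>lborel) =
      (\<integral>\<^sup>+z. (\<Sum>k. \<rho> z * G k z) \<partial>lborel)"
    using AE by (intro nn_integral_cong_AE) (auto simp: count ennreal_suminf_cmult)
  also have "\<dots> = (\<Sum>k. \<integral>\<^sup>+z. \<rho> z * G k z \<partial>lborel)"
    by (rule nn_integral_suminf) simp
  also have "\<dots> = (\<Sum>k. \<integral>\<^sup>+x. \<rho> (h x) * ennreal \<bar>det (J x)\<bar> * indicator (Q k) x \<partial>lborel)"
  proof (rule suminf_cong)
    fix k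
    have der': "\<And>x. x \<in> U k \<Longrightarrow> (h has_derivative (\<lambda>v. J x *v v)) (at x)"
      using der oU(3)[of k] by (auto simp: R_def)
    have J': "continuous_on (U k) J"
      using J by (rule continuous_on_subset) (use oU(3)[of k] in \<open>auto simp: R_def\<close>)
    have "(\<integral>\<^sup>+z. \<rho> z * G k z \<partial>lborel) = (\<integral>\<^sup>+z. (\<rho> z * G k z) * indicator (h ` U k) z \<partial>lborel)"
      by (intro nn_integral_cong) (auto simp: G_def split: split_indicator)
    also have "\<dots> = (\<integral>\<^sup>+x. (\<rho> (h x) * G k (h x)) * ennreal \<bar>det (J x)\<bar> * indicator (U k) x \<partial>lborel)"
      by (rule change_of_variables_homeomorphism[OF oU(1,2) g der' J']) simp_all
    also have "\<dots> = (\<integral>\<^sup>+x. \<rho> (h x) * ennreal \<bar>det (J x)\<bar> * indicator (Q k) x \<partial>lborel)"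
    proof (intro nn_integral_cong)
      fix x
      have "g k (h x) = x" if "x \<in> U k" using that g[of k] by (metis homeomorphism_apply1)
      then show "(\<rho> (h x) * G k (h x)) * ennreal \<bar>det (J x)\<bar> * indicator (U k) x =
          \<rho> (h x) * ennreal \<bar>det (J x)\<bar> * indicator (Q k) x"
        using QU[of k] by (cases "x \<in> U k"; cases "x \<in> Q k") (auto simp: G_def mult_ac)
    qed
    finally show "(\<integral>\<^sup>+z. \<rho> z * G k z \<partial>lborel) =
      (\<integral>\<^sup>+x. \<rho> (h x) * ennreal \<bar>det (J x)\<bar> * indicator (Q k) x \<partial>lborel)" .
  qed
  also have "\<dots> = (\<integral>\<^sup>+x. (\<Sum>k. \<rho> (h x) * ennreal \<bar>det (J x)\<bar> * indicator (Q k) x) \<partial>lborel)"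
  proof (rule nn_integral_suminf[symmetric])
    fix k
    have QV: "Q k \<subseteq> V" using QU[of k] oU(3)[of k] by (auto simp: R_def)
    have "continuous_on V h"
      by (rule has_derivative_continuous_on) (rule has_derivative_at_withinI, rule der)
    then have 1: "(\<lambda>x. if x \<in> V then h x else 0) \<in> borel \<rightarrow>\<^sub>M borel"
      by (rule borel_measurable_continuous_on_if[rotated]) (use V in auto)
    have 2: "(\<lambda>x. if x \<in> V then det (J x) else 0) \<in> borel \<rightarrow>\<^sub>M borel"
      by (rule borel_measurable_continuous_on_if[OF _ cd]) (use V in auto)
    have "(\<lambda>x. \<rho> (if x \<in> V then h x else 0) * ennreal \<bar>if x \<in> V then det (J x) else 0\<bar> * indicator (Q k) x)
        \<in> borel_measurable lborel"
      using measurable_compose[OF 1 \<rho>] 2 by measurable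
    also have "(\<lambda>x. \<rho> (if x \<in> V then h x else 0) * ennreal \<bar>if x \<in> V then det (J x) else 0\<bar> * indicator (Q k) x) =
       (\<lambda>x. \<rho> (h x) * ennreal \<bar>det (J x)\<bar> * indicator (Q k) x)"
      using QV by (auto simp: fun_eq_iff split: split_indicator)
    finally show "(\<lambda>x. \<rho> (h x) * ennreal \<bar>det (J x)\<bar> * indicator (Q k) x) \<in> borel_measurable lborel" .
  qed
  also have "\<dots> = (\<integral>\<^sup>+x. \<rho> (h x) * ennreal \<bar>det (J x)\<bar> * indicator B x \<partial>lborel)"
  proof (intro nn_integral_cong)
    fix x
    have "(\<Sum>k. (indicator (Q k) x :: ennreal)) = indicator (B \<inter> R) x"
      using suminf_indicator[OF disjQ, of x] UQ by simp
    moreover have "det (J x) = 0 \<or> x \<in> R" if "x \<in> B" using that B(2) by (auto simp: R_def)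
    ultimately show "(\<Sum>k. \<rho> (h x) * ennreal \<bar>det (J x)\<bar> * indicator (Q k) x) =
       \<rho> (h x) * ennreal \<bar>det (J x)\<bar> * indicator B x"
      by (auto simp: ennreal_suminf_cmult split: split_indicator)
  qed
  finally show ?thesis .
qed

section \<open>Linear images of Gaussian vectors\<close>

abbreviation std_normal :: "real measure" where
  "std_normal \<equiv> density lborel std_normal_density"

definition std_gaussian :: "'e::euclidean_space measure" where
  "std_gaussian = density lborel (\<lambda>x. ennreal (\<Prod>b\<in>Basis. std_normal_density (x \<bullet> b)))"

text \<open>Only the norm of \<open>x\<close> enters: this is the rotation invariance on which the
  reductions below rest.\<close>

lemma prod_std_normal_density:
  fixes x :: "'e::euclidean_space"
  shows "(\<Prod>b\<in>Basis. std_normal_density (x \<bullet> b)) = (1 / sqrt (2 * pi)) ^ DIM('e) * exp (- (norm x)\<^sup>2 / 2)"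
proof -
  have "(norm x)\<^sup>2 = (\<Sum>b\<in>Basis. (x \<bullet> b)\<^sup>2)"
    unfolding power2_norm_eq_inner by (subst euclidean_inner) (simp add: power2_eq_square)
  then show ?thesis
    by (simp add: std_normal_density_def prod.distrib power_one_over sum_negf sum_divide_distrib
        prod_dividef flip: exp_sum)
qed

lemma prob_space_std_normal: "prob_space std_normal"
  using prob_space_normal_density[of 1 0] by simp

lemma sets_std_gaussian [simp, measurable_cong]: "sets std_gaussian = sets borel"
  and space_std_gaussian [simp]: "space std_gaussian = UNIV"
  by (simp_all add: std_gaussian_def)

lemma prob_space_std_gaussian: "prob_space (std_gaussian :: 'e::euclidean_space measure)"
proof
  interpret prob_space std_normal by (rule prob_space_std_normal)
  have 1: "(\<integral>\<^sup>+x. ennreal (std_normal_density x) \<partial>lborel) = 1"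
    using emeasure_space_1 by (simp add: emeasure_density)
  have "emeasure (std_gaussian :: 'e measure) UNIV =
      (\<integral>\<^sup>+x. (\<Prod>b\<in>Basis. ennreal (std_normal_density (x \<bullet> b))) \<partial>(lborel :: 'e measure))"
    by (simp add: std_gaussian_def emeasure_density prod_ennreal)
  also have "\<dots> = (\<Prod>b\<in>(Basis :: 'e set). (\<integral>\<^sup>+x. ennreal (std_normal_density x) \<partial>lborel))"
    by (rule nn_integral_lborel_prod) auto
  finally show "emeasure (std_gaussian :: 'e measure) (space std_gaussian) = 1"
    by (simp add: 1)
qed

lemma std_gaussian_real: "std_gaussian = std_normal"
  by (simp add: std_gaussian_def)

lemma std_gaussian_pair:
  "(std_gaussian :: ('a::euclidean_space \<times> 'b::euclidean_space) measure) = std_gaussian \<Otimes>\<^sub>M std_gaussian"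
proof -
  interpret b: prob_space "std_gaussian :: 'b measure" by (rule prob_space_std_gaussian)
  have "(std_gaussian \<Otimes>\<^sub>M std_gaussian :: ('a \<times> 'b) measure) =
      density (lborel \<Otimes>\<^sub>M lborel) (\<lambda>(x, y). ennreal (\<Prod>b\<in>Basis. std_normal_density (x \<bullet> b)) *
        ennreal (\<Prod>b\<in>Basis. std_normal_density (y \<bullet> b)))"
    unfolding std_gaussian_def
    by (rule pair_measure_density) (simp_all add: lborel.sigma_finite_measure_axioms
      b.sigma_finite_measure_axioms flip: std_gaussian_def)
  also have "\<dots> = std_gaussian"
    unfolding std_gaussian_def lborel_prod
    by (intro arg_cong2[where f = density] refl ext)
      (auto simp: prod_std_normal_density norm_prod_def power_add exp_add[symmetric]
        ennreal_mult'[symmetric] add_divide_distrib mult_ac intro!: arg_cong[where f = ennreal])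
  finally show ?thesis by simp
qed

lemma linear_measurable_borel:
  fixes f :: "'a::euclidean_space \<Rightarrow> 'b::euclidean_space"
  assumes "linear f" shows "f \<in> borel \<rightarrow>\<^sub>M borel"
  using assms by (simp add: borel_measurable_continuous_onI linear_continuous_on linear_conv_bounded_linear)

lemma nn_integral_std_gaussian_isometry:
  fixes f :: "'a::euclidean_space \<Rightarrow> 'b::euclidean_space"
  assumes f: "linear f" "\<And>x. norm (f x) = norm x" "surj f"
    and [measurable]: "F \<in> borel_measurable borel"
  shows "(\<integral>\<^sup>+x. F (f x) \<partial>std_gaussian) = (\<integral>\<^sup>+x. F x \<partial>std_gaussian)"
proof -
  have [measurable]: "f \<in> borel \<rightarrow>\<^sub>M borel" using f(1) by (rule linear_measurable_borel)
  have dim: "DIM('a) = DIM('b)"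
    using f by (metis dim_UNIV dim_image_eq inj_on_subset subset_UNIV linear_injective_0 norm_eq_zero)
  have "(\<integral>\<^sup>+x. F x \<partial>std_gaussian) =
      (\<integral>\<^sup>+x. ennreal (\<Prod>b\<in>Basis. std_normal_density (x \<bullet> b)) * F x \<partial>distr lborel borel f)"
    unfolding distr_lborel_isometry[OF f] by (simp add: std_gaussian_def nn_integral_density)
  also have "\<dots> = (\<integral>\<^sup>+x. ennreal (\<Prod>b\<in>Basis. std_normal_density (f x \<bullet> b)) * F (f x) \<partial>lborel)"
    by (simp add: nn_integral_distr)
  also have "\<dots> = (\<integral>\<^sup>+x. F (f x) \<partial>std_gaussian)"
    by (simp add: std_gaussian_def nn_integral_density prod_std_normal_density f(2) dim)
  finally show ?thesis by simp
qed

section \<open>Reflections and covariance reduction\<close>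

lemma norm_Pair_power2: "(norm (a, b))\<^sup>2 = (norm a)\<^sup>2 + (norm b)\<^sup>2"
  by (simp add: norm_Pair)

text \<open>Reflection in the hyperplane orthogonal to \<open>u\<close>. For \<open>u = 0\<close>
  division by zero yields the identity, so \<open>householder_swap\<close> also covers
  \<open>a = b\<close>.\<close>

definition householder :: "'e::real_inner \<Rightarrow> 'e \<Rightarrow> 'e" where
  "householder u v = v - (2 * (u \<bullet> v) / (u \<bullet> u)) *\<^sub>R u"

lemma linear_householder: "linear (householder u)"
  by (rule linearI) (simp_all add: householder_def inner_simps algebra_simps add_divide_distrib)

lemma householder_involution: "householder u (householder u v) = v"
  by (cases "u = 0") (simp_all add: householder_def inner_simps algebra_simps)

lemma householder_self_adjoint: "householder u v \<bullet> w = v \<bullet> householder u w"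
  by (simp add: householder_def inner_simps inner_commute)

lemma norm_householder: "norm (householder u v) = norm v"
  by (metis householder_involution householder_self_adjoint norm_eq_sqrt_inner)

lemma surj_householder: "surj (householder u)"
  by (metis householder_involution surjI)

lemma householder_swap:
  assumes "norm a = norm b" shows "householder (a - b) a = b"
proof (cases "a = b")
  case False
  have "a \<bullet> a = b \<bullet> b" using assms by (simp add: norm_eq_sqrt_inner)
  then have "2 * ((a - b) \<bullet> a) = (a - b) \<bullet> (a - b)"
    by (simp add: inner_simps inner_commute)
  moreover have "(a - b) \<bullet> (a - b) \<noteq> 0" using False by simp
  ultimately show ?thesis by (simp add: householder_def)
qed (simp add: householder_def)

lemma nn_integral_std_gaussian_pair:
  fixes F :: "'a::euclidean_space \<times> 'b::euclidean_space \<Rightarrow> ennreal"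
  assumes F [measurable]: "F \<in> borel_measurable borel"
  shows "(\<integral>\<^sup>+x. F x \<partial>std_gaussian) = (\<integral>\<^sup>+x. \<integral>\<^sup>+y. F (x, y) \<partial>std_gaussian \<partial>std_gaussian)"
    and "(\<integral>\<^sup>+x. F x \<partial>std_gaussian) = (\<integral>\<^sup>+y. \<integral>\<^sup>+x. F (x, y) \<partial>std_gaussian \<partial>std_gaussian)"
proof -
  interpret a: prob_space "std_gaussian :: 'a measure" by (rule prob_space_std_gaussian)
  interpret b: prob_space "std_gaussian :: 'b measure" by (rule prob_space_std_gaussian)
  interpret pair_sigma_finite "std_gaussian :: 'a measure" "std_gaussian :: 'b measure" ..
  have F': "F \<in> borel_measurable (std_gaussian \<Otimes>\<^sub>M std_gaussian)"
    unfolding std_gaussian_pair[symmetric] by measurable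
  show "(\<integral>\<^sup>+x. F x \<partial>std_gaussian) = (\<integral>\<^sup>+x. \<integral>\<^sup>+y. F (x, y) \<partial>std_gaussian \<partial>std_gaussian)"
    unfolding std_gaussian_pair by (rule b.nn_integral_fst[OF F', symmetric])
  show "(\<integral>\<^sup>+x. F x \<partial>std_gaussian) = (\<integral>\<^sup>+y. \<integral>\<^sup>+x. F (x, y) \<partial>std_gaussian \<partial>std_gaussian)"
    unfolding std_gaussian_pair by (rule nn_integral_snd[OF F', symmetric])
qed

text \<open>A linear image of a standard Gaussian vector with one superfluous coordinate: reflect a
  kernel vector into that coordinate.\<close>

lemma gaussian_reduce_step:
  fixes S :: "'e::euclidean_space \<times> real \<Rightarrow> 'e"
  assumes S: "linear S"
  obtains T :: "'e \<Rightarrow> 'e" where "linear T" "\<And>u. norm (adjoint T u) = norm (adjoint S u)"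
    "\<And>F. F \<in> borel_measurable borel \<Longrightarrow>
       (\<integral>\<^sup>+x. F (S x) \<partial>std_gaussian) = (\<integral>\<^sup>+x. F (T x) \<partial>std_gaussian)"
proof -
  interpret prob_space "std_gaussian :: real measure" by (rule prob_space_std_gaussian)
  have "\<not> inj S"
  proof
    assume "inj S"
    then have "dim (range S) = dim (UNIV :: ('e \<times> real) set)"
      using S by (metis dim_image_eq inj_on_subset subset_UNIV)
    moreover have "dim (range S) \<le> dim (UNIV :: 'e set)" by (rule dim_subset) simp
    ultimately show False by simp
  qed
  then obtain k0 where k0: "k0 \<noteq> 0" "S k0 = 0" using S linear_injective_0 by blast
  define k where "k = k0 /\<^sub>R norm k0"
  have k: "norm k = 1" "S k = 0" using k0 S by (simp_all add: k_def linear_scale)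
  \<comment> \<open>The reflection sends the last coordinate vector to the kernel vector
    \<open>k\<close>. After it the last coordinate has no effect under \<open>S\<close> and is
    integrated out with total mass 1.\<close>
  define H where "H = householder ((0, 1) - k)"
  have Hk: "H (0, 1) = k" unfolding H_def by (rule householder_swap) (simp add: k(1) norm_Pair)
  note H = linear_householder[of "(0,1) - k", folded H_def] norm_householder[of "(0,1) - k", folded H_def]
    surj_householder[of "(0,1) - k", folded H_def]
  define T where "T x = S (H (x, 0))" for x
  have linT: "linear T" unfolding T_def
    using linear_compose[OF linear_compose[OF _ H(1)] S, of "\<lambda>x. (x, 0)"]
    by (simp add: o_def linear_iff)
  have SH: "S (H (x, t)) = T x" for x t
  proof -
    have "H (x, t) = H (x, 0) + t *\<^sub>R H (0, 1)"
      using linear_add[OF H(1), of "(x, 0)" "t *\<^sub>R (0, 1)"] linear_scale[OF H(1), of t "(0, 1)"] by simp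
    then show ?thesis using S k by (simp add: T_def Hk linear_add linear_scale)
  qed
  have adj: "adjoint T u = fst (H (adjoint S u))" for u
  proof (rule vector_eq_ldot[THEN iffD1], rule allI)
    fix x
    have "x \<bullet> adjoint T u = (x, 0) \<bullet> H (adjoint S u)"
      using S linT by (simp add: adjoint_works T_def H_def flip: householder_self_adjoint)
    then show "x \<bullet> adjoint T u = x \<bullet> fst (H (adjoint S u))" by (simp add: inner_prod_def)
  qed
  have snd0: "snd (H (adjoint S u)) = 0" for u
  proof -
    have "snd (H (adjoint S u)) = (0, 1) \<bullet> H (adjoint S u)" by (simp add: inner_prod_def)
    also have "\<dots> = H (0, 1) \<bullet> adjoint S u" by (simp add: H_def householder_self_adjoint)
    finally show ?thesis using S k by (simp add: Hk adjoint_works)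
  qed
  show ?thesis
  proof (rule that[OF linT])
    fix u
    have "norm (adjoint S u) = norm (H (adjoint S u))" by (simp add: H(2))
    also have "\<dots> = norm (adjoint T u)" using snd0[of u] by (simp add: adj norm_prod_def)
    finally show "norm (adjoint T u) = norm (adjoint S u)" by simp
  next
    fix F :: "'e \<Rightarrow> ennreal" assume F [measurable]: "F \<in> borel_measurable borel"
    have m [measurable]: "S \<in> borel \<rightarrow>\<^sub>M borel" "T \<in> borel \<rightarrow>\<^sub>M borel" "H \<in> borel \<rightarrow>\<^sub>M borel"
      by (rule linear_measurable_borel; fact S linT H)+
    have "(\<integral>\<^sup>+x. F (S x) \<partial>std_gaussian) = (\<integral>\<^sup>+x. F (S (H x)) \<partial>std_gaussian)"
      by (rule nn_integral_std_gaussian_isometry[OF H, symmetric]) measurable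
    also have "\<dots> = (\<integral>\<^sup>+x. \<integral>\<^sup>+t. F (S (H (x, t))) \<partial>std_gaussian \<partial>std_gaussian)"
      by (rule nn_integral_std_gaussian_pair) measurable
    also have "\<dots> = (\<integral>\<^sup>+x. F (T x) \<partial>std_gaussian)"
      using emeasure_space_1 by (simp add: SH)
    finally show "(\<integral>\<^sup>+x. F (S x) \<partial>std_gaussian) = (\<integral>\<^sup>+x. F (T x) \<partial>std_gaussian)" .
  qed
qed

text \<open>Arbitrarily many Gaussian coefficients are compressed to as many as the dimension of the
  target space: each new coefficient adds one coordinate, and \<open>gaussian_reduce_step\<close>
  removes one again. The square of \<open>norm (adjoint T u)\<close> is the variance of the
  component along \<open>u\<close>, so the second conclusion records that the covariance is
  kept.\<close>

lemma gaussian_reduce: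
  fixes a :: "'i \<Rightarrow> 'e::euclidean_space"
  assumes "finite I"
  obtains T :: "'e \<Rightarrow> 'e" where "linear T" "\<And>u. (norm (adjoint T u))\<^sup>2 = (\<Sum>i\<in>I. (a i \<bullet> u)\<^sup>2)"
    "\<And>F. F \<in> borel_measurable borel \<Longrightarrow>
       (\<integral>\<^sup>+w. F (\<Sum>i\<in>I. w i *\<^sub>R a i) \<partial>PiM I (\<lambda>_. std_normal)) = (\<integral>\<^sup>+x. F (T x) \<partial>std_gaussian)"
proof -
  have "\<exists>T :: 'e \<Rightarrow> 'e. linear T \<and> (\<forall>u. (norm (adjoint T u))\<^sup>2 = (\<Sum>i\<in>I. (a i \<bullet> u)\<^sup>2)) \<and>
    (\<forall>F \<in> borel_measurable borel.
       (\<integral>\<^sup>+w. F (\<Sum>i\<in>I. w i *\<^sub>R a i) \<partial>PiM I (\<lambda>_. std_normal)) = (\<integral>\<^sup>+x. F (T x) \<partial>std_gaussian))"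
    using assms
  proof (induction I)
    case empty
    interpret prob_space "std_gaussian :: 'e measure" by (rule prob_space_std_gaussian)
    have "adjoint (\<lambda>_::'e. 0::'e) u = 0" for u
      by (rule vector_eq_ldot[THEN iffD1], rule allI) (simp add: adjoint_works linear_zero)
    then show ?case
      using emeasure_space_1
      by (intro exI[of _ "\<lambda>_. 0"]) (simp add: linear_zero PiM_empty nn_integral_count_space_finite)
  next
    case (insert k I)
    then obtain T :: "'e \<Rightarrow> 'e" where T: "linear T" "\<And>u. (norm (adjoint T u))\<^sup>2 = (\<Sum>i\<in>I. (a i \<bullet> u)\<^sup>2)"
      "\<And>F. F \<in> borel_measurable borel \<Longrightarrow>
       (\<integral>\<^sup>+w. F (\<Sum>i\<in>I. w i *\<^sub>R a i) \<partial>PiM I (\<lambda>_. std_normal)) = (\<integral>\<^sup>+x. F (T x) \<partial>std_gaussian)"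
      by blast
    interpret N: prob_space std_normal by (rule prob_space_std_normal)
    interpret product_sigma_finite "\<lambda>_::'i. std_normal"
      by (simp add: product_sigma_finite_def N.sigma_finite_measure_axioms)
    define S where "S p = T (fst p) + snd p *\<^sub>R a k" for p :: "'e \<times> real"
    have S: "linear S"
      using T(1) by (auto simp: S_def linear_iff algebra_simps)
    have adjS: "adjoint S u = (adjoint T u, a k \<bullet> u)" for u
    proof (rule vector_eq_ldot[THEN iffD1], rule allI)
      fix p
      show "p \<bullet> adjoint S u = p \<bullet> (adjoint T u, a k \<bullet> u)"
        unfolding adjoint_works[OF S] by (simp add: S_def inner_prod_def adjoint_works[OF T(1)] inner_simps)
    qed
    obtain T' :: "'e \<Rightarrow> 'e" where T': "linear T'" "\<And>u. norm (adjoint T' u) = norm (adjoint S u)"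
      "\<And>F. F \<in> borel_measurable borel \<Longrightarrow>
         (\<integral>\<^sup>+x. F (S x) \<partial>std_gaussian) = (\<integral>\<^sup>+x. F (T' x) \<partial>std_gaussian)"
      by (rule gaussian_reduce_step[OF S]) blast
    show ?case
    proof (intro exI[of _ T'] conjI allI ballI)
      fix u
      show "(norm (adjoint T' u))\<^sup>2 = (\<Sum>i\<in>insert k I. (a i \<bullet> u)\<^sup>2)"
        using insert.hyps by (simp add: T'(2) adjS norm_Pair_power2 T(2))
    next
      fix F :: "'e \<Rightarrow> ennreal" assume F [measurable]: "F \<in> borel_measurable borel"
      have [measurable]: "S \<in> borel \<rightarrow>\<^sub>M borel" by (rule linear_measurable_borel[OF S])
      have "(\<integral>\<^sup>+w. F (\<Sum>i\<in>insert k I. w i *\<^sub>R a i) \<partial>PiM (insert k I) (\<lambda>_. std_normal)) =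
        (\<integral>\<^sup>+t. \<integral>\<^sup>+w. F (\<Sum>i\<in>insert k I. (w(k := t)) i *\<^sub>R a i) \<partial>PiM I (\<lambda>_. std_normal) \<partial>std_normal)"
        by (rule product_nn_integral_insert_rev) (use insert.hyps in \<open>auto intro!: measurable_compose[OF _ F]\<close>)
      also have "\<dots> = (\<integral>\<^sup>+t. \<integral>\<^sup>+w. F ((\<Sum>i\<in>I. w i *\<^sub>R a i) + t *\<^sub>R a k) \<partial>PiM I (\<lambda>_. std_normal) \<partial>std_normal)"
      proof -
        have "(\<Sum>i\<in>insert k I. (w(k := t)) i *\<^sub>R a i) = (\<Sum>i\<in>I. w i *\<^sub>R a i) + t *\<^sub>R a k" for w t
        proof -
          have "(\<Sum>i\<in>I. (w(k := t)) i *\<^sub>R a i) = (\<Sum>i\<in>I. w i *\<^sub>R a i)"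
            by (rule sum.cong) (use insert.hyps in auto)
          then show ?thesis using insert.hyps by (simp add: add.commute)
        qed
        then show ?thesis by simp
      qed
      also have "\<dots> = (\<integral>\<^sup>+t. \<integral>\<^sup>+x. F (T x + t *\<^sub>R a k) \<partial>std_gaussian \<partial>std_normal)"
        by (intro nn_integral_cong T(3)) measurable
      also have "\<dots> = (\<integral>\<^sup>+p. F (S p) \<partial>std_gaussian)"
        proof -
        have "(\<lambda>p. F (S p)) \<in> borel_measurable borel" by measurable
        from nn_integral_std_gaussian_pair(2)[OF this] show ?thesis by (simp add: S_def std_gaussian_real)
      qed
      also have "\<dots> = (\<integral>\<^sup>+x. F (T' x) \<partial>std_gaussian)" by (rule T'(3)[OF F])
      finally show "(\<integral>\<^sup>+w. F (\<Sum>i\<in>insert k I. w i *\<^sub>R a i) \<partial>PiM (insert k I) (\<lambda>_. std_normal)) =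
        (\<integral>\<^sup>+x. F (T' x) \<partial>std_gaussian)" .
    qed (rule T'(1))
  qed
  then show ?thesis using that by blast
qed

text \<open>Weighting by the density of one linear form amounts to conditioning on a further Gaussian
  variable: it shrinks the covariance by a rank-one term.\<close>

lemma gaussian_reduce_weighted:
  fixes \<phi> :: "'i \<Rightarrow> real" and L :: "'i \<Rightarrow> 'e::euclidean_space"
  assumes I: "finite I"
  obtains B :: "'e \<Rightarrow> 'e" where "linear B"
    "\<And>u. (norm (adjoint B u))\<^sup>2 =
       (\<Sum>i\<in>I. (L i \<bullet> u)\<^sup>2) - (\<Sum>i\<in>I. \<phi> i * (L i \<bullet> u))\<^sup>2 / (1 + (\<Sum>i\<in>I. (\<phi> i)\<^sup>2))"
    "\<And>F. F \<in> borel_measurable borel \<Longrightarrow>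
       (\<integral>\<^sup>+w. ennreal (std_normal_density (\<Sum>i\<in>I. w i * \<phi> i)) * F (\<Sum>i\<in>I. w i *\<^sub>R L i) \<partial>PiM I (\<lambda>_. std_normal)) =
       ennreal (1 / sqrt (2 * pi * (1 + (\<Sum>i\<in>I. (\<phi> i)\<^sup>2)))) * (\<integral>\<^sup>+x. F (B x) \<partial>std_gaussian)"
proof -
  define s where "s = (\<Sum>i\<in>I. (\<phi> i)\<^sup>2)"
  have s0: "s \<ge> 0" unfolding s_def by (rule sum_nonneg) simp
  define r where "r = sqrt (1 + s)"
  have r: "r > 0" "r\<^sup>2 = 1 + s" using s0 by (simp_all add: r_def)
  obtain T :: "real \<times> 'e \<Rightarrow> real \<times> 'e" where T: "linear T"
    "\<And>v. (norm (adjoint T v))\<^sup>2 = (\<Sum>i\<in>I. ((\<phi> i, L i) \<bullet> v)\<^sup>2)"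
    "\<And>F. F \<in> borel_measurable borel \<Longrightarrow>
       (\<integral>\<^sup>+w. F (\<Sum>i\<in>I. w i *\<^sub>R (\<phi> i, L i)) \<partial>PiM I (\<lambda>_. std_normal)) = (\<integral>\<^sup>+x. F (T x) \<partial>std_gaussian)"
    by (rule gaussian_reduce[OF I, of "\<lambda>i. (\<phi> i, L i)"]) blast
  \<comment> \<open>The first component of \<open>T x\<close> is the inner product of
    \<open>x\<close> with \<open>p\<close>. A reflection that moves \<open>p\<close> onto the first
    axis makes the weight depend on a single real Gaussian variable \<open>g\<close>; the remaining
    coordinates enter through \<open>C\<close> only.\<close>
  define p where "p = adjoint T (1, 0)"
  have np: "(norm p)\<^sup>2 = s" unfolding p_def T(2) s_def by (simp add: inner_prod_def)
  define H where "H = householder (p - norm p *\<^sub>R (1, 0))"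
  have Hp: "H p = norm p *\<^sub>R (1, 0)" unfolding H_def by (rule householder_swap) (simp add: norm_Pair)
  note H = linear_householder[of "p - norm p *\<^sub>R (1, 0)", folded H_def]
    norm_householder[of "p - norm p *\<^sub>R (1, 0)", folded H_def]
    surj_householder[of "p - norm p *\<^sub>R (1, 0)", folded H_def]
    householder_self_adjoint[of "p - norm p *\<^sub>R (1, 0)", folded H_def]
  define T' where "T' x = T (H x)" for x
  have linT': "linear T'" unfolding T'_def using linear_compose[OF H(1) T(1)] by (simp add: o_def)
  have adjT': "adjoint T' v = H (adjoint T v)" for v
  proof (rule vector_eq_ldot[THEN iffD1], rule allI)
    fix x show "x \<bullet> adjoint T' v = x \<bullet> H (adjoint T v)"
      unfolding adjoint_works[OF linT'] by (simp add: T'_def adjoint_works[OF T(1)] flip: H(4))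
  qed
  have fstT': "fst (T' x) = norm p * fst x" for x
  proof -
    have "fst (T' x) = x \<bullet> adjoint T' (1, 0)" unfolding adjoint_works[OF linT'] by (simp add: inner_prod_def)
    also have "\<dots> = norm p * fst x" by (simp add: adjT' Hp flip: p_def) (simp add: inner_prod_def)
    finally show ?thesis .
  qed
  define b where "b = snd (T' (1, 0))"
  define C where "C y = snd (T' (0, y))" for y
  have C: "linear C"
  proof (rule linearI)
    show "C (x + y) = C x + C y" for x y
      using linear_add[OF linT', of "(0, x)" "(0, y)"] by (simp add: C_def)
    show "C (c *\<^sub>R x) = c *\<^sub>R C x" for c x
      using linear_scale[OF linT', of c "(0, x)"] by (simp add: C_def)
  qed
  have sndT': "snd (T' (g, y)) = g *\<^sub>R b + C y" for g y
  proof -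
    have "T' (g, y) = g *\<^sub>R T' (1, 0) + T' (0, y)"
      using linear_add[OF linT', of "g *\<^sub>R (1, 0)" "(0, y)"] linear_scale[OF linT', of g "(1, 0)"] by simp
    then show ?thesis by (simp add: b_def C_def)
  qed
  have adjT'2: "adjoint T' (t, u) = (t * norm p + b \<bullet> u, adjoint C u)" for t u
  proof (rule vector_eq_ldot[THEN iffD1], rule allI)
    fix x :: "real \<times> 'e"
    obtain g y where x: "x = (g, y)" by (cases x)
    have "x \<bullet> adjoint T' (t, u) = T' x \<bullet> (t, u)" by (rule adjoint_works[OF linT'])
    also have "\<dots> = norm p * g * t + (g *\<^sub>R b + C y) \<bullet> u"
      using fstT'[of x] sndT'[of g y] by (simp add: inner_prod_def x)
    also have "\<dots> = x \<bullet> (t * norm p + b \<bullet> u, adjoint C u)"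
      by (simp add: x inner_prod_def adjoint_works[OF C] inner_simps algebra_simps)
    finally show "x \<bullet> adjoint T' (t, u) = x \<bullet> (t * norm p + b \<bullet> u, adjoint C u)" .
  qed
  \<comment> \<open>The covariance of the scalar and the vector part together: \<open>t = 0\<close>
    gives the variances of the vector part, and \<open>t = 1\<close> then the mixed term.\<close>
  have gram: "(t * norm p + b \<bullet> u)\<^sup>2 + (norm (adjoint C u))\<^sup>2 = (\<Sum>i\<in>I. (\<phi> i * t + L i \<bullet> u)\<^sup>2)" for t u
  proof -
    have "(norm (adjoint T' (t, u)))\<^sup>2 = (\<Sum>i\<in>I. (\<phi> i * t + L i \<bullet> u)\<^sup>2)"
      unfolding adjT' H(2) T(2) by (simp add: inner_prod_def)
    then show ?thesis by (simp add: adjT'2 norm_Pair_power2)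
  qed
  \<comment> \<open>The weight narrows the law of \<open>g\<close> to standard deviation
    \<open>1 / r\<close>. Under the weighted law the vector part is thus
    \<open>C y + (h / r) *\<^sub>R b\<close> with a standard normal \<open>h\<close>, which is again
    one coordinate too many.\<close>
  define S where "S q = C (fst q) + (snd q / r) *\<^sub>R b" for q :: "'e \<times> real"
  have S: "linear S" using C by (auto simp: S_def linear_iff algebra_simps add_divide_distrib)
  have adjS: "adjoint S u = (adjoint C u, b \<bullet> u / r)" for u
  proof (rule vector_eq_ldot[THEN iffD1], rule allI)
    fix q
    show "q \<bullet> adjoint S u = q \<bullet> (adjoint C u, b \<bullet> u / r)"
      unfolding adjoint_works[OF S] by (simp add: S_def inner_prod_def adjoint_works[OF C] inner_simps)
  qed
  obtain B :: "'e \<Rightarrow> 'e" where B: "linear B" "\<And>u. norm (adjoint B u) = norm (adjoint S u)"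
    "\<And>F. F \<in> borel_measurable borel \<Longrightarrow>
       (\<integral>\<^sup>+x. F (S x) \<partial>std_gaussian) = (\<integral>\<^sup>+x. F (B x) \<partial>std_gaussian)"
    by (rule gaussian_reduce_step[OF S]) blast
  show ?thesis
  proof (rule that[OF B(1)])
    fix u
    have eq0: "(b \<bullet> u)\<^sup>2 + (norm (adjoint C u))\<^sup>2 = (\<Sum>i\<in>I. (L i \<bullet> u)\<^sup>2)"
      using gram[of 0 u] by simp
    have "(norm p + b \<bullet> u)\<^sup>2 + (norm (adjoint C u))\<^sup>2 =
        s + 2 * (\<Sum>i\<in>I. \<phi> i * (L i \<bullet> u)) + (\<Sum>i\<in>I. (L i \<bullet> u)\<^sup>2)"
      using gram[of 1 u] by (simp add: s_def power2_sum sum.distrib sum_distrib_left mult_ac)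
    then have cross: "norm p * (b \<bullet> u) = (\<Sum>i\<in>I. \<phi> i * (L i \<bullet> u))"
      using eq0 np by (simp add: power2_sum)
    have "(norm (adjoint B u))\<^sup>2 = (norm (adjoint C u))\<^sup>2 + (b \<bullet> u)\<^sup>2 / (1 + s)"
      by (simp add: B(2) adjS norm_Pair_power2 power_divide r)
    also have "(b \<bullet> u)\<^sup>2 / (1 + s) = (b \<bullet> u)\<^sup>2 - s * (b \<bullet> u)\<^sup>2 / (1 + s)"
      using s0 by (simp add: field_simps)
    also have "s * (b \<bullet> u)\<^sup>2 = (\<Sum>i\<in>I. \<phi> i * (L i \<bullet> u))\<^sup>2"
      unfolding cross[symmetric] power_mult_distrib np ..
    finally show "(norm (adjoint B u))\<^sup>2 =
       (\<Sum>i\<in>I. (L i \<bullet> u)\<^sup>2) - (\<Sum>i\<in>I. \<phi> i * (L i \<bullet> u))\<^sup>2 / (1 + (\<Sum>i\<in>I. (\<phi> i)\<^sup>2))"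
      unfolding eq0[symmetric] s_def by simp
  next
    fix F :: "'e \<Rightarrow> ennreal" assume F [measurable]: "F \<in> borel_measurable borel"
    have [measurable]: "T \<in> borel \<rightarrow>\<^sub>M borel" "H \<in> borel \<rightarrow>\<^sub>M borel" "C \<in> borel \<rightarrow>\<^sub>M borel"
      "S \<in> borel \<rightarrow>\<^sub>M borel" "T' \<in> borel \<rightarrow>\<^sub>M borel"
      by (rule linear_measurable_borel; fact)+
    define G where "G q = ennreal (std_normal_density (fst q)) * F (snd q)" for q :: "real \<times> 'e"
    have Gm [measurable]: "G \<in> borel_measurable borel"
      unfolding G_def borel_prod[symmetric] by measurable
    \<comment> \<open>Since \<open>(norm p)\<^sup>2 = s\<close> and
      \<open>r\<^sup>2 = 1 + s\<close>, the two exponents add up to that of \<open>r * g\<close>;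
      substituting \<open>h = r * g\<close> later gives the factor \<open>1 / r\<close>.\<close>
    have dens: "std_normal_density g * std_normal_density (norm p * g) = 1 / sqrt (2 * pi) * std_normal_density (r * g)" for g
      unfolding std_normal_density_def
      by (simp add: exp_add[symmetric] power_mult_distrib np r field_simps)
    have pull: "(\<integral>\<^sup>+g. ennreal (std_normal_density (norm p * g)) * F (g *\<^sub>R b + C y) \<partial>std_normal) =
        ennreal (1 / (sqrt (2 * pi) * r)) * (\<integral>\<^sup>+h. F (C y + (h / r) *\<^sub>R b) \<partial>std_normal)" for y
    proof -
      have "(\<integral>\<^sup>+g. ennreal (std_normal_density (norm p * g)) * F (g *\<^sub>R b + C y) \<partial>std_normal) =
        (\<integral>\<^sup>+g. ennreal (1 / sqrt (2 * pi)) * (ennreal (std_normal_density (r * g)) * F (g *\<^sub>R b + C y)) \<partial>lborel)"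
        by (subst nn_integral_density) (auto intro!: nn_integral_cong simp: mult.assoc[symmetric] ennreal_mult'[symmetric] dens)
      also have "\<dots> = ennreal (1 / sqrt (2 * pi)) * (\<integral>\<^sup>+g. ennreal (std_normal_density (r * g)) * F (g *\<^sub>R b + C y) \<partial>lborel)"
        by (rule nn_integral_cmult) measurable
      also have "(\<integral>\<^sup>+g. ennreal (std_normal_density (r * g)) * F (g *\<^sub>R b + C y) \<partial>lborel) =
          ennreal (1 / r) * (\<integral>\<^sup>+h. ennreal (std_normal_density h) * F ((h / r) *\<^sub>R b + C y) \<partial>lborel)"
        using r by (subst nn_integral_real_affine[where c = "1 / r" and t = 0]) simp_all
      also have "(\<integral>\<^sup>+h. ennreal (std_normal_density h) * F ((h / r) *\<^sub>R b + C y) \<partial>lborel) =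
          (\<integral>\<^sup>+h. F (C y + (h / r) *\<^sub>R b) \<partial>std_normal)"
        by (subst nn_integral_density) (simp_all add: add.commute)
      finally show ?thesis
        using r by (simp add: mult.assoc[symmetric] ennreal_mult'[symmetric])
    qed
    have "(\<integral>\<^sup>+w. ennreal (std_normal_density (\<Sum>i\<in>I. w i * \<phi> i)) * F (\<Sum>i\<in>I. w i *\<^sub>R L i) \<partial>PiM I (\<lambda>_. std_normal))
      = (\<integral>\<^sup>+w. G (\<Sum>i\<in>I. w i *\<^sub>R (\<phi> i, L i)) \<partial>PiM I (\<lambda>_. std_normal))"
      by (simp add: G_def fst_sum snd_sum)
    also have "\<dots> = (\<integral>\<^sup>+x. G (T x) \<partial>std_gaussian)" by (rule T(3)[OF Gm])
    also have "\<dots> = (\<integral>\<^sup>+x. G (T' x) \<partial>std_gaussian)" unfolding T'_def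
      by (rule nn_integral_std_gaussian_isometry[OF H(1-3), symmetric]) measurable
    also have "\<dots> = (\<integral>\<^sup>+y. \<integral>\<^sup>+g. G (T' (g, y)) \<partial>std_gaussian \<partial>std_gaussian)"
      by (rule nn_integral_std_gaussian_pair) measurable
    also have "\<dots> = (\<integral>\<^sup>+y. ennreal (1 / (sqrt (2 * pi) * r)) * (\<integral>\<^sup>+h. F (C y + (h / r) *\<^sub>R b) \<partial>std_normal) \<partial>std_gaussian)"
      by (simp add: G_def fstT' sndT' std_gaussian_real pull)
    also have "\<dots> = ennreal (1 / (sqrt (2 * pi) * r)) * (\<integral>\<^sup>+y. (\<integral>\<^sup>+h. F (C y + (h / r) *\<^sub>R b) \<partial>std_normal) \<partial>std_gaussian)"
    proof (rule nn_integral_cmult)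
      interpret N: prob_space std_normal by (rule prob_space_std_normal)
      show "(\<lambda>y. \<integral>\<^sup>+h. F (C y + (h / r) *\<^sub>R b) \<partial>std_normal) \<in> borel_measurable std_gaussian"
        by measurable
    qed
    also have "(\<integral>\<^sup>+y. (\<integral>\<^sup>+h. F (C y + (h / r) *\<^sub>R b) \<partial>std_normal) \<partial>std_gaussian) = (\<integral>\<^sup>+q. F (S q) \<partial>std_gaussian)"
      proof -
      have "(\<lambda>p. F (S p)) \<in> borel_measurable borel" by measurable
      from nn_integral_std_gaussian_pair(1)[OF this] show ?thesis by (simp add: S_def std_gaussian_real)
    qed
    also have "\<dots> = (\<integral>\<^sup>+x. F (B x) \<partial>std_gaussian)" by (rule B(3)[OF F])
    also have "sqrt (2 * pi) * r = sqrt (2 * pi * (1 + (\<Sum>i\<in>I. (\<phi> i)\<^sup>2)))"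
      by (simp add: r_def s_def real_sqrt_mult)
    finally show "(\<integral>\<^sup>+w. ennreal (std_normal_density (\<Sum>i\<in>I. w i * \<phi> i)) * F (\<Sum>i\<in>I. w i *\<^sub>R L i) \<partial>PiM I (\<lambda>_. std_normal)) =
       ennreal (1 / sqrt (2 * pi * (1 + (\<Sum>i\<in>I. (\<phi> i)\<^sup>2)))) * (\<integral>\<^sup>+x. F (B x) \<partial>std_gaussian)" .
  qed
qed

text \<open>The hypothesis says that the \<open>adjoint T\<close> of \<open>gaussian_reduce\<close>
  is an isometry; hence \<open>T\<close> is orthogonal, and the Gaussian measure is rotation
  invariant. Applied to coordinate vectors it identifies a product of normal laws with
  \<open>std_gaussian\<close>.\<close>

lemma nn_integral_std_gaussian_orthonormal:
  fixes a :: "'i \<Rightarrow> 'e::euclidean_space"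
  assumes I: "finite I" and a: "\<And>u. (\<Sum>i\<in>I. (a i \<bullet> u)\<^sup>2) = (norm u)\<^sup>2"
    and F: "F \<in> borel_measurable borel"
  shows "(\<integral>\<^sup>+w. F (\<Sum>i\<in>I. w i *\<^sub>R a i) \<partial>PiM I (\<lambda>_. std_normal)) = (\<integral>\<^sup>+x. F x \<partial>std_gaussian)"
proof -
  obtain T :: "'e \<Rightarrow> 'e" where T: "linear T" "\<And>u. (norm (adjoint T u))\<^sup>2 = (\<Sum>i\<in>I. (a i \<bullet> u)\<^sup>2)"
    "(\<integral>\<^sup>+w. F (\<Sum>i\<in>I. w i *\<^sub>R a i) \<partial>PiM I (\<lambda>_. std_normal)) = (\<integral>\<^sup>+x. F (T x) \<partial>std_gaussian)"
    by (rule gaussian_reduce[OF I, of a]) (use F in blast)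
  have n: "norm (adjoint T u) = norm u" for u
    using T(2)[of u] a[of u] by (simp add: power2_eq_iff_nonneg)
  have ot: "orthogonal_transformation (adjoint T)"
    unfolding orthogonal_transformation by (simp add: n adjoint_linear[OF T(1)])
  have TT: "T (adjoint T u) = u" for u
  proof (rule vector_eq_rdot[THEN iffD1], rule allI)
    fix v
    show "T (adjoint T u) \<bullet> v = u \<bullet> v"
      using ot by (simp add: orthogonal_transformation_def flip: adjoint_works[OF T(1)])
  qed
  have "norm (T x) = norm x" for x
  proof -
    obtain u where "x = adjoint T u" using orthogonal_transformation_surj[OF ot] by auto
    then show ?thesis by (simp add: TT n)
  qed
  moreover have "surj T" using TT by (rule surjI)
  ultimately show ?thesis
    unfolding T(3) by (intro nn_integral_std_gaussian_isometry T(1) F)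
qed

text \<open>If \<open>M\<close> is the image of a product of \<open>A\<close> and \<open>B\<close>,
  then a finite power of \<open>M\<close> is the image of the powers of \<open>A\<close> and
  \<open>B\<close>, copy by copy. This separates, in all independent copies at once, one
  distinguished coefficient (\<open>A\<close>) from the remaining ones (\<open>B\<close>).\<close>

lemma nn_integral_PiM_pairing:
  fixes F :: "('j \<Rightarrow> 'c) \<Rightarrow> ennreal"
  assumes J: "finite J" and A: "prob_space A" and B: "prob_space B" and M: "prob_space M"
    and \<phi> [measurable]: "(\<lambda>(a, b). \<phi> a b) \<in> A \<Otimes>\<^sub>M B \<rightarrow>\<^sub>M M"
    and eq: "\<And>G. G \<in> borel_measurable M \<Longrightarrow> (\<integral>\<^sup>+y. G y \<partial>M) = (\<integral>\<^sup>+b. \<integral>\<^sup>+a. G (\<phi> a b) \<partial>A \<partial>B)"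
    and F: "F \<in> borel_measurable (PiM J (\<lambda>_. M))"
  shows "(\<integral>\<^sup>+y. F y \<partial>PiM J (\<lambda>_. M)) =
    (\<integral>\<^sup>+b. \<integral>\<^sup>+a. F (\<lambda>j\<in>J. \<phi> (a j) (b j)) \<partial>PiM J (\<lambda>_. A) \<partial>PiM J (\<lambda>_. B))"
  using J F
proof (induction J arbitrary: F)
  case empty
  then show ?case by (simp add: PiM_empty nn_integral_count_space_finite)
next
  case (insert k J)
  interpret A: prob_space A by fact
  interpret B: prob_space B by fact
  interpret M: prob_space M by fact
  interpret PA: product_prob_space "\<lambda>_::'j. A" J by unfold_locales
  interpret PB: product_prob_space "\<lambda>_::'j. B" J by unfold_locales
  interpret PM: product_prob_space "\<lambda>_::'j. M" J by unfold_locales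
  interpret AB: pair_sigma_finite A "PiM J (\<lambda>_. B)" ..
  note [measurable] = insert.prems
  have fin: "finite J" by fact
  have meas [measurable]: "(\<lambda>(x, y). x(k := y)) \<in> PiM J (\<lambda>_. M) \<Otimes>\<^sub>M M \<rightarrow>\<^sub>M PiM (insert k J) (\<lambda>_. M)"
    by (rule measurable_add_dim)
  have upd: "F \<in> borel_measurable (PiM (insert k J) (\<lambda>_. M)) \<Longrightarrow> y \<in> space M \<Longrightarrow>
      (\<lambda>x. F (x(k := y))) \<in> borel_measurable (PiM J (\<lambda>_. M))" for y
    by measurable
  have [measurable]: "(\<lambda>a. \<phi> a b) \<in> A \<rightarrow>\<^sub>M M" if "b \<in> space B" for b
    using measurable_compose[OF measurable_Pair2'[OF that] \<phi>] by simp
  have restr: "(\<lambda>(a, b). \<lambda>j\<in>J'. \<phi> (a j) (b j)) \<in> PiM J' (\<lambda>_. A) \<Otimes>\<^sub>M PiM J' (\<lambda>_. B) \<rightarrow>\<^sub>M PiM J' (\<lambda>_. M)" for J'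
    unfolding case_prod_beta
    by (rule measurable_restrict) (simp add: measurable_compose[OF _ \<phi>[unfolded case_prod_beta], of "\<lambda>p. (fst p j, snd p j)" for j, simplified])
  note restr [measurable]
  have restr': "(\<lambda>(b, a). \<lambda>j\<in>J'. \<phi> (a j) (b j)) \<in> PiM J' (\<lambda>_. B) \<Otimes>\<^sub>M PiM J' (\<lambda>_. A) \<rightarrow>\<^sub>M PiM J' (\<lambda>_. M)" for J'
    using measurable_compose[OF measurable_pair_swap' restr[of J']] by (simp add: case_prod_beta)
  let ?upd = "\<lambda>a' b' a b. (\<lambda>j\<in>J. \<phi> (a' j) (b' j))(k := \<phi> a b)"
  have "(\<integral>\<^sup>+y. F y \<partial>PiM (insert k J) (\<lambda>_. M)) =
      (\<integral>\<^sup>+y. \<integral>\<^sup>+x. F (x(k := y)) \<partial>PiM J (\<lambda>_. M) \<partial>M)"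
    by (rule PM.product_nn_integral_insert_rev) (use insert in auto)
  also have "\<dots> = (\<integral>\<^sup>+b. \<integral>\<^sup>+a. \<integral>\<^sup>+x. F (x(k := \<phi> a b)) \<partial>PiM J (\<lambda>_. M) \<partial>A \<partial>B)"
    by (rule eq) measurable
  also have "\<dots> = (\<integral>\<^sup>+b. \<integral>\<^sup>+a. \<integral>\<^sup>+b'. \<integral>\<^sup>+a'. F (?upd a' b' a b) \<partial>PiM J (\<lambda>_. A) \<partial>PiM J (\<lambda>_. B) \<partial>A \<partial>B)"
  proof (intro nn_integral_cong)
    fix b a assume "b \<in> space B" "a \<in> space A"
    then have "\<phi> a b \<in> space M" using measurable_space[OF \<phi>, of "(a, b)"] by (simp add: space_pair_measure)
    then show "(\<integral>\<^sup>+x. F (x(k := \<phi> a b)) \<partial>PiM J (\<lambda>_. M)) =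
        (\<integral>\<^sup>+b'. \<integral>\<^sup>+a'. F (?upd a' b' a b) \<partial>PiM J (\<lambda>_. A) \<partial>PiM J (\<lambda>_. B))"
      by (rule insert.IH[OF upd[OF insert.prems]])
  qed
  \<comment> \<open>Only the new \<open>A\<close>-coordinate and the old
    \<open>B\<close>-coordinates have to change places.\<close>
  also have "\<dots> = (\<integral>\<^sup>+b. \<integral>\<^sup>+b'. \<integral>\<^sup>+a. \<integral>\<^sup>+a'. F (?upd a' b' a b) \<partial>PiM J (\<lambda>_. A) \<partial>A \<partial>PiM J (\<lambda>_. B) \<partial>B)"
  proof (rule nn_integral_cong)
    fix b assume [measurable]: "b \<in> space B"
    show "(\<integral>\<^sup>+a. \<integral>\<^sup>+b'. \<integral>\<^sup>+a'. F (?upd a' b' a b) \<partial>PiM J (\<lambda>_. A) \<partial>PiM J (\<lambda>_. B) \<partial>A) =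
      (\<integral>\<^sup>+b'. \<integral>\<^sup>+a. \<integral>\<^sup>+a'. F (?upd a' b' a b) \<partial>PiM J (\<lambda>_. A) \<partial>A \<partial>PiM J (\<lambda>_. B))"
      by (rule AB.Fubini'[symmetric]) measurable
  qed
  also have "\<dots> = (\<integral>\<^sup>+b. \<integral>\<^sup>+b'. \<integral>\<^sup>+a. F (\<lambda>j\<in>insert k J. \<phi> (a j) ((b'(k := b)) j)) \<partial>PiM (insert k J) (\<lambda>_. A) \<partial>PiM J (\<lambda>_. B) \<partial>B)"
  proof (intro nn_integral_cong)
    fix b b' assume b: "b \<in> space B" "b' \<in> space (PiM J (\<lambda>_. B))"
    have bb: "b'(k := b) \<in> space (PiM (insert k J) (\<lambda>_. B))"
      using b by (auto simp: space_PiM PiE_def extensional_def)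
    have eq2: "?upd a' b' a b = (\<lambda>j\<in>insert k J. \<phi> ((a'(k := a)) j) ((b'(k := b)) j))" for a a'
      using insert.hyps by (auto simp: fun_eq_iff)
    show "(\<integral>\<^sup>+a. \<integral>\<^sup>+a'. F (?upd a' b' a b) \<partial>PiM J (\<lambda>_. A) \<partial>A) =
      (\<integral>\<^sup>+a. F (\<lambda>j\<in>insert k J. \<phi> (a j) ((b'(k := b)) j)) \<partial>PiM (insert k J) (\<lambda>_. A))"
      unfolding eq2
    proof (rule PA.product_nn_integral_insert_rev[symmetric])
      show "(\<lambda>a. F (\<lambda>j\<in>insert k J. \<phi> (a j) ((b'(k := b)) j))) \<in> borel_measurable (PiM (insert k J) (\<lambda>_. A))"
        using measurable_compose[OF measurable_compose[OF measurable_Pair2'[OF bb] restr] insert.prems]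
        by (simp only: case_prod_conv)
    qed (use insert in auto)
  qed
  also have "\<dots> = (\<integral>\<^sup>+b. \<integral>\<^sup>+a. F (\<lambda>j\<in>insert k J. \<phi> (a j) (b j)) \<partial>PiM (insert k J) (\<lambda>_. A) \<partial>PiM (insert k J) (\<lambda>_. B))"
  proof (rule PB.product_nn_integral_insert_rev[symmetric])
    interpret PA': product_prob_space "\<lambda>_::'j. A" "insert k J" by unfold_locales
    show "(\<lambda>b. \<integral>\<^sup>+a. F (\<lambda>j\<in>insert k J. \<phi> (a j) (b j)) \<partial>PiM (insert k J) (\<lambda>_. A)) \<in> borel_measurable (PiM (insert k J) (\<lambda>_. B))"
      by (rule PA'.borel_measurable_nn_integral)
        (use measurable_compose[OF restr' insert.prems] in \<open>simp only: case_prod_unfold\<close>)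
  qed (use insert in auto)
  finally show ?case .
qed

text \<open>A weighted identity for one row carries over to independent rows, with one factor
  \<open>c\<close> for each row. This is the passage from a Gaussian row to a Gaussian
  matrix.\<close>

lemma nn_integral_PiM_weighted:
  fixes F :: "('j \<Rightarrow> 'c) \<Rightarrow> ennreal"
  assumes J: "finite J" and A: "prob_space A" and B: "prob_space B"
    and S [measurable]: "S \<in> A \<rightarrow>\<^sub>M M" and T [measurable]: "T \<in> B \<rightarrow>\<^sub>M M"
    and k [measurable]: "k \<in> borel_measurable A"
    and eq: "\<And>G. G \<in> borel_measurable M \<Longrightarrow> (\<integral>\<^sup>+a. k a * G (S a) \<partial>A) = c * (\<integral>\<^sup>+b. G (T b) \<partial>B)"
    and F: "F \<in> borel_measurable (PiM J (\<lambda>_. M))"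
  shows "(\<integral>\<^sup>+a. (\<Prod>j\<in>J. k (a j)) * F (\<lambda>j\<in>J. S (a j)) \<partial>PiM J (\<lambda>_. A)) =
    c ^ card J * (\<integral>\<^sup>+b. F (\<lambda>j\<in>J. T (b j)) \<partial>PiM J (\<lambda>_. B))"
  using J F
proof (induction J arbitrary: F)
  case empty
  then show ?case by (simp add: PiM_empty nn_integral_count_space_finite)
next
  case (insert i J)
  interpret A: prob_space A by fact
  interpret B: prob_space B by fact
  interpret PA: product_prob_space "\<lambda>_::'j. A" J by unfold_locales
  interpret PB: product_prob_space "\<lambda>_::'j. B" J by unfold_locales
  note [measurable] = insert.prems
  have fin: "finite J" by fact
  have rS [measurable]: "(\<lambda>a. \<lambda>j\<in>J'. S (a j)) \<in> PiM J' (\<lambda>_. A) \<rightarrow>\<^sub>M PiM J' (\<lambda>_. M)" for J'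
    by (rule measurable_restrict) measurable
  have rT [measurable]: "(\<lambda>a. \<lambda>j\<in>J'. T (a j)) \<in> PiM J' (\<lambda>_. B) \<rightarrow>\<^sub>M PiM J' (\<lambda>_. M)" for J'
    by (rule measurable_restrict) measurable
  have upd: "y \<in> space M \<Longrightarrow> (\<lambda>x. F (x(i := y))) \<in> borel_measurable (PiM J (\<lambda>_. M))" for y
    using insert.prems by measurable
  have eqS: "(\<lambda>j\<in>insert i J. S ((a'(i := a)) j)) = (\<lambda>j\<in>J. S (a' j))(i := S a)" for a a'
    using insert.hyps by (auto simp: fun_eq_iff)
  have eqT: "(\<lambda>j\<in>insert i J. T ((a'(i := a)) j)) = (\<lambda>j\<in>J. T (a' j))(i := T a)" for a a'
    using insert.hyps by (auto simp: fun_eq_iff)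
  have prodk: "(\<Prod>j\<in>insert i J. k ((a'(i := a)) j)) = k a * (\<Prod>j\<in>J. k (a' j))" for a a'
  proof -
    have "(\<Prod>j\<in>J. k ((a'(i := a)) j)) = (\<Prod>j\<in>J. k (a' j))"
      by (rule prod.cong) (use insert.hyps in auto)
    then show ?thesis using insert.hyps by simp
  qed
  have pk [measurable]: "(\<lambda>a. \<Prod>j\<in>J'. k (a j)) \<in> borel_measurable (PiM J' (\<lambda>_. A))" if "finite J'" for J'
    by (rule borel_measurable_prod_ennreal) measurable
  have "(\<integral>\<^sup>+a. (\<Prod>j\<in>insert i J. k (a j)) * F (\<lambda>j\<in>insert i J. S (a j)) \<partial>PiM (insert i J) (\<lambda>_. A)) =
     (\<integral>\<^sup>+a. \<integral>\<^sup>+a'. (\<Prod>j\<in>insert i J. k ((a'(i := a)) j)) * F (\<lambda>j\<in>insert i J. S ((a'(i := a)) j)) \<partial>PiM J (\<lambda>_. A) \<partial>A)"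
    by (rule PA.product_nn_integral_insert_rev) (use insert pk[of "insert i J"] in \<open>auto intro!: borel_measurable_times_ennreal measurable_compose[OF rS]\<close>)
  also have "\<dots> = (\<integral>\<^sup>+a. k a * (c ^ card J * (\<integral>\<^sup>+b. F ((\<lambda>j\<in>J. T (b j))(i := S a)) \<partial>PiM J (\<lambda>_. B))) \<partial>A)"
  proof (intro nn_integral_cong)
    fix a assume a: "a \<in> space A"
    then have Sa: "S a \<in> space M" by (rule measurable_space[OF S])
    have m: "(\<lambda>a'. (\<Prod>j\<in>J. k (a' j)) * F ((\<lambda>j\<in>J. S (a' j))(i := S a))) \<in> borel_measurable (PiM J (\<lambda>_. A))"
      by (intro borel_measurable_times_ennreal pk fin measurable_compose[OF rS upd[OF Sa]])
    have "(\<integral>\<^sup>+a'. (\<Prod>j\<in>insert i J. k ((a'(i := a)) j)) * F (\<lambda>j\<in>insert i J. S ((a'(i := a)) j)) \<partial>PiM J (\<lambda>_. A)) =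
       k a * (\<integral>\<^sup>+a'. (\<Prod>j\<in>J. k (a' j)) * F ((\<lambda>j\<in>J. S (a' j))(i := S a)) \<partial>PiM J (\<lambda>_. A))"
      unfolding prodk eqS mult.assoc by (rule nn_integral_cmult[OF m])
    also have "\<dots> = k a * (c ^ card J * (\<integral>\<^sup>+b. F ((\<lambda>j\<in>J. T (b j))(i := S a)) \<partial>PiM J (\<lambda>_. B)))"
      by (simp only: insert.IH[OF upd[OF Sa]])
    finally show "(\<integral>\<^sup>+a'. (\<Prod>j\<in>insert i J. k ((a'(i := a)) j)) * F (\<lambda>j\<in>insert i J. S ((a'(i := a)) j)) \<partial>PiM J (\<lambda>_. A)) =
      k a * (c ^ card J * (\<integral>\<^sup>+b. F ((\<lambda>j\<in>J. T (b j))(i := S a)) \<partial>PiM J (\<lambda>_. B)))" .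
  qed
  also have "\<dots> = c * (\<integral>\<^sup>+b. c ^ card J * (\<integral>\<^sup>+b'. F ((\<lambda>j\<in>J. T (b' j))(i := T b)) \<partial>PiM J (\<lambda>_. B)) \<partial>B)"
    by (rule eq[where G = "\<lambda>y. c ^ card J * (\<integral>\<^sup>+b'. F ((\<lambda>j\<in>J. T (b' j))(i := y)) \<partial>PiM J (\<lambda>_. B))"]) measurable
  also have "\<dots> = c ^ card (insert i J) * (\<integral>\<^sup>+b. (\<integral>\<^sup>+b'. F (\<lambda>j\<in>insert i J. T ((b'(i := b)) j)) \<partial>PiM J (\<lambda>_. B)) \<partial>B)"
    unfolding eqT using insert.hyps by (subst nn_integral_cmult) (measurable, simp add: mult.assoc)
  also have "(\<integral>\<^sup>+b. (\<integral>\<^sup>+b'. F (\<lambda>j\<in>insert i J. T ((b'(i := b)) j)) \<partial>PiM J (\<lambda>_. B)) \<partial>B) =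
     (\<integral>\<^sup>+b. F (\<lambda>j\<in>insert i J. T (b j)) \<partial>PiM (insert i J) (\<lambda>_. B))"
    by (rule PB.product_nn_integral_insert_rev[symmetric]) (use insert in \<open>auto intro!: measurable_compose[OF rT]\<close>)
  finally show ?case .
qed

section \<open>Counting common zeros\<close>

text \<open>Compactness is what turns the existence of a common zero into a condition on countably
  many points. The property holds for open subsets of a manifold and survives intersection with a
  closed set, so the pieces of a disjointed open cover have it too.\<close>

definition sigma_compact_traces :: "'a::topological_space set \<Rightarrow> bool" where
  "sigma_compact_traces B \<longleftrightarrow>
     (\<forall>W. open W \<longrightarrow> (\<exists>K :: nat \<Rightarrow> 'a set. (\<forall>n. compact (K n)) \<and> W \<inter> B = (\<Union>n. K n)))"

lemma sigma_compact_traces_Int_closed: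
  assumes "sigma_compact_traces B" "closed C"
  shows "sigma_compact_traces (B \<inter> C)"
  unfolding sigma_compact_traces_def
proof (intro allI impI)
  fix W :: "'a set" assume "open W"
  then obtain K :: "nat \<Rightarrow> 'a set" where K: "\<And>n. compact (K n)" "W \<inter> B = (\<Union>n. K n)"
    using assms(1) unfolding sigma_compact_traces_def by blast
  have "W \<inter> (B \<inter> C) = (\<Union>n. K n \<inter> C)" using K(2) by auto
  then show "\<exists>K :: nat \<Rightarrow> 'a set. (\<forall>n. compact (K n)) \<and> W \<inter> (B \<inter> C) = (\<Union>n. K n)"
    using K(1) assms(2) by (intro exI[of _ "\<lambda>n. K n \<inter> C"]) (auto intro: compact_Int_closed)
qed

lemma countable_dense_subset:
  fixes K :: "'a::second_countable_topology set"
  obtains D where "countable D" "D \<subseteq> K" "\<And>W. open W \<Longrightarrow> W \<inter> K \<noteq> {} \<Longrightarrow> W \<inter> D \<noteq> {}"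
proof -
  obtain \<B> :: "'a set set" where \<B>: "countable \<B>" "topological_basis \<B>"
    using ex_countable_basis by blast
  define c where "c b = (SOME x. x \<in> b \<inter> K)" for b
  let ?D = "c ` {b \<in> \<B>. b \<inter> K \<noteq> {}}"
  have c: "c b \<in> b \<inter> K" if "b \<inter> K \<noteq> {}" for b
    unfolding c_def by (rule someI_ex) (use that in blast)
  show ?thesis
  proof (rule that[of ?D])
    show "countable ?D" using \<B>(1) by (intro countable_image) (rule countable_subset, auto)
    show "?D \<subseteq> K" using c by auto
    fix W :: "'a set" assume "open W" "W \<inter> K \<noteq> {}"
    then obtain x where x: "x \<in> W" "x \<in> K" by blast
    obtain b where b: "b \<in> \<B>" "x \<in> b" "b \<subseteq> W"
      using topological_basisE[OF \<B>(2) \<open>open W\<close> x(1)] by blast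
    then have "c b \<in> W \<inter> ?D" using c[of b] x by blast
    then show "W \<inter> ?D \<noteq> {}" by blast
  qed
qed

text \<open>On a compact set the sum of the \<open>\<bar>h j x\<bar>\<close> attains its infimum,
  and arbitrarily small values, even on a dense subset only, force the minimum to be 0. With a
  countable \<open>D\<close> the right-hand side involves countably many values of
  \<open>h\<close>.\<close>

lemma ex_zero_iff_dense:
  fixes h :: "nat \<Rightarrow> 'a::topological_space \<Rightarrow> real"
  assumes K: "compact K" and D: "D \<subseteq> K" "\<And>W. open W \<Longrightarrow> W \<inter> K \<noteq> {} \<Longrightarrow> W \<inter> D \<noteq> {}"
    and h: "\<And>j. j < m \<Longrightarrow> continuous_on K (h j)"
  shows "(\<exists>x\<in>K. \<forall>j<m. h j x = 0) \<longleftrightarrow> (\<forall>n. \<exists>x\<in>D. \<forall>j<m. \<bar>h j x\<bar> < 1 / real (Suc n))"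
proof
  define g where "g x = (\<Sum>j<m. \<bar>h j x\<bar>)" for x
  have g: "continuous_on K g" unfolding g_def by (intro continuous_intros) (use h in auto)
  have g0: "0 \<le> g x" for x unfolding g_def by (rule sum_nonneg) simp
  {
    assume "\<exists>x\<in>K. \<forall>j<m. h j x = 0"
    then obtain x where x: "x \<in> K" "\<forall>j<m. h j x = 0" by blast
    show "\<forall>n. \<exists>x\<in>D. \<forall>j<m. \<bar>h j x\<bar> < 1 / real (Suc n)"
    proof
      fix n
      obtain W where W: "open W" "W \<inter> K = g -` {..< 1 / real (Suc n)} \<inter> K"
        using g[unfolded continuous_on_open_invariant, rule_format, of "{..< 1 / real (Suc n)}"] by auto
      have "g x = 0" using x by (simp add: g_def)
      then have "x \<in> W" using W x by auto
      then obtain y where y: "y \<in> W" "y \<in> D" using D(2)[OF W(1)] x by blast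
      then have gy: "g y < 1 / real (Suc n)" using W(2) D(1) by blast
      have "\<bar>h j y\<bar> \<le> g y" if "j < m" for j
        unfolding g_def by (rule member_le_sum) (use that in auto)
      then show "\<exists>x\<in>D. \<forall>j<m. \<bar>h j x\<bar> < 1 / real (Suc n)"
        using y gy by (meson le_less_trans)
    qed
  }
  assume *: "\<forall>n. \<exists>x\<in>D. \<forall>j<m. \<bar>h j x\<bar> < 1 / real (Suc n)"
  then have "K \<noteq> {}" using D(1) by blast
  then obtain x where x: "x \<in> K" "\<And>y. y \<in> K \<Longrightarrow> g x \<le> g y"
    using continuous_attains_inf[OF K _ g] by blast
  have le: "g x \<le> real m * (1 / real (Suc n))" for n
  proof -
    obtain y where y: "y \<in> D" "\<And>j. j < m \<Longrightarrow> \<bar>h j y\<bar> < 1 / real (Suc n)" using * by blast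
    have "g x \<le> g y" using x(2) y(1) D(1) by blast
    also have "g y \<le> (\<Sum>j<m. 1 / real (Suc n))"
      unfolding g_def by (rule sum_mono) (use y(2) in \<open>auto intro: less_imp_le\<close>)
    finally show ?thesis by simp
  qed
  have "(\<lambda>n. real m * (1 / real (Suc n))) \<longlonglongrightarrow> real m * 0"
    by (intro tendsto_intros LIMSEQ_Suc lim_1_over_n)
  then have "g x \<le> 0" using le by (intro LIMSEQ_le_const[of _ "real m * 0" "g x", simplified]) auto
  then have "g x = 0" using g0[of x] by simp
  then have "h j x = 0" if "j < m" for j
    using that unfolding g_def by (subst (asm) sum_nonneg_eq_0_iff) auto
  then show "\<exists>x\<in>K. \<forall>j<m. h j x = 0" using x(1) by blast
qed

lemma finite_separated_by_basis:
  fixes F :: "'a::t2_space set"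
  assumes F: "finite F" and \<B>: "topological_basis \<B>"
  obtains b where "\<And>x. x \<in> F \<Longrightarrow> b x \<in> \<B> \<and> x \<in> b x" "\<And>x y. x \<in> F \<Longrightarrow> y \<in> F \<Longrightarrow> x \<noteq> y \<Longrightarrow> b x \<inter> b y = {}"
proof -
  have "\<forall>p. \<exists>UV. fst p \<noteq> snd p \<longrightarrow> open (fst UV) \<and> open (snd UV) \<and> fst p \<in> fst UV \<and> snd p \<in> snd UV \<and> fst UV \<inter> snd UV = ({} :: 'a set)"
  proof
    fix p :: "'a \<times> 'a"
    show "\<exists>UV. fst p \<noteq> snd p \<longrightarrow> open (fst UV) \<and> open (snd UV) \<and> fst p \<in> fst UV \<and> snd p \<in> snd UV \<and> fst UV \<inter> snd UV = {}"
    proof (cases "fst p = snd p")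
      case False
      then obtain U V where "open U" "open V" "fst p \<in> U" "snd p \<in> V" "U \<inter> V = {}"
        using hausdorff[OF False] by blast
      then show ?thesis by (intro exI[of _ "(U, V)"]) simp
    qed simp
  qed
  then have "\<exists>s :: 'a \<times> 'a \<Rightarrow> 'a set \<times> 'a set. \<forall>p. fst p \<noteq> snd p \<longrightarrow> open (fst (s p)) \<and> open (snd (s p)) \<and>
      fst p \<in> fst (s p) \<and> snd p \<in> snd (s p) \<and> fst (s p) \<inter> snd (s p) = {}"
    by (rule choice)
  then obtain s :: "'a \<times> 'a \<Rightarrow> 'a set \<times> 'a set" where s': "\<And>p. fst p \<noteq> snd p \<Longrightarrow> open (fst (s p)) \<and> open (snd (s p)) \<and>
      fst p \<in> fst (s p) \<and> snd p \<in> snd (s p) \<and> fst (s p) \<inter> snd (s p) = {}"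
    by blast
  have s: "open (fst (s (x, y))) \<and> open (snd (s (x, y))) \<and>
      x \<in> fst (s (x, y)) \<and> y \<in> snd (s (x, y)) \<and> fst (s (x, y)) \<inter> snd (s (x, y)) = {}" if "x \<noteq> y" for x y
    using s'[of "(x, y)"] that by simp
  \<comment> \<open>The choice \<open>s\<close> need not be symmetric, so the first set for
    \<open>(x, y)\<close> and the second one for \<open>(y, x)\<close> are both imposed; then
    \<open>W x\<close> and \<open>W y\<close> lie in the two disjoint sets chosen for
    \<open>(x, y)\<close>.\<close>
  define W where "W x = (\<Inter>y\<in>F - {x}. fst (s (x, y)) \<inter> snd (s (y, x)))" for x
  have W: "open (W x)" "x \<in> W x" for x
  proof -
    show "open (W x)" unfolding W_def
    proof (rule open_INT)
      show "\<forall>y\<in>F - {x}. open (fst (s (x, y)) \<inter> snd (s (y, x)))"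
      proof
        fix y assume "y \<in> F - {x}"
        then show "open (fst (s (x, y)) \<inter> snd (s (y, x)))" using s[of x y] s[of y x] by blast
      qed
    qed (use F in simp)
    show "x \<in> W x" unfolding W_def
    proof (rule INT_I)
      fix y assume "y \<in> F - {x}"
      then show "x \<in> fst (s (x, y)) \<inter> snd (s (y, x))" using s[of x y] s[of y x] by blast
    qed
  qed
  have "\<exists>b. b \<in> \<B> \<and> x \<in> b \<and> b \<subseteq> W x" for x
    using topological_basisE[OF \<B> W(1) W(2)] by blast
  then have "\<exists>b. \<forall>x. b x \<in> \<B> \<and> x \<in> b x \<and> b x \<subseteq> W x" by (intro choice allI)
  then obtain b where b: "\<And>x. b x \<in> \<B> \<and> x \<in> b x \<and> b x \<subseteq> W x" by blast
  show ?thesis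
  proof (rule that)
    show "b x \<in> \<B> \<and> x \<in> b x" for x using b by blast
    fix x y assume xy: "x \<in> F" "y \<in> F" "x \<noteq> y"
    have "W x \<inter> W y \<subseteq> fst (s (x, y)) \<inter> snd (s (x, y))"
      unfolding W_def using xy by blast
    then show "b x \<inter> b y = {}" using b[of x] b[of y] s[OF xy(3)] by blast
  qed
qed

text \<open>Cardinality as the largest number of disjoint basic open sets that meet
  \<open>S\<close>: finitely many points are separated by such sets, and conversely one point is
  picked from each set. With a countable basis the count is thus expressed by the countably many
  events that \<open>b\<close> meets \<open>S\<close>.\<close>

lemma emeasure_count_space_disjoint_basis:
  fixes S :: "'a::t2_space set"
  assumes \<B>: "topological_basis \<B>"
  defines "\<P> \<equiv> {\<C>. finite \<C> \<and> \<C> \<subseteq> \<B> \<and> disjoint \<C>}"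
  shows "emeasure (count_space UNIV) S = (SUP \<C>\<in>\<P>. \<Sum>b\<in>\<C>. (if b \<inter> S \<noteq> {} then 1 else 0 :: ennreal))"
proof (rule antisym)
  have fin: "of_nat (card F) \<le> (SUP \<C>\<in>\<P>. \<Sum>b\<in>\<C>. (if b \<inter> S \<noteq> {} then 1 else 0 :: ennreal))"
    if F: "finite F" "F \<subseteq> S" for F
  proof -
    obtain b where b: "\<And>x. x \<in> F \<Longrightarrow> b x \<in> \<B> \<and> x \<in> b x"
      "\<And>x y. x \<in> F \<Longrightarrow> y \<in> F \<Longrightarrow> x \<noteq> y \<Longrightarrow> b x \<inter> b y = {}"
      by (rule finite_separated_by_basis[OF F(1) \<B>]) blast
    have inj: "inj_on b F"
    proof (rule inj_onI, rule ccontr)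
      fix x y assume "x \<in> F" "y \<in> F" "b x = b y" "x \<noteq> y"
      then show False using b(1)[of x] b(2)[of x y] by auto
    qed
    have "disjoint (b ` F)"
      unfolding disjoint_def
    proof (intro ballI impI)
      fix A C assume "A \<in> b ` F" "C \<in> b ` F" and ne: "A \<noteq> C"
      then obtain x y where "x \<in> F" "A = b x" "y \<in> F" "C = b y" by blast
      then show "A \<inter> C = {}" using b(2)[of x y] ne by (cases "x = y") simp_all
    qed
    then have P: "b ` F \<in> \<P>"
      unfolding \<P>_def using F(1) b(1) by blast
    have "(\<Sum>c\<in>b ` F. (if c \<inter> S \<noteq> {} then 1 else 0 :: ennreal)) = (\<Sum>c\<in>b ` F. 1)"
      by (rule sum.cong) (use b(1) F(2) in auto)
    also have "\<dots> = of_nat (card F)" using inj by (simp add: card_image)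
    finally show ?thesis using SUP_upper[OF P, of "\<lambda>\<C>. \<Sum>b\<in>\<C>. (if b \<inter> S \<noteq> {} then 1 else 0 :: ennreal)"]
      by simp
  qed
  show "emeasure (count_space UNIV) S \<le> (SUP \<C>\<in>\<P>. \<Sum>b\<in>\<C>. (if b \<inter> S \<noteq> {} then 1 else 0 :: ennreal))"
  proof (cases "finite S")
    case True
    then show ?thesis using fin[of S] by (simp add: emeasure_count_space_finite)
  next
    case False
    have "of_nat n \<le> (SUP \<C>\<in>\<P>. \<Sum>b\<in>\<C>. (if b \<inter> S \<noteq> {} then 1 else 0 :: ennreal))" for n
    proof -
      obtain F where "finite F" "card F = n" "F \<subseteq> S" using infinite_arbitrarily_large[OF False] by blast
      then show ?thesis using fin by blast
    qed
    then have "(SUP \<C>\<in>\<P>. \<Sum>b\<in>\<C>. (if b \<inter> S \<noteq> {} then 1 else 0 :: ennreal)) = \<infinity>"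
      by (metis ennreal_Ex_less_of_nat not_less top.not_eq_extremum infinity_ennreal_def)
    then show ?thesis by (simp only: infinity_ennreal_def top_greatest)
  qed
  show "(SUP \<C>\<in>\<P>. \<Sum>b\<in>\<C>. (if b \<inter> S \<noteq> {} then 1 else 0 :: ennreal)) \<le> emeasure (count_space UNIV) S"
  proof (rule SUP_least)
    fix \<C> assume \<C>: "\<C> \<in> \<P>"
    let ?C = "{b \<in> \<C>. b \<inter> S \<noteq> {}}"
    define c where "c b = (SOME x. x \<in> b \<inter> S)" for b
    have c: "c b \<in> b \<inter> S" if "b \<in> ?C" for b
      unfolding c_def by (rule someI_ex) (use that in blast)
    have inj: "inj_on c ?C"
    proof (rule inj_onI, rule ccontr)
      fix x y assume xy: "x \<in> ?C" "y \<in> ?C" "c x = c y" "x \<noteq> y"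
      then have "x \<inter> y = {}" using \<C> unfolding \<P>_def disjoint_def by blast
      then show False using c[OF xy(1)] c[OF xy(2)] xy(3) by auto
    qed
    have "(\<Sum>b\<in>\<C>. (if b \<inter> S \<noteq> {} then 1 else 0 :: ennreal)) = of_nat (card ?C)"
      using \<C> by (simp add: \<P>_def sum.If_cases Int_def)
    also have "\<dots> = emeasure (count_space UNIV) (c ` ?C)"
      using \<C> inj by (simp add: \<P>_def emeasure_count_space_finite card_image)
    also have "\<dots> \<le> emeasure (count_space UNIV) S"
      by (rule emeasure_mono) (use c in auto)
    finally show "(\<Sum>b\<in>\<C>. (if b \<inter> S \<noteq> {} then 1 else 0 :: ennreal)) \<le> emeasure (count_space UNIV) S" .
  qed
qed

text \<open>The number of common zeros is not measurable on the space of all paths, but it agrees on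
  continuous paths with a functional that only looks at countably many points.\<close>

lemma zero_count_functional:
  fixes B :: "'a::{t2_space,second_countable_topology} set"
  assumes B: "sigma_compact_traces B"
  obtains \<Phi> :: "(nat \<Rightarrow> 'a \<Rightarrow> real) \<Rightarrow> ennreal" where
    "\<Phi> \<in> borel_measurable (PiM {..<m} (\<lambda>_. PiM UNIV (\<lambda>_. borel)))"
    "\<And>h. (\<And>j. j < m \<Longrightarrow> continuous_on B (h j)) \<Longrightarrow>
       \<Phi> h = emeasure (count_space UNIV) {x \<in> B. \<forall>j<m. h j x = 0}"
proof -
  obtain \<B> :: "'a set set" where \<B>: "countable \<B>" "topological_basis \<B>"
    using ex_countable_basis by blast
  define K where "K b = (SOME K :: nat \<Rightarrow> 'a set. (\<forall>n. compact (K n)) \<and> b \<inter> B = (\<Union>n. K n))" for b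
  have K': "(\<forall>n. compact (K b n)) \<and> b \<inter> B = (\<Union>n. K b n)" if "b \<in> \<B>" for b
    unfolding K_def
  proof (rule someI_ex[of "\<lambda>K :: nat \<Rightarrow> 'a set. (\<forall>n. compact (K n)) \<and> b \<inter> B = (\<Union>n. K n)"])
    have "open b" using that by (rule topological_basis_open[OF \<B>(2)])
    from B[unfolded sigma_compact_traces_def, rule_format, OF this]
    show "\<exists>K :: nat \<Rightarrow> 'a set. (\<forall>n. compact (K n)) \<and> b \<inter> B = (\<Union>n. K n)" .
  qed
  have K: "compact (K b n)" "b \<inter> B = (\<Union>n. K b n)" if "b \<in> \<B>" for b n
    using K'[OF that] by simp_all
  define D where "D b n = (SOME D. countable D \<and> D \<subseteq> K b n \<and>
      (\<forall>W. open W \<longrightarrow> W \<inter> K b n \<noteq> {} \<longrightarrow> W \<inter> D \<noteq> {}))" for b n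
  have D': "countable (D b n) \<and> D b n \<subseteq> K b n \<and> (\<forall>W. open W \<longrightarrow> W \<inter> K b n \<noteq> {} \<longrightarrow> W \<inter> D b n \<noteq> {})" for b n
    unfolding D_def
  proof (rule someI_ex[of "\<lambda>D. countable D \<and> D \<subseteq> K b n \<and>
      (\<forall>W. open W \<longrightarrow> W \<inter> K b n \<noteq> {} \<longrightarrow> W \<inter> D \<noteq> {})"])
    show "\<exists>D. countable D \<and> D \<subseteq> K b n \<and> (\<forall>W. open W \<longrightarrow> W \<inter> K b n \<noteq> {} \<longrightarrow> W \<inter> D \<noteq> {})"
    proof (rule countable_dense_subset[of "K b n"])
      fix C assume "countable C" "C \<subseteq> K b n" "\<And>W. open W \<Longrightarrow> W \<inter> K b n \<noteq> {} \<Longrightarrow> W \<inter> C \<noteq> {}"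
      then show ?thesis by (intro exI[of _ C]) simp
    qed
  qed
  have D: "countable (D b n)" "D b n \<subseteq> K b n" "open W \<Longrightarrow> W \<inter> K b n \<noteq> {} \<Longrightarrow> W \<inter> D b n \<noteq> {}" for b n W
    using D'[of b n] by simp_all
  \<comment> \<open>For continuous \<open>h\<close>, the event of a common zero in
    \<open>b \<inter> B\<close>: this set is the union of the compact sets \<open>K b n\<close>, and
    \<open>D b n\<close> is a countable dense subset of \<open>K b n\<close>.\<close>
  define Z where "Z b h \<longleftrightarrow> (\<exists>n. \<forall>i. \<exists>x\<in>D b n. \<forall>j\<in>{..<m}. \<bar>h j x\<bar> < 1 / real (Suc i))"
    for b and h :: "nat \<Rightarrow> 'a \<Rightarrow> real"
  define \<P> where "\<P> = {\<C>. finite \<C> \<and> \<C> \<subseteq> \<B> \<and> disjoint \<C>}"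
  define \<Phi> where "\<Phi> h = (SUP \<C>\<in>\<P>. \<Sum>b\<in>\<C>. (if Z b h then 1 else 0 :: ennreal))" for h
  have cP: "countable \<P>"
    by (rule countable_subset[OF _ countable_Collect_finite_subset[OF \<B>(1)]]) (auto simp: \<P>_def)
  show ?thesis
  proof (rule that)
    have "Measurable.pred (PiM {..<m} (\<lambda>_. PiM UNIV (\<lambda>_. borel))) (Z b)" for b
    proof -
      have [measurable]: "(\<lambda>h. h j x) \<in> borel_measurable (PiM {..<m} (\<lambda>_. PiM UNIV (\<lambda>_. borel :: real measure)))"
        if "j \<in> {..<m}" for j and x :: 'a
        by (rule measurable_compose[OF measurable_component_singleton[OF that] measurable_component_singleton]) simp
      have "Measurable.pred (PiM {..<m} (\<lambda>_. PiM UNIV (\<lambda>_. borel)))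
          (\<lambda>h. \<exists>x\<in>D b n. \<forall>j\<in>{..<m}. \<bar>h j x\<bar> < 1 / real (Suc i))" for n i
        unfolding pred_def by (rule sets.sets_Collect_countable_Ex'[OF _ D(1)]) measurable
      then show ?thesis unfolding Z_def by (intro pred_intros_countable)
    qed
    note this [measurable]
    show "\<Phi> \<in> borel_measurable (PiM {..<m} (\<lambda>_. PiM UNIV (\<lambda>_. borel)))"
      unfolding \<Phi>_def by (rule borel_measurable_SUP[OF cP]) measurable
  next
    fix h :: "nat \<Rightarrow> 'a \<Rightarrow> real" assume h: "\<And>j. j < m \<Longrightarrow> continuous_on B (h j)"
    let ?S = "{x \<in> B. \<forall>j<m. h j x = 0}"
    have ZS: "Z b h \<longleftrightarrow> b \<inter> ?S \<noteq> {}" if b: "b \<in> \<B>" for b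
    proof -
      have "Z b h \<longleftrightarrow> (\<exists>n. \<exists>x\<in>K b n. \<forall>j<m. h j x = 0)"
      proof -
        have "(\<exists>x\<in>K b n. \<forall>j<m. h j x = 0) \<longleftrightarrow> (\<forall>i. \<exists>x\<in>D b n. \<forall>j<m. \<bar>h j x\<bar> < 1 / real (Suc i))" for n
        proof (rule ex_zero_iff_dense[OF K(1)[OF b] D(2,3)])
          have "K b n \<subseteq> B" using K(2)[OF b] by blast
          then show "continuous_on (K b n) (h j)" if "j < m" for j
            using h[OF that] continuous_on_subset by blast
        qed
        then show ?thesis unfolding Z_def by (simp only: Ball_def lessThan_iff)
      qed
      also have "\<dots> \<longleftrightarrow> b \<inter> ?S \<noteq> {}" using K(2)[OF b] by blast
      finally show ?thesis .
    qed
    show "\<Phi> h = emeasure (count_space UNIV) ?S"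
      unfolding \<Phi>_def emeasure_count_space_disjoint_basis[OF \<B>(2)] \<P>_def[symmetric]
      by (intro SUP_cong sum.cong refl if_cong ZS) (auto simp: \<P>_def)
  qed
qed

section \<open>The Kac--Rice formula in coordinates\<close>

text \<open>\<open>expected_zeros\<close> numbers the copies by naturals, while the rows of a matrix
  are indexed by \<open>'m\<close>; a fixed bijection translates.\<close>

definition coord_index :: "'m::finite \<Rightarrow> nat" where
  "coord_index = (SOME r. bij_betw r UNIV {..<CARD('m)})"

lemma bij_coord_index: "bij_betw (coord_index :: 'm::finite \<Rightarrow> nat) UNIV {..<CARD('m)}"
proof -
  have "\<exists>r :: 'm \<Rightarrow> nat. bij_betw r UNIV {..<CARD('m)}"
    using ex_bij_betw_finite_nat[of "UNIV :: 'm set"] by (simp add: atLeast0LessThan)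
  then show ?thesis unfolding coord_index_def by (rule someI_ex)
qed

lemma coord_index_less [simp]: "coord_index (k :: 'm::finite) < CARD('m)"
  using bij_betwE[OF bij_coord_index] by auto

text \<open>The expression in \<open>gram_matrix\<close>, for a quadratic form that is already
  written in coordinates.\<close>

definition polar_matrix :: "(real ^ 'm \<Rightarrow> real) \<Rightarrow> real ^ 'm ^ 'm" where
  "polar_matrix q = (\<chi> i j. (q (axis i 1 + axis j 1) - q (axis i 1) - q (axis j 1)) / 2)"

lemma det_scaleR:
  fixes A :: "real ^ 'm::finite ^ 'm"
  shows "det (c *\<^sub>R A) = c ^ CARD('m) * det A"
  by (simp add: det_def prod.distrib sum_distrib_left mult_ac)

lemma polar_matrix_norm:
  fixes L :: "real ^ 'm::finite \<Rightarrow> 'e::real_inner"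
  assumes "linear L"
  shows "polar_matrix (\<lambda>u. (norm (L u))\<^sup>2 / R) = (\<chi> i j. (L (axis i 1) \<bullet> L (axis j 1)) / R)"
  by (simp add: polar_matrix_def vec_eq_iff linear_add[OF assms] power2_norm_eq_inner inner_simps
      inner_commute add_divide_distrib diff_divide_distrib)

text \<open>The matrix of the form is \<open>matrix B ** transpose (matrix B)\<close> divided by
  \<open>R\<close>, so up to the power of \<open>R\<close> its determinant is a square.\<close>

lemma sqrt_det_polar_matrix:
  fixes B :: "real ^ 'm::finite \<Rightarrow> real ^ 'm"
  assumes B: "linear B" and R: "R > 0"
  shows "sqrt (det (polar_matrix (\<lambda>u. (norm (adjoint B u))\<^sup>2 / R))) = \<bar>det (matrix B)\<bar> / sqrt R ^ CARD('m)"
proof -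
  have adj: "adjoint B (axis i 1) $ j = matrix B $ i $ j" for i j
  proof -
    have "adjoint B (axis i 1) $ j = axis j 1 \<bullet> adjoint B (axis i 1)" by (simp add: inner_axis')
    also have "\<dots> = matrix B $ i $ j" unfolding adjoint_works[OF B] by (simp add: inner_axis matrix_def)
    finally show ?thesis .
  qed
  have "polar_matrix (\<lambda>u. (norm (adjoint B u))\<^sup>2 / R) = (1 / R) *\<^sub>R (matrix B ** transpose (matrix B))"
    unfolding polar_matrix_norm[OF adjoint_linear[OF B]]
    by (simp add: vec_eq_iff inner_vec_def matrix_matrix_mult_def transpose_def adj)
  then have "det (polar_matrix (\<lambda>u. (norm (adjoint B u))\<^sup>2 / R)) = (1 / R) ^ CARD('m) * (det (matrix B))\<^sup>2"
    by (simp add: det_scaleR det_mul det_transpose power2_eq_square)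
  then show ?thesis
    using R by (simp add: real_sqrt_mult real_sqrt_divide real_sqrt_power[of R] power_one_over)
qed

lemma borel_measurable_vec_nth [measurable]: "(\<lambda>x :: real ^ 'm::finite. x $ i) \<in> borel_measurable borel"
  by (intro borel_measurable_continuous_onI continuous_intros)

lemma borel_measurable_det [measurable (raw)]:
  fixes F :: "'a \<Rightarrow> 'm::finite \<Rightarrow> real ^ 'm"
  assumes [measurable]: "\<And>k. (\<lambda>x. F x k) \<in> borel_measurable M"
  shows "(\<lambda>x. det (\<chi> k. F x k)) \<in> borel_measurable M"
  unfolding det_def by simp

text \<open>The mean absolute determinant of a square matrix with independent standard Gaussian
  rows. It stays unevaluated in the Kac--Rice formula; its value is found in
  \<open>abs_det_mean_eq\<close>.\<close>

definition abs_det_mean :: "'m::finite itself \<Rightarrow> ennreal" where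
  "abs_det_mean _ = (\<integral>\<^sup>+g. ennreal \<bar>det (\<chi> k :: 'm. (g (coord_index k) :: real ^ 'm))\<bar>
     \<partial>PiM {..<CARD('m)} (\<lambda>_. std_gaussian))"

text \<open>Under the weights each row is distributed, up to a constant, as \<open>B x\<close> with
  \<open>x\<close> standard Gaussian, and \<open>B\<close> is the same for all rows; so
  \<open>\<bar>det (matrix B)\<bar>\<close> factors out. The constant contributes
  \<open>1 / sqrt R\<close> for every row, which amounts to dividing the quadratic form by
  \<open>R\<close>.\<close>

lemma gaussian_det_expectation:
  fixes \<phi> :: "'i \<Rightarrow> real" and L :: "'i \<Rightarrow> real ^ 'm::finite"
  assumes I: "finite I"
  defines "R \<equiv> 1 + (\<Sum>i\<in>I. (\<phi> i)\<^sup>2)"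
  shows "(\<integral>\<^sup>+W. (\<Prod>j\<in>{..<CARD('m)}. ennreal (std_normal_density (\<Sum>i\<in>I. W j i * \<phi> i))) *
       ennreal \<bar>det (\<chi> k. \<Sum>i\<in>I. W (coord_index k) i *\<^sub>R L i)\<bar> \<partial>PiM {..<CARD('m)} (\<lambda>_. PiM I (\<lambda>_. std_normal))) =
     abs_det_mean TYPE('m) * ennreal (sqrt (det (polar_matrix
       (\<lambda>u. (\<Sum>i\<in>I. (L i \<bullet> u)\<^sup>2) / R - (\<Sum>i\<in>I. \<phi> i * (L i \<bullet> u))\<^sup>2 / R\<^sup>2))) / sqrt (2 * pi) ^ CARD('m))"
proof -
  have R: "R > 0" unfolding R_def by (rule add_pos_nonneg) (auto intro: sum_nonneg)
  obtain B :: "real ^ 'm \<Rightarrow> real ^ 'm" where B: "linear B"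
    "\<And>u. (norm (adjoint B u))\<^sup>2 = (\<Sum>i\<in>I. (L i \<bullet> u)\<^sup>2) - (\<Sum>i\<in>I. \<phi> i * (L i \<bullet> u))\<^sup>2 / R"
    "\<And>F. F \<in> borel_measurable borel \<Longrightarrow>
       (\<integral>\<^sup>+w. ennreal (std_normal_density (\<Sum>i\<in>I. w i * \<phi> i)) * F (\<Sum>i\<in>I. w i *\<^sub>R L i) \<partial>PiM I (\<lambda>_. std_normal)) =
       ennreal (1 / sqrt (2 * pi * R)) * (\<integral>\<^sup>+x. F (B x) \<partial>std_gaussian)"
    unfolding R_def by (rule gaussian_reduce_weighted[OF I, of L \<phi>]) blast
  let ?J = "{..<CARD('m)}"
  define F where "F y = ennreal \<bar>det (\<chi> k. y (coord_index k))\<bar>" for y :: "nat \<Rightarrow> real ^ 'm"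
  have F: "F \<in> borel_measurable (PiM ?J (\<lambda>_. borel))"
    unfolding F_def by measurable
  have [measurable]: "B \<in> borel \<rightarrow>\<^sub>M borel" by (rule linear_measurable_borel[OF B(1)])
  interpret N: prob_space std_normal by (rule prob_space_std_normal)
  have "(\<integral>\<^sup>+W. (\<Prod>j\<in>?J. ennreal (std_normal_density (\<Sum>i\<in>I. W j i * \<phi> i))) * F (\<lambda>j\<in>?J. \<Sum>i\<in>I. W j i *\<^sub>R L i)
       \<partial>PiM ?J (\<lambda>_. PiM I (\<lambda>_. std_normal))) =
     ennreal (1 / sqrt (2 * pi * R)) ^ card ?J * (\<integral>\<^sup>+g. F (\<lambda>j\<in>?J. B (g j)) \<partial>PiM ?J (\<lambda>_. std_gaussian))"
  proof (rule nn_integral_PiM_weighted[where M = borel])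
    show "prob_space (PiM I (\<lambda>_. std_normal))" by (intro prob_space_PiM N.prob_space_axioms)
    show "prob_space std_gaussian" by (rule prob_space_std_gaussian)
  qed (use B(3) F in \<open>simp_all\<close>)
  also have "(\<integral>\<^sup>+g. F (\<lambda>j\<in>?J. B (g j)) \<partial>PiM ?J (\<lambda>_. std_gaussian)) =
      (\<integral>\<^sup>+g. ennreal \<bar>det (\<chi> k :: 'm. (g (coord_index k) :: real ^ 'm))\<bar> * ennreal \<bar>det (matrix B)\<bar> \<partial>PiM ?J (\<lambda>_. std_gaussian))"
  proof (rule nn_integral_cong)
    fix g :: "nat \<Rightarrow> real ^ 'm"
    have "(\<chi> k :: 'm. B (g (coord_index k))) = (\<chi> k. g (coord_index k)) ** transpose (matrix B)"
    proof -
      have "B v $ j = (\<Sum>i\<in>UNIV. v $ i * matrix B $ j $ i)" for v j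
        by (subst matrix_works[OF B(1)[folded linear_matrix_vector_mul_eq], symmetric]) (simp add: matrix_vector_mult_def mult.commute)
      then show ?thesis by (simp add: vec_eq_iff matrix_matrix_mult_def transpose_def)
    qed
    then show "F (\<lambda>j\<in>?J. B (g j)) = ennreal \<bar>det (\<chi> k :: 'm. (g (coord_index k) :: real ^ 'm))\<bar> * ennreal \<bar>det (matrix B)\<bar>"
      by (simp add: F_def det_mul det_transpose abs_mult ennreal_mult')
  qed
  also have "\<dots> = abs_det_mean TYPE('m) * ennreal \<bar>det (matrix B)\<bar>"
    unfolding abs_det_mean_def by (rule nn_integral_multc) measurable
  also have "ennreal (1 / sqrt (2 * pi * R)) ^ card ?J * (abs_det_mean TYPE('m) * ennreal \<bar>det (matrix B)\<bar>) =
      abs_det_mean TYPE('m) * ennreal (\<bar>det (matrix B)\<bar> / sqrt R ^ CARD('m) / sqrt (2 * pi) ^ CARD('m))"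
  proof -
    have "ennreal (1 / sqrt (2 * pi * R)) ^ card ?J = ennreal ((1 / sqrt (2 * pi * R)) ^ CARD('m))"
      using R by (simp add: ennreal_power)
    moreover have "ennreal ((1 / sqrt (2 * pi * R)) ^ CARD('m)) * ennreal \<bar>det (matrix B)\<bar> =
        ennreal (\<bar>det (matrix B)\<bar> / sqrt R ^ CARD('m) / sqrt (2 * pi) ^ CARD('m))"
      using R by (subst ennreal_mult'[symmetric])
        (simp_all add: real_sqrt_mult power_divide power_mult_distrib mult.commute)
    ultimately show ?thesis by (simp only: mult.left_commute)
  qed
  also have "\<bar>det (matrix B)\<bar> / sqrt R ^ CARD('m) = sqrt (det (polar_matrix
       (\<lambda>u. (\<Sum>i\<in>I. (L i \<bullet> u)\<^sup>2) / R - (\<Sum>i\<in>I. \<phi> i * (L i \<bullet> u))\<^sup>2 / R\<^sup>2)))"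
    unfolding sqrt_det_polar_matrix[OF B(1) R, symmetric] B(2)
    by (simp add: diff_divide_distrib power2_eq_square)
  finally show ?thesis
    by (simp add: F_def)
qed

text \<open>The quadratic form is unchanged when all functions are divided by \<open>f\<^sub>p\<close>.\<close>

lemma projective_form_eq:
  fixes P :: real
  assumes P: "P \<noteq> 0" and S0: "S0 \<ge> 0"
  shows "(\<delta>\<^sup>2 * S0 - 2 * P * \<delta> * S1 + P\<^sup>2 * S2) / P ^ 4 / (1 + S0 / P\<^sup>2) -
     ((P * S1 - \<delta> * S0) / P ^ 3)\<^sup>2 / (1 + S0 / P\<^sup>2)\<^sup>2 =
     (\<delta>\<^sup>2 + S2) / (P\<^sup>2 + S0) - (P * \<delta> + S1)\<^sup>2 / (P\<^sup>2 + S0)\<^sup>2"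
proof -
  define K where "K = P\<^sup>2 + S0"
  have K: "K > 0" unfolding K_def using P S0 by (simp add: add_pos_nonneg)
  have R: "1 + S0 / P\<^sup>2 = K / P\<^sup>2" using P by (simp add: K_def field_simps)
  have 1: "(\<delta>\<^sup>2 * S0 - 2 * P * \<delta> * S1 + P\<^sup>2 * S2) / P ^ 4 / (K / P\<^sup>2) =
      (\<delta>\<^sup>2 * S0 - 2 * P * \<delta> * S1 + P\<^sup>2 * S2) * K / (P\<^sup>2 * K\<^sup>2)"
    using P K by (simp add: field_simps power2_eq_square power4_eq_xxxx)
  have 2: "((P * S1 - \<delta> * S0) / P ^ 3)\<^sup>2 / (K / P\<^sup>2)\<^sup>2 = (P * S1 - \<delta> * S0)\<^sup>2 / (P\<^sup>2 * K\<^sup>2)"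
    using P K by (simp add: power_divide field_simps)
  have 3: "(\<delta>\<^sup>2 + S2) / K - (P * \<delta> + S1)\<^sup>2 / K\<^sup>2 = (P\<^sup>2 * (\<delta>\<^sup>2 + S2) * K - P\<^sup>2 * (P * \<delta> + S1)\<^sup>2) / (P\<^sup>2 * K\<^sup>2)"
    using P K by (simp add: field_simps power2_eq_square)
  have "(\<delta>\<^sup>2 * S0 - 2 * P * \<delta> * S1 + P\<^sup>2 * S2) * K - (P * S1 - \<delta> * S0)\<^sup>2 =
      P\<^sup>2 * (\<delta>\<^sup>2 + S2) * K - P\<^sup>2 * (P * \<delta> + S1)\<^sup>2"
    unfolding K_def by (simp add: power2_eq_square algebra_simps)
  then show ?thesis
    unfolding R 1 2 K_def[symmetric] 3 by (simp flip: diff_divide_distrib)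
qed

lemma measurable_matrix_entry:
  assumes "j \<in> J" "i \<in> K"
  shows "(\<lambda>Z. Z j i) \<in> borel_measurable (PiM J (\<lambda>_. PiM K (\<lambda>_. std_normal)))"
proof -
  have "(\<lambda>Z. Z j i) \<in> PiM J (\<lambda>_. PiM K (\<lambda>_. std_normal)) \<rightarrow>\<^sub>M std_normal"
    by (rule measurable_compose[OF measurable_component_singleton[OF assms(1)] measurable_component_singleton[OF assms(2)]])
  then show ?thesis by simp
qed

text \<open>Two sets occur because derivatives need an open set \<open>V\<close>, whereas zeros are
  counted on a piece \<open>B\<close> that need not be open. For every copy, \<open>W\<close> holds
  the coefficients of the functions other than \<open>f p\<close>; it is kept fixed while the
  coefficients of \<open>f p\<close> are integrated out, and averaged last, separately for each
  \<open>x\<close>.\<close>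

lemma kac_rice_local:
  fixes f :: "nat \<Rightarrow> real ^ 'm::finite \<Rightarrow> real" and B V :: "(real ^ 'm) set"
  assumes V: "open V" and B: "B \<in> sets borel" "B \<subseteq> V" "sigma_compact_traces B"
    and I: "finite I" "p \<notin> I"
    and der: "\<And>i x. i \<in> insert p I \<Longrightarrow> x \<in> V \<Longrightarrow> (f i has_derivative (\<lambda>v. D i x \<bullet> v)) (at x)"
    and D: "\<And>i. i \<in> insert p I \<Longrightarrow> continuous_on V (D i)"
    and fp: "\<And>x. x \<in> V \<Longrightarrow> f p x \<noteq> 0"
  defines "q x u \<equiv> (\<Sum>i\<in>insert p I. (D i x \<bullet> u)\<^sup>2) / (\<Sum>i\<in>insert p I. (f i x)\<^sup>2) -
      (\<Sum>i\<in>insert p I. f i x * (D i x \<bullet> u))\<^sup>2 / (\<Sum>i\<in>insert p I. (f i x)\<^sup>2)\<^sup>2"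
  shows "(\<integral>\<^sup>+Z. emeasure (count_space UNIV) {x \<in> B. \<forall>j<CARD('m). (\<Sum>i\<in>insert p I. Z j i * f i x) = 0}
       \<partial>PiM {..<CARD('m)} (\<lambda>_. PiM (insert p I) (\<lambda>_. std_normal))) =
     (\<integral>\<^sup>+x. abs_det_mean TYPE('m) * ennreal (sqrt (det (polar_matrix (q x))) / sqrt (2 * pi) ^ CARD('m)) * indicator B x \<partial>lborel)"
proof -
  let ?J = "{..<CARD('m)}"
  interpret N: prob_space std_normal by (rule prob_space_std_normal)
  interpret PI: product_prob_space "\<lambda>_::nat. std_normal" I by unfold_locales
  have pI: "prob_space (PiM K (\<lambda>_. std_normal))" for K :: "nat set"
    by (intro prob_space_PiM N.prob_space_axioms)
  interpret W: prob_space "PiM ?J (\<lambda>_. PiM I (\<lambda>_. std_normal))"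
    by (intro prob_space_PiM pI)
  interpret WL: pair_sigma_finite "PiM ?J (\<lambda>_. PiM I (\<lambda>_. std_normal))" "lborel :: (real ^ 'm) measure"
    by (simp add: pair_sigma_finite_def W.sigma_finite_measure_axioms lborel.sigma_finite_measure_axioms)
  have contf: "continuous_on V (f i)" if "i \<in> insert p I" for i
    by (rule has_derivative_continuous_on) (rule has_derivative_at_withinI, rule der[OF that])
  define cnt where "cnt h = emeasure (count_space UNIV) {x \<in> B. \<forall>j<CARD('m). h j x = 0}" for h :: "nat \<Rightarrow> real ^ 'm \<Rightarrow> real"
  obtain \<Phi> :: "(nat \<Rightarrow> real ^ 'm \<Rightarrow> real) \<Rightarrow> ennreal" where
    \<Phi>: "\<Phi> \<in> borel_measurable (PiM ?J (\<lambda>_. PiM UNIV (\<lambda>_. borel)))"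
    "\<And>h. (\<And>j. j < CARD('m) \<Longrightarrow> continuous_on B (h j)) \<Longrightarrow> \<Phi> h = cnt h"
    unfolding cnt_def by (rule zero_count_functional[OF B(3), of "CARD('m)"]) blast
  \<comment> \<open>The splitting below and the Gaussian integrals need counts that are measurable
    in the random coefficients; \<open>\<Phi>\<close> provides this, since the paths are continuous
    on \<open>B\<close>.\<close>
  have cnt_measurable: "(\<lambda>w. cnt (\<lambda>j x. H w j x)) \<in> borel_measurable M"
    if "\<And>j x. j < CARD('m) \<Longrightarrow> (\<lambda>w. H w j x) \<in> borel_measurable M"
      "\<And>w j. j < CARD('m) \<Longrightarrow> continuous_on B (H w j)" for H and M :: "'w measure"
  proof -
    have "(\<lambda>w. \<lambda>j\<in>?J. H w j) \<in> M \<rightarrow>\<^sub>M PiM ?J (\<lambda>_. PiM UNIV (\<lambda>_. borel))"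
      by (rule measurable_restrict, rule measurable_PiM_single') (use that in auto)
    then have "(\<lambda>w. \<Phi> (\<lambda>j\<in>?J. H w j)) \<in> borel_measurable M"
      by (rule measurable_compose[OF _ \<Phi>(1)])
    also have "(\<lambda>w. \<Phi> (\<lambda>j\<in>?J. H w j)) = (\<lambda>w. cnt (\<lambda>j x. H w j x))"
    proof
      fix w
      have "\<Phi> (\<lambda>j\<in>?J. H w j) = cnt (\<lambda>j\<in>?J. H w j)"
        by (rule \<Phi>(2)) (use that(2) in auto)
      then show "\<Phi> (\<lambda>j\<in>?J. H w j) = cnt (\<lambda>j x. H w j x)" by (simp add: cnt_def)
    qed
    finally show ?thesis .
  qed
  have cB: "continuous_on B (f i)" if "i \<in> insert p I" for i
    using contf[OF that] B(2) by (rule continuous_on_subset)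
  \<comment> \<open>The sign turns the equation of the zeros into \<open>h W x = v\<close> with
    \<open>v\<close> the coefficients of \<open>f p\<close>. By the quotient rule \<open>L i\<close>
    is the gradient of \<open>\<phi> i\<close>.\<close>
  define \<phi> where "\<phi> i x = - f i x / f p x" for i x
  define L where "L i x = (f i x / (f p x)\<^sup>2) *\<^sub>R D p x - (1 / f p x) *\<^sub>R D i x" for i x
  have der\<phi>: "(\<phi> i has_derivative (\<lambda>v. L i x \<bullet> v)) (at x)" if "i \<in> I" "x \<in> V" for i x
  proof -
    have di: "(f i has_derivative (\<lambda>v. D i x \<bullet> v)) (at x)" and dp: "(f p has_derivative (\<lambda>v. D p x \<bullet> v)) (at x)"
      using der[of i x] der[of p x] that by auto
    have "((\<lambda>x. - f i x / f p x) has_derivative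
        (\<lambda>v. (- (D i x \<bullet> v) * f p x - - f i x * (D p x \<bullet> v)) / (f p x * f p x))) (at x)"
      by (rule has_derivative_divide'[OF has_derivative_minus[OF di] dp fp[OF that(2)]])
    then show ?thesis unfolding \<phi>_def
      by (rule has_derivative_eq_rhs)
        (use fp[OF that(2)] in \<open>auto simp: L_def fun_eq_iff inner_simps field_simps power2_eq_square\<close>)
  qed
  have contL: "continuous_on V (L i)" if "i \<in> I" for i
    unfolding L_def by (intro continuous_intros contf D) (use that fp in auto)
  have cont\<phi>: "continuous_on V (\<phi> i)" if "i \<in> I" for i
    unfolding \<phi>_def by (intro continuous_intros contf) (use that fp in auto)
  define h where "h W x = (\<chi> k :: 'm. \<Sum>i\<in>I. W (coord_index k) i * \<phi> i x)" for W :: "nat \<Rightarrow> nat \<Rightarrow> real" and x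
  define J where "J W x = (\<chi> k :: 'm. \<Sum>i\<in>I. W (coord_index k) i *\<^sub>R L i x)" for W :: "nat \<Rightarrow> nat \<Rightarrow> real" and x
  define dens where "dens v = ennreal (\<Prod>b\<in>Basis. std_normal_density (v \<bullet> b))" for v :: "real ^ 'm"
  have dens [measurable]: "dens \<in> borel_measurable borel" unfolding dens_def by measurable
  have derh: "(h W has_derivative (\<lambda>v. J W x *v v)) (at x)" if "x \<in> V" for W x
  proof -
    have "((\<lambda>x. \<Sum>i\<in>I. W (coord_index k) i * \<phi> i x) has_derivative (\<lambda>v. (J W x *v v) $ k)) (at x)" for k :: 'm
      by (rule has_derivative_eq_rhs, (rule derivative_intros der\<phi>)+)
        (use that in \<open>auto simp: J_def fun_eq_iff matrix_vector_mul_component inner_sum_left\<close>)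
    then show ?thesis unfolding h_def by (subst has_derivative_componentwise_within) (auto simp: Basis_vec_def inner_axis)
  qed
  have contJ: "continuous_on V (J W)" for W
    unfolding J_def by (intro continuous_on_vec_lambda continuous_intros contL) auto
  have densh: "dens (h W x) = (\<Prod>j\<in>?J. ennreal (std_normal_density (\<Sum>i\<in>I. W j i * \<phi> i x)))" for W x
  proof -
    have "(\<Prod>b\<in>Basis. std_normal_density (h W x \<bullet> b)) = (\<Prod>k\<in>UNIV. std_normal_density (h W x $ k))"
      by (rule prod.reindex_bij_witness[of _ "\<lambda>k. axis k 1" "\<lambda>b. SOME k. b = axis k 1"])
        (auto simp: Basis_vec_def inner_axis axis_eq_axis)
    also have "\<dots> = (\<Prod>j\<in>?J. std_normal_density (\<Sum>i\<in>I. W j i * \<phi> i x))"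
      unfolding h_def using prod.reindex_bij_betw[OF bij_coord_index[where 'm = 'm], of "\<lambda>j. std_normal_density (\<Sum>i\<in>I. W j i * \<phi> i x)"]
      by simp
    finally show ?thesis by (simp add: dens_def prod_ennreal)
  qed
  have split: "(\<integral>\<^sup>+Z. cnt (\<lambda>j x. \<Sum>i\<in>insert p I. Z j i * f i x) \<partial>PiM ?J (\<lambda>_. PiM (insert p I) (\<lambda>_. std_normal))) =
      (\<integral>\<^sup>+W. \<integral>\<^sup>+z. cnt (\<lambda>j x. \<Sum>i\<in>insert p I. (\<lambda>j\<in>?J. (W j)(p := z j)) j i * f i x)
         \<partial>PiM ?J (\<lambda>_. std_normal) \<partial>PiM ?J (\<lambda>_. PiM I (\<lambda>_. std_normal)))"
  proof (rule nn_integral_PiM_pairing[where \<phi> = "\<lambda>z w. w(p := z)"])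
    show "(\<lambda>(z, w). w(p := z)) \<in> std_normal \<Otimes>\<^sub>M PiM I (\<lambda>_. std_normal) \<rightarrow>\<^sub>M PiM (insert p I) (\<lambda>_. std_normal)"
      using measurable_compose[OF measurable_pair_swap' measurable_add_dim[of p I "\<lambda>_. std_normal"]]
      by (simp add: case_prod_unfold)
    show "(\<integral>\<^sup>+y. G y \<partial>PiM (insert p I) (\<lambda>_. std_normal)) =
        (\<integral>\<^sup>+b. \<integral>\<^sup>+a. G (b(p := a)) \<partial>std_normal \<partial>PiM I (\<lambda>_. std_normal))"
      if "G \<in> borel_measurable (PiM (insert p I) (\<lambda>_. std_normal))" for G
      by (rule PI.product_nn_integral_insert) (use I that in auto)
    show "(\<lambda>Z. cnt (\<lambda>j x. \<Sum>i\<in>insert p I. Z j i * f i x)) \<in> borel_measurable (PiM ?J (\<lambda>_. PiM (insert p I) (\<lambda>_. std_normal)))"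
    proof (rule cnt_measurable)
      fix j x assume j: "j < CARD('m)"
      have [measurable]: "(\<lambda>Z. Z j i) \<in> borel_measurable (PiM ?J (\<lambda>_. PiM (insert p I) (\<lambda>_. std_normal)))" if "i \<in> insert p I" for i
        using measurable_matrix_entry[OF _ that, of j ?J] j by simp
      show "(\<lambda>Z. \<Sum>i\<in>insert p I. Z j i * f i x) \<in> borel_measurable (PiM ?J (\<lambda>_. PiM (insert p I) (\<lambda>_. std_normal)))"
        by (intro borel_measurable_sum borel_measurable_times) measurable
    next
      show "continuous_on B (\<lambda>x. \<Sum>i\<in>insert p I. Z j i * f i x)" for Z :: "nat \<Rightarrow> nat \<Rightarrow> real" and j
        by (intro continuous_intros cB)
    qed
  qed (use pI N.prob_space_axioms in auto)
  have inner: "(\<integral>\<^sup>+z. cnt (\<lambda>j x. \<Sum>i\<in>insert p I. (\<lambda>j\<in>?J. (W j)(p := z j)) j i * f i x) \<partial>PiM ?J (\<lambda>_. std_normal)) =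
      (\<integral>\<^sup>+x. dens (h W x) * ennreal \<bar>det (J W x)\<bar> * indicator B x \<partial>lborel)" for W
  proof -
    define F where "F v = emeasure (count_space UNIV) {x \<in> B. h W x = v}" for v
    define r :: "nat \<Rightarrow> 'm" where "r = inv_into UNIV coord_index"
    have r: "r (coord_index k) = k" "j < CARD('m) \<Longrightarrow> coord_index (r j) = j" for k j
      using bij_coord_index[where 'm = 'm] unfolding r_def bij_betw_def
      by (auto intro: inv_into_f_f f_inv_into_f)
    have Fcnt: "F v = cnt (\<lambda>j x. v $ r j * f p x + (\<Sum>i\<in>I. W j i * f i x))" for v
    proof -
      have "h W x = v \<longleftrightarrow> (\<forall>j<CARD('m). v $ r j * f p x + (\<Sum>i\<in>I. W j i * f i x) = 0)" if "x \<in> B" for x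
      proof -
        have fpx: "f p x \<noteq> 0" using fp B(2) that by auto
        have eq: "(\<Sum>i\<in>I. W j i * \<phi> i x) = - (\<Sum>i\<in>I. W j i * f i x) / f p x" for j
          by (simp add: \<phi>_def sum_divide_distrib sum_negf)
        have "h W x = v \<longleftrightarrow> (\<forall>k. (\<Sum>i\<in>I. W (coord_index k) i * \<phi> i x) = v $ k)"
          by (simp add: h_def vec_eq_iff)
        also have "\<dots> \<longleftrightarrow> (\<forall>j<CARD('m). (\<Sum>i\<in>I. W j i * \<phi> i x) = v $ r j)"
          by (metis coord_index_less r)
        also have "\<dots> \<longleftrightarrow> (\<forall>j<CARD('m). v $ r j * f p x + (\<Sum>i\<in>I. W j i * f i x) = 0)"
          unfolding eq using fpx by (auto simp: field_simps add_eq_0_iff)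
        finally show ?thesis .
      qed
      then show ?thesis unfolding F_def cnt_def by (intro arg_cong[where f = "emeasure (count_space UNIV)"]) blast
    qed
    have Fm: "F \<in> borel_measurable borel"
      unfolding Fcnt[abs_def]
      by (rule cnt_measurable) (auto intro!: continuous_intros cB)
    have vz: "(\<Sum>j\<in>?J. z j *\<^sub>R axis (r j) 1) $ r j = z j" if "j < CARD('m)" for z :: "nat \<Rightarrow> real" and j
    proof -
      have "(\<Sum>i\<in>?J. z i *\<^sub>R axis (r i) 1) $ r j = (\<Sum>i\<in>?J. if i = j then z i else 0)"
        unfolding sum_component
        by (rule sum.cong) (use that r(2) in \<open>auto simp: axis_def, metis\<close>)
      then show ?thesis using that by simp
    qed
    have "(\<integral>\<^sup>+z. cnt (\<lambda>j x. \<Sum>i\<in>insert p I. (\<lambda>j\<in>?J. (W j)(p := z j)) j i * f i x) \<partial>PiM ?J (\<lambda>_. std_normal)) =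
        (\<integral>\<^sup>+z. F (\<Sum>j\<in>?J. z j *\<^sub>R axis (r j) 1) \<partial>PiM ?J (\<lambda>_. std_normal))"
    proof (rule nn_integral_cong)
      fix z :: "nat \<Rightarrow> real"
      have "(\<Sum>i\<in>insert p I. (\<lambda>j\<in>?J. (W j)(p := z j)) j i * f i x) = z j * f p x + (\<Sum>i\<in>I. W j i * f i x)"
        if "j < CARD('m)" for j x
      proof -
        have "(\<Sum>i\<in>I. ((W j)(p := z j)) i * f i x) = (\<Sum>i\<in>I. W j i * f i x)"
          by (rule sum.cong) (use I in auto)
        then show ?thesis using I that by simp
      qed
      then show "cnt (\<lambda>j x. \<Sum>i\<in>insert p I. (\<lambda>j\<in>?J. (W j)(p := z j)) j i * f i x) = F (\<Sum>j\<in>?J. z j *\<^sub>R axis (r j) 1)"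
        unfolding Fcnt cnt_def using vz[of _ z]
        by (intro arg_cong[where f = "emeasure (count_space UNIV)"] Collect_cong conj_cong refl all_cong) simp
    qed
    also have "\<dots> = (\<integral>\<^sup>+v. F v \<partial>std_gaussian)"
    proof (rule nn_integral_std_gaussian_orthonormal[OF _ _ Fm])
      fix u :: "real ^ 'm"
      have "(\<Sum>j\<in>?J. (axis (r j) 1 \<bullet> u)\<^sup>2) = (\<Sum>j\<in>?J. (u $ r j)\<^sup>2)" by (simp add: inner_axis')
      also have "\<dots> = (\<Sum>k\<in>UNIV. (u $ k)\<^sup>2)"
        using sum.reindex_bij_betw[OF bij_coord_index[where 'm = 'm], of "\<lambda>j. (u $ r j)\<^sup>2"] by (simp add: r)
      also have "\<dots> = (norm u)\<^sup>2" by (simp add: norm_vec_def L2_set_def sum_nonneg)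
      finally show "(\<Sum>j\<in>?J. (axis (r j) 1 \<bullet> u)\<^sup>2) = (norm u)\<^sup>2" .
    qed simp
    also have "\<dots> = (\<integral>\<^sup>+v. dens v * F v \<partial>lborel)"
      unfolding std_gaussian_def dens_def using Fm by (subst nn_integral_density) auto
    also have "\<dots> = (\<integral>\<^sup>+x. dens (h W x) * ennreal \<bar>det (J W x)\<bar> * indicator B x \<partial>lborel)"
      unfolding F_def by (rule area_formula[OF V B(1,2) derh contJ dens])
    finally show ?thesis .
  qed
  define G where "G W x = (\<Prod>j\<in>?J. ennreal (std_normal_density (\<Sum>i\<in>I. W j i * \<phi> i x))) * ennreal \<bar>det (J W x)\<bar>"
    for W :: "nat \<Rightarrow> nat \<Rightarrow> real" and x
  have Gm: "(\<lambda>(W, x). G W x * indicator B x) \<in> borel_measurable (PiM ?J (\<lambda>_. PiM I (\<lambda>_. std_normal)) \<Otimes>\<^sub>M lborel)"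
  proof -
    \<comment> \<open>\<open>\<phi>\<close> and \<open>L\<close> are continuous on \<open>V\<close>
      only; cutting them off outside makes the integrand jointly measurable, and
      \<open>indicator B\<close> hides the change.\<close>
    define \<phi>' where "\<phi>' i x = (if x \<in> V then \<phi> i x else 0)" for i x
    define L' where "L' i x = (if x \<in> V then L i x else 0)" for i x
    have [measurable]: "\<phi>' i \<in> borel_measurable borel" "L' i \<in> borel_measurable borel" if "i \<in> I" for i
      unfolding \<phi>'_def[abs_def] L'_def[abs_def] using V that
      by (auto intro!: borel_measurable_continuous_on_if cont\<phi> contL)
    have [measurable]: "(\<lambda>p. fst p j i) \<in> borel_measurable (PiM ?J (\<lambda>_. PiM I (\<lambda>_. std_normal)) \<Otimes>\<^sub>M (lborel :: (real ^ 'm) measure))"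
      if "i \<in> I" "j \<in> ?J" for i j
      by (rule measurable_compose[OF measurable_fst measurable_matrix_entry[OF that(2,1)]])
    have [measurable]: "B \<in> sets borel" by (rule B)
    have "(\<lambda>p. (\<Prod>j\<in>?J. ennreal (std_normal_density (\<Sum>i\<in>I. fst p j i * \<phi>' i (snd p)))) *
        ennreal \<bar>det (\<chi> k :: 'm. \<Sum>i\<in>I. fst p (coord_index k) i *\<^sub>R L' i (snd p))\<bar> * indicator B (snd p))
       \<in> borel_measurable (PiM ?J (\<lambda>_. PiM I (\<lambda>_. std_normal)) \<Otimes>\<^sub>M lborel)"
      by measurable
    also have "(\<lambda>p. (\<Prod>j\<in>?J. ennreal (std_normal_density (\<Sum>i\<in>I. fst p j i * \<phi>' i (snd p)))) *
        ennreal \<bar>det (\<chi> k :: 'm. \<Sum>i\<in>I. fst p (coord_index k) i *\<^sub>R L' i (snd p))\<bar> * indicator B (snd p)) =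
       (\<lambda>(W, x). G W x * indicator B x)"
    proof (rule ext)
      fix wx :: "(nat \<Rightarrow> nat \<Rightarrow> real) \<times> (real ^ 'm)"
      show "(\<Prod>j\<in>?J. ennreal (std_normal_density (\<Sum>i\<in>I. fst wx j i * \<phi>' i (snd wx)))) *
          ennreal \<bar>det (\<chi> k :: 'm. \<Sum>i\<in>I. fst wx (coord_index k) i *\<^sub>R L' i (snd wx))\<bar> * indicator B (snd wx) =
          (case wx of (W, x) \<Rightarrow> G W x * indicator B x)"
        using B(2) by (cases "snd wx \<in> B") (auto simp: G_def J_def \<phi>'_def L'_def case_prod_beta)
    qed
    finally show ?thesis .
  qed
  have "(\<integral>\<^sup>+Z. emeasure (count_space UNIV) {x \<in> B. \<forall>j<CARD('m). (\<Sum>i\<in>insert p I. Z j i * f i x) = 0}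
       \<partial>PiM ?J (\<lambda>_. PiM (insert p I) (\<lambda>_. std_normal))) =
     (\<integral>\<^sup>+W. \<integral>\<^sup>+x. G W x * indicator B x \<partial>lborel \<partial>PiM ?J (\<lambda>_. PiM I (\<lambda>_. std_normal)))"
    unfolding cnt_def[symmetric] split inner densh G_def ..
  also have "\<dots> = (\<integral>\<^sup>+x. \<integral>\<^sup>+W. G W x * indicator B x \<partial>PiM ?J (\<lambda>_. PiM I (\<lambda>_. std_normal)) \<partial>lborel)"
    by (rule WL.Fubini'[OF Gm, symmetric])
  also have "\<dots> = (\<integral>\<^sup>+x. abs_det_mean TYPE('m) * ennreal (sqrt (det (polar_matrix (q x))) / sqrt (2 * pi) ^ CARD('m)) * indicator B x \<partial>lborel)"
  proof (rule nn_integral_cong)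
    fix x :: "real ^ 'm"
    show "(\<integral>\<^sup>+W. G W x * indicator B x \<partial>PiM ?J (\<lambda>_. PiM I (\<lambda>_. std_normal))) =
       abs_det_mean TYPE('m) * ennreal (sqrt (det (polar_matrix (q x))) / sqrt (2 * pi) ^ CARD('m)) * indicator B x"
    proof (cases "x \<in> B")
      case True
      then have fpx: "f p x \<noteq> 0" using B(2) fp by auto
      \<comment> \<open>The Gaussian reduction produces the form of the quotients by
        \<open>f p\<close>, which \<open>projective_form_eq\<close> identifies with the form of the
        functions themselves. So the choice of \<open>p\<close> leaves no trace in the
        density.\<close>
      have qx: "q x = (\<lambda>u. (\<Sum>i\<in>I. (L i x \<bullet> u)\<^sup>2) / (1 + (\<Sum>i\<in>I. (\<phi> i x)\<^sup>2)) -
          (\<Sum>i\<in>I. \<phi> i x * (L i x \<bullet> u))\<^sup>2 / (1 + (\<Sum>i\<in>I. (\<phi> i x)\<^sup>2))\<^sup>2)"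
      proof
        fix u
        define S0 where "S0 = (\<Sum>i\<in>I. (f i x)\<^sup>2)"
        define S1 where "S1 = (\<Sum>i\<in>I. f i x * (D i x \<bullet> u))"
        define S2 where "S2 = (\<Sum>i\<in>I. (D i x \<bullet> u)\<^sup>2)"
        define \<delta> where "\<delta> = D p x \<bullet> u"
        define P where "P = f p x"
        have P: "P \<noteq> 0" using fpx by (simp add: P_def)
        have S0: "S0 \<ge> 0" unfolding S0_def by (rule sum_nonneg) simp
        have Lu: "L i x \<bullet> u = (f i x * \<delta> - P * (D i x \<bullet> u)) / P\<^sup>2" for i
          using P by (simp add: L_def \<delta>_def P_def[symmetric] inner_simps field_simps power2_eq_square)
        have e0: "(\<Sum>i\<in>I. (\<phi> i x)\<^sup>2) = S0 / P\<^sup>2"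
          by (simp add: \<phi>_def P_def S0_def power_divide sum_divide_distrib)
        have e1: "(\<Sum>i\<in>I. \<phi> i x * (L i x \<bullet> u)) = (P * S1 - \<delta> * S0) / P ^ 3"
          unfolding S0_def S1_def sum_distrib_left sum_subtractf[symmetric] sum_divide_distrib
          by (rule sum.cong) (use P in \<open>auto simp: Lu \<phi>_def P_def[symmetric] field_simps power2_eq_square power3_eq_cube\<close>)
        have e2: "(\<Sum>i\<in>I. (L i x \<bullet> u)\<^sup>2) = (\<delta>\<^sup>2 * S0 - 2 * P * \<delta> * S1 + P\<^sup>2 * S2) / P ^ 4"
          unfolding S0_def S1_def S2_def sum_distrib_left sum_subtractf[symmetric] sum.distrib[symmetric] sum_divide_distrib
          by (rule sum.cong) (use P in \<open>auto simp: Lu power_divide power2_diff power_mult_distrib field_simps\<close>)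
        have "q x u = (\<delta>\<^sup>2 + S2) / (P\<^sup>2 + S0) - (P * \<delta> + S1)\<^sup>2 / (P\<^sup>2 + S0)\<^sup>2"
          using I by (simp add: q_def S0_def S1_def S2_def \<delta>_def P_def)
        then show "q x u = (\<Sum>i\<in>I. (L i x \<bullet> u)\<^sup>2) / (1 + (\<Sum>i\<in>I. (\<phi> i x)\<^sup>2)) -
          (\<Sum>i\<in>I. \<phi> i x * (L i x \<bullet> u))\<^sup>2 / (1 + (\<Sum>i\<in>I. (\<phi> i x)\<^sup>2))\<^sup>2"
          unfolding e0 e1 e2 projective_form_eq[OF P S0] .
      qed
      have "(\<integral>\<^sup>+W. G W x * indicator B x \<partial>PiM ?J (\<lambda>_. PiM I (\<lambda>_. std_normal))) =
          (\<integral>\<^sup>+W. G W x \<partial>PiM ?J (\<lambda>_. PiM I (\<lambda>_. std_normal)))" using True by simp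
      also have "\<dots> = abs_det_mean TYPE('m) * ennreal (sqrt (det (polar_matrix (q x))) / sqrt (2 * pi) ^ CARD('m))"
        unfolding G_def J_def qx by (rule gaussian_det_expectation[OF I(1)])
      finally show ?thesis using True by simp
    qed simp
  qed
  finally show ?thesis .
qed

section \<open>Laws of random functions\<close>

abbreviation path_space :: "('a \<Rightarrow> real) measure" where
  "path_space \<equiv> PiM UNIV (\<lambda>_. borel)"

lemma zero_count_measurable:
  fixes X :: "'w \<Rightarrow> 'a::{t2_space,second_countable_topology} \<Rightarrow> real" and m :: nat
  assumes B: "sigma_compact_traces B" and X: "X \<in> P \<rightarrow>\<^sub>M path_space"
    and cont: "\<And>\<omega>. continuous_on B (X \<omega>)"
  shows "(\<lambda>\<omega>. emeasure (count_space UNIV) {x \<in> B. \<forall>j<m. X (\<omega> j) x = 0}) \<in> borel_measurable (PiM {..<m} (\<lambda>_. P))"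
proof -
  obtain \<Phi> :: "(nat \<Rightarrow> 'a \<Rightarrow> real) \<Rightarrow> ennreal" where
    \<Phi>: "\<Phi> \<in> borel_measurable (PiM {..<m} (\<lambda>_. path_space))"
    "\<And>h. (\<And>j. j < m \<Longrightarrow> continuous_on B (h j)) \<Longrightarrow>
       \<Phi> h = emeasure (count_space UNIV) {x \<in> B. \<forall>j<m. h j x = 0}"
    by (rule zero_count_functional[OF B, of m]) blast
  have eq: "emeasure (count_space UNIV) {x \<in> B. \<forall>j<m. X (\<omega> j) x = 0} = \<Phi> (\<lambda>j\<in>{..<m}. X (\<omega> j))" for \<omega>
    using \<Phi>(2)[of "\<lambda>j\<in>{..<m}. X (\<omega> j)"] cont by simp
  have "(\<lambda>\<omega>. \<lambda>j\<in>{..<m}. X (\<omega> j)) \<in> PiM {..<m} (\<lambda>_. P) \<rightarrow>\<^sub>M PiM {..<m} (\<lambda>_. path_space)"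
    by (rule measurable_restrict, rule measurable_compose[OF _ X], rule measurable_component_singleton)
  from measurable_compose[OF this \<Phi>(1)]
  show "(\<lambda>\<omega>. emeasure (count_space UNIV) {x \<in> B. \<forall>j<m. X (\<omega> j) x = 0}) \<in> borel_measurable (PiM {..<m} (\<lambda>_. P))"
    by (simp only: eq)
qed

lemma nn_integral_PiM_law:
  assumes P: "prob_space P" and X: "X \<in> P \<rightarrow>\<^sub>M M" and I: "finite I"
    and \<Phi>: "\<Phi> \<in> borel_measurable (PiM I (\<lambda>_. M))"
  shows "(\<integral>\<^sup>+\<omega>. \<Phi> (\<lambda>j\<in>I. X (\<omega> j)) \<partial>PiM I (\<lambda>_. P)) = (\<integral>\<^sup>+h. \<Phi> h \<partial>PiM I (\<lambda>_. distr P M X))"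
proof -
  let ?L = "distr P M X"
  have X': "X \<in> P \<rightarrow>\<^sub>M ?L" using X by simp
  have L: "prob_space ?L" using P X by (rule prob_space.prob_space_distr)
  have "distr P ?L X = ?L" by (rule distr_cong) auto
  then have "distr (PiM I (\<lambda>_. P)) (PiM I (\<lambda>_. ?L)) (compose I X) = PiM I (\<lambda>_. ?L)"
    using distr_PiM_finite_prob_space'[of I "\<lambda>_. P" "\<lambda>_. ?L" X] I P L X' by simp
  moreover have "compose I X \<in> PiM I (\<lambda>_. P) \<rightarrow>\<^sub>M PiM I (\<lambda>_. ?L)"
    unfolding compose_def
    by (rule measurable_restrict, rule measurable_compose[OF _ X'], rule measurable_component_singleton)
  moreover have "\<Phi> \<in> borel_measurable (PiM I (\<lambda>_. ?L))"
    using \<Phi> by (simp cong: measurable_cong_sets add: sets_PiM_cong[of I I "\<lambda>_. ?L" "\<lambda>_. M"])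
  ultimately have "(\<integral>\<^sup>+h. \<Phi> h \<partial>PiM I (\<lambda>_. ?L)) = (\<integral>\<^sup>+\<omega>. \<Phi> (compose I X \<omega>) \<partial>PiM I (\<lambda>_. P))"
    by (metis nn_integral_distr)
  then show ?thesis by (simp add: compose_def)
qed

text \<open>The zero count is not a measurable functional of the path, so equality of laws does not
  apply to it directly. On continuous paths it equals the measurable \<open>\<Phi>\<close>, whose
  integral depends on the law only.\<close>

lemma expected_zeros_cong_law:
  fixes X :: "'w \<Rightarrow> 'a::{t2_space,second_countable_topology} \<Rightarrow> real"
    and Y :: "'v \<Rightarrow> 'a \<Rightarrow> real"
  assumes B: "sigma_compact_traces B" and P: "prob_space P" and Q: "prob_space Q"
    and X: "X \<in> P \<rightarrow>\<^sub>M path_space" and Y: "Y \<in> Q \<rightarrow>\<^sub>M path_space"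
    and contX: "\<And>\<omega>. continuous_on B (X \<omega>)" and contY: "\<And>\<omega>. continuous_on B (Y \<omega>)"
    and law: "distr P path_space X = distr Q path_space Y"
  shows "expected_zeros P m X B = expected_zeros Q m Y B"
proof -
  obtain \<Phi> :: "(nat \<Rightarrow> 'a \<Rightarrow> real) \<Rightarrow> ennreal" where
    \<Phi>: "\<Phi> \<in> borel_measurable (PiM {..<m} (\<lambda>_. path_space))"
    "\<And>h. (\<And>j. j < m \<Longrightarrow> continuous_on B (h j)) \<Longrightarrow>
       \<Phi> h = emeasure (count_space UNIV) {x \<in> B. \<forall>j<m. h j x = 0}"
    by (rule zero_count_functional[OF B, of m]) blast
  have "expected_zeros P m X B = (\<integral>\<^sup>+\<omega>. \<Phi> (\<lambda>j\<in>{..<m}. X (\<omega> j)) \<partial>PiM {..<m} (\<lambda>_. P))"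
    unfolding expected_zeros_def
    by (rule nn_integral_cong) (use \<Phi>(2)[of "\<lambda>j\<in>{..<m}. X (\<omega> j)" for \<omega>] contX in simp)
  also have "\<dots> = (\<integral>\<^sup>+\<omega>. \<Phi> (\<lambda>j\<in>{..<m}. Y (\<omega> j)) \<partial>PiM {..<m} (\<lambda>_. Q))"
    unfolding nn_integral_PiM_law[OF P X finite_lessThan \<Phi>(1)]
      nn_integral_PiM_law[OF Q Y finite_lessThan \<Phi>(1)] law ..
  also have "\<dots> = expected_zeros Q m Y B"
    unfolding expected_zeros_def
    by (rule nn_integral_cong) (use \<Phi>(2)[of "\<lambda>j\<in>{..<m}. Y (\<omega> j)" for \<omega>] contY in simp)
  finally show ?thesis .
qed

lemma expected_zeros_UN:
  fixes X :: "'w \<Rightarrow> 'a::{t2_space,second_countable_topology} \<Rightarrow> real" and B :: "nat \<Rightarrow> 'a set"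
  assumes B: "\<And>k. sigma_compact_traces (B k)" and X: "X \<in> P \<rightarrow>\<^sub>M path_space"
    and cont: "\<And>\<omega>. continuous_on UNIV (X \<omega>)" and disj: "disjoint_family B"
  shows "expected_zeros P m X (\<Union>k. B k) = (\<Sum>k. expected_zeros P m X (B k))"
proof -
  have "emeasure (count_space UNIV) {x \<in> (\<Union>k. B k). \<forall>j<m. X (\<omega> j) x = 0} =
      (\<Sum>k. emeasure (count_space UNIV) {x \<in> B k. \<forall>j<m. X (\<omega> j) x = 0})" for \<omega>
  proof -
    have "{x \<in> (\<Union>k. B k). \<forall>j<m. X (\<omega> j) x = 0} = (\<Union>k. {x \<in> B k. \<forall>j<m. X (\<omega> j) x = 0})" by blast
    moreover have "(\<Sum>k. emeasure (count_space UNIV) {x \<in> B k. \<forall>j<m. X (\<omega> j) x = 0}) =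
        emeasure (count_space UNIV) (\<Union>k. {x \<in> B k. \<forall>j<m. X (\<omega> j) x = 0})"
      by (rule suminf_emeasure) (use disj in \<open>auto simp: disjoint_family_on_def\<close>)
    ultimately show ?thesis by (simp only:)
  qed
  then show ?thesis
    unfolding expected_zeros_def
    using zero_count_measurable[OF B X continuous_on_subset[OF cont]]
    by (simp add: nn_integral_suminf)
qed

section \<open>Laws of Gaussian combinations\<close>

lemma measurable_linear_combination:
  assumes "finite K"
  shows "(\<lambda>w x. \<Sum>i\<in>K. w i * f i x) \<in> PiM K (\<lambda>_. std_normal) \<rightarrow>\<^sub>M path_space"
proof (rule measurable_PiM_single')
  fix x :: 'b
  have "(\<lambda>w. w i) \<in> borel_measurable (PiM K (\<lambda>_. std_normal))" if "i \<in> K" for i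
    using measurable_component_singleton[OF that, of "\<lambda>_. std_normal"] by simp
  then show "(\<lambda>w. \<Sum>i\<in>K. w i * f i x) \<in> borel_measurable (PiM K (\<lambda>_. std_normal))"
    by (intro borel_measurable_sum borel_measurable_times) auto
qed auto

lemma law_gaussian_combination:
  fixes \<xi> :: "nat \<Rightarrow> 'w \<Rightarrow> real" and f :: "nat \<Rightarrow> 'a \<Rightarrow> real"
  assumes P: "prob_space P" and K: "finite K" "K \<noteq> {}"
    and gaussian: "\<forall>i\<in>K. distributed P lborel (\<xi> i) std_normal_density"
    and indep: "prob_space.indep_vars P (\<lambda>_. borel) \<xi> K"
  shows "(\<lambda>\<omega> x. \<Sum>i\<in>K. \<xi> i \<omega> * f i x) \<in> P \<rightarrow>\<^sub>M path_space"
    and "distr P path_space (\<lambda>\<omega> x. \<Sum>i\<in>K. \<xi> i \<omega> * f i x) =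
      distr (PiM K (\<lambda>_. std_normal)) path_space (\<lambda>w x. \<Sum>i\<in>K. w i * f i x)"
proof -
  interpret prob_space P by (rule P)
  have rv: "\<xi> i \<in> borel_measurable P" if "i \<in> K" for i
    using gaussian that distributed_measurable[of P lborel "\<xi> i"] by auto
  have "distr P borel (\<xi> i) = std_normal" if "i \<in> K" for i
  proof -
    have "distr P borel (\<xi> i) = distr P lborel (\<xi> i)" by (rule distr_cong) auto
    also have "\<dots> = std_normal" using gaussian that distributed_distr_eq_density by blast
    finally show ?thesis .
  qed
  then have law: "distr P (PiM K (\<lambda>_. borel)) (\<lambda>\<omega>. \<lambda>i\<in>K. \<xi> i \<omega>) = PiM K (\<lambda>_. std_normal)"
    using indep indep_vars_iff_distr_eq_PiM'[OF K(2), where M' = "\<lambda>_. borel" and X = \<xi>] rv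
    by (simp cong: PiM_cong)
  have m1: "(\<lambda>\<omega>. \<lambda>i\<in>K. \<xi> i \<omega>) \<in> P \<rightarrow>\<^sub>M PiM K (\<lambda>_. borel)"
    by (rule measurable_restrict) (rule rv)
  have m2: "(\<lambda>w x. \<Sum>i\<in>K. w i * f i x) \<in> PiM K (\<lambda>_. borel) \<rightarrow>\<^sub>M path_space"
    using measurable_linear_combination[OF K(1), of f]
    by (simp cong: measurable_cong_sets add: sets_PiM_cong[of K K "\<lambda>_. std_normal" "\<lambda>_. borel"])
  have eq: "(\<lambda>w x. \<Sum>i\<in>K. w i * f i x) \<circ> (\<lambda>\<omega>. \<lambda>i\<in>K. \<xi> i \<omega>) = (\<lambda>\<omega> x. \<Sum>i\<in>K. \<xi> i \<omega> * f i x)"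
    by (simp add: fun_eq_iff)
  show "(\<lambda>\<omega> x. \<Sum>i\<in>K. \<xi> i \<omega> * f i x) \<in> P \<rightarrow>\<^sub>M path_space"
    using measurable_comp[OF m1 m2] unfolding eq .
  show "distr P path_space (\<lambda>\<omega> x. \<Sum>i\<in>K. \<xi> i \<omega> * f i x) =
      distr (PiM K (\<lambda>_. std_normal)) path_space (\<lambda>w x. \<Sum>i\<in>K. w i * f i x)"
    unfolding law[symmetric] by (subst distr_distr[OF m2 m1]) (simp only: eq)
qed

text \<open>Independence is given between \<open>\<eta>\<close> and the random function, not between
  \<open>\<eta>\<close> and the coefficients inside it. Hence the joint law of \<open>\<eta>\<close>
  and \<open>X\<close>, with values in the path space, is the product of the two laws, and there
  \<open>X\<close> may be replaced by a combination with the same law.\<close>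

lemma law_gaussian_combination_add:
  fixes X :: "'w \<Rightarrow> 'a \<Rightarrow> real" and f :: "nat \<Rightarrow> 'a \<Rightarrow> real"
  assumes P: "prob_space P" and K: "finite K" "k \<notin> K"
    and X: "X \<in> P \<rightarrow>\<^sub>M path_space"
    and lawX: "distr P path_space X = distr (PiM K (\<lambda>_. std_normal)) path_space (\<lambda>w x. \<Sum>i\<in>K. w i * f i x)"
    and gaussian: "distributed P lborel \<eta> std_normal_density"
    and indep: "prob_space.indep_set P {\<eta> -` B \<inter> space P | B. B \<in> sets borel}
        {X -` C \<inter> space P | C. C \<in> sets path_space}"
  shows "(\<lambda>\<omega> x. X \<omega> x + \<eta> \<omega> * f k x) \<in> P \<rightarrow>\<^sub>M path_space"
    and "distr P path_space (\<lambda>\<omega> x. X \<omega> x + \<eta> \<omega> * f k x) =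
      distr (PiM (insert k K) (\<lambda>_. std_normal)) path_space (\<lambda>w x. \<Sum>i\<in>insert k K. w i * f i x)"
proof -
  interpret prob_space P by (rule P)
  interpret N: prob_space std_normal by (rule prob_space_std_normal)
  have \<eta>: "\<eta> \<in> borel_measurable P" using distributed_measurable[OF gaussian] by simp
  have law\<eta>: "distr P borel \<eta> = std_normal"
  proof -
    have "distr P borel \<eta> = distr P lborel \<eta>" by (rule distr_cong) auto
    also have "\<dots> = std_normal" using gaussian by (rule distributed_distr_eq_density)
    finally show ?thesis .
  qed
  have joint: "std_normal \<Otimes>\<^sub>M distr P path_space X = distr P (borel \<Otimes>\<^sub>M path_space) (\<lambda>\<omega>. (\<eta> \<omega>, X \<omega>))"
  proof (rule pair_measure_eqI)
    show "sigma_finite_measure std_normal" by (rule N.sigma_finite_measure_axioms)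
    show "sigma_finite_measure (distr P path_space X)"
      by (rule prob_space_imp_sigma_finite[OF prob_space_distr[OF X]])
    show "sets (std_normal \<Otimes>\<^sub>M distr P path_space X) = sets (distr P (borel \<Otimes>\<^sub>M path_space) (\<lambda>\<omega>. (\<eta> \<omega>, X \<omega>)))"
      by (simp cong: sets_pair_measure_cong)
    fix A C assume "A \<in> sets std_normal" "C \<in> sets (distr P path_space X)"
    then have A: "A \<in> sets borel" and C: "C \<in> sets path_space" by simp_all
    have "emeasure std_normal A = emeasure P (\<eta> -` A \<inter> space P)"
      unfolding law\<eta>[symmetric] using \<eta> A by (rule emeasure_distr)
    moreover have "emeasure (distr P path_space X) C = emeasure P (X -` C \<inter> space P)"
      using X C by (rule emeasure_distr)
    moreover have "emeasure (distr P (borel \<Otimes>\<^sub>M path_space) (\<lambda>\<omega>. (\<eta> \<omega>, X \<omega>))) (A \<times> C) =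
        emeasure P ((\<eta> -` A \<inter> space P) \<inter> (X -` C \<inter> space P))"
      using A C \<eta> X by (subst emeasure_distr) (auto intro!: arg_cong[where f = "emeasure P"])
    moreover have "prob ((\<eta> -` A \<inter> space P) \<inter> (X -` C \<inter> space P)) = prob (\<eta> -` A \<inter> space P) * prob (X -` C \<inter> space P)"
      by (rule indep_setD[OF indep]) (use A C in auto)
    ultimately show "emeasure std_normal A * emeasure (distr P path_space X) C =
        emeasure (distr P (borel \<Otimes>\<^sub>M path_space) (\<lambda>\<omega>. (\<eta> \<omega>, X \<omega>))) (A \<times> C)"
      by (simp add: emeasure_eq_measure ennreal_mult')
  qed
  have mpair: "(\<lambda>\<omega>. (\<eta> \<omega>, X \<omega>)) \<in> P \<rightarrow>\<^sub>M borel \<Otimes>\<^sub>M path_space"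
    using \<eta> X by (rule measurable_Pair)
  have madd: "(\<lambda>(t, h) x. h x + t * f k x) \<in> borel \<Otimes>\<^sub>M path_space \<rightarrow>\<^sub>M path_space"
    by (rule measurable_PiM_single') (auto simp: case_prod_unfold)
  define S where "S w x = (\<Sum>i\<in>K. w i * f i x)" for w x
  have S: "S \<in> PiM K (\<lambda>_. std_normal) \<rightarrow>\<^sub>M path_space"
    unfolding S_def[abs_def] by (rule measurable_linear_combination[OF K(1)])
  have pK: "prob_space (PiM K (\<lambda>_. std_normal))" by (intro prob_space_PiM N.prob_space_axioms)
  show "(\<lambda>\<omega> x. X \<omega> x + \<eta> \<omega> * f k x) \<in> P \<rightarrow>\<^sub>M path_space"
    using measurable_comp[OF mpair madd] by (simp add: o_def)
  have "distr P path_space (\<lambda>\<omega> x. X \<omega> x + \<eta> \<omega> * f k x) =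
      distr (std_normal \<Otimes>\<^sub>M distr P path_space X) path_space (\<lambda>(t, h) x. h x + t * f k x)"
    unfolding joint by (subst distr_distr[OF madd mpair]) (simp add: o_def)
  also have "std_normal \<Otimes>\<^sub>M distr P path_space X =
      distr (std_normal \<Otimes>\<^sub>M PiM K (\<lambda>_. std_normal)) (borel \<Otimes>\<^sub>M path_space) (\<lambda>(t, w). (t, S w))"
  proof -
    have "sigma_finite_measure (distr (PiM K (\<lambda>_. std_normal)) path_space S)"
      using prob_space.prob_space_distr[OF pK S] by (rule prob_space_imp_sigma_finite)
    then have "distr std_normal borel (\<lambda>t. t) \<Otimes>\<^sub>M distr (PiM K (\<lambda>_. std_normal)) path_space S =
       distr (std_normal \<Otimes>\<^sub>M PiM K (\<lambda>_. std_normal)) (borel \<Otimes>\<^sub>M path_space) (\<lambda>(t, w). (t, S w))"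
      by (intro pair_measure_distr S) auto
    moreover have "distr std_normal borel (\<lambda>t. t) = std_normal" by (rule distr_id2) simp
    ultimately show ?thesis unfolding lawX S_def[abs_def] by simp
  qed
  also have "distr (distr (std_normal \<Otimes>\<^sub>M PiM K (\<lambda>_. std_normal)) (borel \<Otimes>\<^sub>M path_space) (\<lambda>(t, w). (t, S w)))
      path_space (\<lambda>(t, h) x. h x + t * f k x) =
     distr (std_normal \<Otimes>\<^sub>M PiM K (\<lambda>_. std_normal)) path_space (\<lambda>(t, w) x. S w x + t * f k x)"
  proof -
    have "(\<lambda>(t, w). (t, S w)) \<in> std_normal \<Otimes>\<^sub>M PiM K (\<lambda>_. std_normal) \<rightarrow>\<^sub>M borel \<Otimes>\<^sub>M path_space"
      using S unfolding case_prod_unfold by (intro measurable_Pair measurable_compose[OF measurable_snd S]) simp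
    from distr_distr[OF madd this] show ?thesis by (simp add: o_def case_prod_unfold)
  qed
  also have "\<dots> = distr (PiM (insert k K) (\<lambda>_. std_normal)) path_space (\<lambda>w x. \<Sum>i\<in>insert k K. w i * f i x)"
  proof -
    have ins: "finite (insert k K)" using K by simp
    have upd: "(\<lambda>(t, w). w(k := t)) \<in> std_normal \<Otimes>\<^sub>M PiM K (\<lambda>_. std_normal) \<rightarrow>\<^sub>M PiM (insert k K) (\<lambda>_. std_normal)"
      using measurable_compose[OF measurable_pair_swap' measurable_add_dim[of k K "\<lambda>_. std_normal"]]
      by (simp add: case_prod_unfold)
    have "(\<Sum>i\<in>insert k K. (w(k := t)) i * f i x) = S w x + t * f k x" for w t x
    proof -
      have "(\<Sum>i\<in>K. (w(k := t)) i * f i x) = S w x"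
        unfolding S_def by (rule sum.cong) (use K in auto)
      then show ?thesis using K by simp
    qed
    then have eq: "(\<lambda>w x. \<Sum>i\<in>insert k K. w i * f i x) \<circ> (\<lambda>(t, w). w(k := t)) = (\<lambda>(t, w) x. S w x + t * f k x)"
      by (auto simp: fun_eq_iff)
    have d: "distr (std_normal \<Otimes>\<^sub>M PiM K (\<lambda>_. std_normal)) (PiM (insert k K) (\<lambda>_. std_normal)) (\<lambda>(t, w). w(k := t)) =
        PiM (insert k K) (\<lambda>_. std_normal)"
      by (rule distr_pair_PiM_eq_PiM) (use N.prob_space_axioms in auto)
    show ?thesis
      using distr_distr[OF measurable_linear_combination[OF ins, of f] upd] unfolding d eq by simp
  qed
  finally show "distr P path_space (\<lambda>\<omega> x. X \<omega> x + \<eta> \<omega> * f k x) =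
      distr (PiM (insert k K) (\<lambda>_. std_normal)) path_space (\<lambda>w x. \<Sum>i\<in>insert k K. w i * f i x)" .
qed

section \<open>The dimensional constant\<close>

text \<open>In an orthonormal basis that has \<open>x /\<^sub>R norm x\<close> at an arbitrary place
  \<open>k\<close> the matrix is diagonal, with entries 1 except for
  \<open>1 + c * (norm x)\<^sup>2\<close> at \<open>k\<close>.\<close>

lemma det_identity_plus_outer:
  fixes x :: "real ^ 'm::finite"
  shows "det (\<chi> i j :: 'm. (if i = j then 1 else 0) + c * (x $ i * x $ j)) = 1 + c * (norm x)\<^sup>2"
proof (cases "x = 0")
  case True
  have "(\<chi> i j :: 'm. (if i = j then 1 else 0) + c * (x $ i * x $ j)) = mat 1"
    by (simp add: True mat_def)
  then show ?thesis using True by (simp add: det_I)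
next
  case False
  define k :: 'm where "k = undefined"
  define M where "M = (\<chi> i j :: 'm. (if i = j then 1 else 0) + c * (x $ i * x $ j))"
  define D where "D = (\<chi> i j :: 'm. if i = j then (if i = k then 1 + c * (norm x)\<^sup>2 else 1) else 0)"
  have M: "M *v v = v + (c * (x \<bullet> v)) *\<^sub>R x" for v
    by (simp add: M_def vec_eq_iff matrix_vector_mult_def inner_vec_def sum.distrib algebra_simps
        sum_distrib_left sum_distrib_right if_distrib[of "\<lambda>u. _ * u"] cong: if_cong)
  have D: "D *v v = v + (c * (norm x)\<^sup>2 * v $ k) *\<^sub>R axis k 1" for v
    by (simp add: D_def vec_eq_iff matrix_vector_mult_def axis_def algebra_simps
        if_distrib[of "\<lambda>u. _ * u"] if_distrib[of "\<lambda>u. u * _"] cong: if_cong)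
  obtain A where A: "orthogonal_matrix A" "A *v axis k 1 = x /\<^sub>R norm x"
    by (rule orthogonal_matrix_exists_basis[of "x /\<^sub>R norm x" k]) (use False in auto)
  have tA: "transpose A ** A = mat 1" using A(1) by (simp add: orthogonal_matrix_def)
  have tAx: "transpose A *v x = norm x *\<^sub>R axis k 1"
  proof -
    have "x = A *v (norm x *\<^sub>R axis k 1)" using A(2) False by (simp add: matrix_vector_mult_scaleR)
    then have "transpose A *v x = (transpose A ** A) *v (norm x *\<^sub>R axis k 1)"
      by (metis matrix_vector_mul_assoc)
    then show ?thesis by (simp add: tA)
  qed
  have "transpose A ** M ** A = D"
    unfolding matrix_eq
  proof
    fix v
    have "x \<bullet> (A *v v) = (transpose A *v x) \<bullet> v" by (simp flip: dot_lmul_matrix)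
    also have "\<dots> = norm x * v $ k" unfolding tAx by (simp add: inner_axis')
    finally have 1: "x \<bullet> (A *v v) = norm x * v $ k" .
    have "(transpose A ** M ** A) *v v = transpose A *v (M *v (A *v v))"
      by (simp only: matrix_vector_mul_assoc matrix_mul_assoc)
    also have "\<dots> = transpose A *v (A *v v) + (c * (norm x * v $ k)) *\<^sub>R (transpose A *v x)"
      by (simp only: M 1 matrix_vector_right_distrib matrix_vector_mult_scaleR)
    also have "\<dots> = (transpose A ** A) *v v + (c * (norm x * v $ k)) *\<^sub>R (transpose A *v x)"
      by (simp only: matrix_vector_mul_assoc)
    also have "\<dots> = D *v v"
      unfolding tA tAx D by (simp add: power2_eq_square mult_ac)
    finally show "(transpose A ** M ** A) *v v = D *v v" .
  qed
  then have "det D = det (transpose A ** M ** A)" by simp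
  also have "\<dots> = det (transpose A ** A) * det M" by (simp only: det_mul mult_ac)
  finally have "det D = det (transpose A ** A) * det M" .
  then have "det M = det D" by (simp add: tA det_I)
  also have "\<dots> = (\<Prod>i\<in>UNIV. D $ i $ i)" by (rule det_diagonal) (simp add: D_def)
  also have "\<dots> = 1 + c * (norm x)\<^sup>2" by (simp add: D_def prod.delta)
  finally show ?thesis unfolding M_def .
qed

lemma std_gaussian_hyperplane:
  fixes f :: "real ^ 'm::finite \<Rightarrow> real"
  assumes f: "linear f" "f v \<noteq> 0"
  shows "(\<integral>\<^sup>+y. (if f y = 0 then 1 else 0) \<partial>std_gaussian) = 0"
proof -
  define a where "a = adjoint f 1"
  have fa: "f y = a \<bullet> y" for y
    using adjoint_works[OF f(1), of y 1] by (simp add: a_def inner_commute)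
  have "a \<noteq> 0" using f(2) fa by auto
  then have "negligible {y. f y = 0}" unfolding fa by (rule negligible_hyperplane[OF disjI1])
  then have "AE y in lebesgue. f y \<noteq> 0"
    using AE_not_in[of "{y. f y = 0}" lebesgue] by (simp add: negligible_iff_null_sets)
  then have AE: "AE y in lborel. f y \<noteq> 0" by (simp only: AE_completion_iff)
  have [measurable]: "f \<in> borel_measurable borel" using f(1) by (rule linear_measurable_borel)
  have "(\<integral>\<^sup>+y. (if f y = 0 then 1 else 0) \<partial>std_gaussian) =
     (\<integral>\<^sup>+y. ennreal (\<Prod>b\<in>Basis. std_normal_density (y \<bullet> b)) * (if f y = 0 then 1 else 0) \<partial>lborel)"
    unfolding std_gaussian_def by (rule nn_integral_density) measurable
  also have "\<dots> = (\<integral>\<^sup>+y. 0 \<partial>(lborel :: (real ^ 'm) measure))"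
    by (rule nn_integral_cong_AE) (use AE in eventually_elim, simp)
  finally show ?thesis by simp
qed

text \<open>The rows of the identity matrix are replaced by Gaussian rows one at a time. As a
  function of the row being replaced the determinant is linear, and its value at the old row
  \<open>axis k 1\<close> is the previous determinant; where this is nonzero, the bad rows form a
  hyperplane.\<close>

lemma gaussian_matrix_nonsingular:
  "(\<integral>\<^sup>+g. (if det (\<chi> k :: 'm::finite. (g (coord_index k) :: real ^ 'm)) = 0 then 1 else 0)
     \<partial>PiM {..<CARD('m)} (\<lambda>_. std_gaussian)) = 0"
proof -
  let ?G = "std_gaussian :: (real ^ 'm) measure"
  interpret G: prob_space ?G by (rule prob_space_std_gaussian)
  define A :: "'m set \<Rightarrow> (nat \<Rightarrow> real ^ 'm) \<Rightarrow> real ^ 'm ^ 'm"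
    where "A S g = (\<chi> k. if k \<in> S then g (coord_index k) else axis k 1)" for S g
  have Am: "(\<lambda>g. det (A S g)) \<in> borel_measurable (PiM J (\<lambda>_. ?G))" if "coord_index ` S \<subseteq> J" for S J
    unfolding A_def
  proof (rule borel_measurable_det)
    fix k
    show "(\<lambda>g. if k \<in> S then g (coord_index k) else axis k 1) \<in> borel_measurable (PiM J (\<lambda>_. ?G))"
    proof (cases "k \<in> S")
      case True
      then have "coord_index k \<in> J" using that by blast
      from measurable_component_singleton[OF this, of "\<lambda>_. ?G"]
      have "(\<lambda>g. g (coord_index k)) \<in> borel_measurable (PiM J (\<lambda>_. ?G))"
        by (simp only: measurable_cong_sets[OF refl sets_std_gaussian])
      then show ?thesis using True by simp
    qed simp
  qed
  have "(\<integral>\<^sup>+g. (if det (A S g) = 0 then 1 else 0) \<partial>PiM {..<CARD('m)} (\<lambda>_. ?G)) = 0" for S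
  proof (induction S rule: finite_induct[OF finite])
    case 1
    have "A {} g = mat 1" for g by (simp add: A_def mat_def axis_def vec_eq_iff)
    then show ?case by (simp add: det_I)
  next
    case (2 k S)
    define c where "c = coord_index k"
    define J where "J = {..<CARD('m)} - {c}"
    have ins: "{..<CARD('m)} = insert c J" by (auto simp: J_def c_def)
    have J: "finite J" "c \<notin> J" by (auto simp: J_def)
    interpret product_prob_space "\<lambda>_::nat. ?G" J by unfold_locales
    have m: "(\<lambda>g. if det (A S' g) = 0 then 1 else 0 :: ennreal) \<in> borel_measurable (PiM (insert c J) (\<lambda>_. ?G))" for S'
    proof -
      have "(\<lambda>g. det (A S' g)) \<in> borel_measurable (PiM (insert c J) (\<lambda>_. ?G))"
        by (rule Am) (auto simp flip: ins)
      then show ?thesis by measurable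
    qed
    have inj: "coord_index i \<noteq> c" if "i \<noteq> k" for i
      using bij_coord_index[where 'm = 'm] that by (auto simp: c_def bij_betw_def inj_on_def)
    have AS: "A S (x(c := y)) = A S x" for x y
    proof -
      have "coord_index i \<noteq> c" if "i \<in> S" for i using inj[of i] 2(2) that by auto
      then show ?thesis unfolding A_def vec_eq_iff by simp
    qed
    have "(\<integral>\<^sup>+g. (if det (A (insert k S) g) = 0 then 1 else 0) \<partial>PiM (insert c J) (\<lambda>_. ?G)) =
        (\<integral>\<^sup>+x. \<integral>\<^sup>+y. (if det (A (insert k S) (x(c := y))) = 0 then 1 else 0) \<partial>?G \<partial>PiM J (\<lambda>_. ?G))"
      by (rule product_nn_integral_insert[OF J m])
    also have "\<dots> \<le> (\<integral>\<^sup>+x. \<integral>\<^sup>+y. (if det (A S (x(c := y))) = 0 then 1 else 0) \<partial>?G \<partial>PiM J (\<lambda>_. ?G))"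
    proof (rule nn_integral_mono)
      fix x
      define f where "f y = det (\<chi> i. if i = k then y else A S x $ i)" for y
      have ins_eq: "A (insert k S) (x(c := y)) = (\<chi> i. if i = k then y else A S x $ i)" for y
        unfolding A_def vec_eq_iff using inj by (auto simp: c_def)
      have "linear f"
      proof (rule linearI)
        show "f (y + z) = f y + f z" for y z
          unfolding f_def by (rule det_row_add[of k "\<lambda>_. y" "\<lambda>_. z"])
        show "f (t *\<^sub>R y) = t *\<^sub>R f y" for t y
          using det_row_mul[of k t "\<lambda>_. y" "\<lambda>i. A S x $ i"]
          unfolding f_def scalar_mult_eq_scaleR real_scaleR_def .
      qed
      moreover have "f (axis k 1) = det (A S x)"
        unfolding f_def by (rule arg_cong[where f = det]) (use 2(2) in \<open>auto simp: A_def vec_eq_iff\<close>)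
      ultimately have "(\<integral>\<^sup>+y. (if f y = 0 then 1 else 0) \<partial>?G) = 0" if "det (A S x) \<noteq> 0"
        using std_gaussian_hyperplane[of f "axis k 1"] that by simp
      moreover have "(\<integral>\<^sup>+y. (if f y = 0 then 1 else 0) \<partial>?G) \<le> (\<integral>\<^sup>+y. 1 \<partial>?G)"
        by (rule nn_integral_mono) simp
      ultimately show "(\<integral>\<^sup>+y. (if det (A (insert k S) (x(c := y))) = 0 then 1 else 0) \<partial>?G) \<le>
          (\<integral>\<^sup>+y. (if det (A S (x(c := y))) = 0 then 1 else 0) \<partial>?G)"
        unfolding ins_eq f_def[symmetric] AS by (cases "det (A S x) = 0") auto
    qed
    also have "\<dots> = (\<integral>\<^sup>+g. (if det (A S g) = 0 then 1 else 0) \<partial>PiM (insert c J) (\<lambda>_. ?G))"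
      by (rule product_nn_integral_insert[OF J m, symmetric])
    also have "\<dots> = 0" using 2(3) unfolding ins .
    finally show ?case unfolding ins by simp
  qed
  from this[of UNIV] show ?thesis by (simp add: A_def)
qed

lemma nn_integral_abs_power:
  assumes "a \<ge> 0"
  shows "(\<integral>\<^sup>+s. ennreal (\<bar>s\<bar> ^ n) * indicator {-a..a} s \<partial>lborel) = ennreal (2 * a ^ Suc n / real (Suc n))"
proof -
  have 1: "(\<integral>\<^sup>+s. ennreal (s ^ n) * indicator {0..a} s \<partial>lborel) = ennreal (a ^ Suc n / real (Suc n) - 0 ^ Suc n / real (Suc n))"
    by (rule nn_integral_FTC_Icc) (use assms in \<open>auto intro!: derivative_eq_intros simp del: power_Suc\<close>)
  have 2: "(\<integral>\<^sup>+s. ennreal (\<bar>s\<bar> ^ n) * indicator {-a..0} s \<partial>lborel) = (\<integral>\<^sup>+s. ennreal (\<bar>s\<bar> ^ n) * indicator {0..a} s \<partial>lborel)"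
    by (subst nn_integral_real_affine[where c = "-1" and t = 0])
      (auto intro!: nn_integral_cong split: split_indicator)
  have 3: "(\<integral>\<^sup>+s. ennreal (\<bar>s\<bar> ^ n) * indicator {0..a} s \<partial>lborel) = (\<integral>\<^sup>+s. ennreal (s ^ n) * indicator {0..a} s \<partial>lborel)"
    by (auto intro!: nn_integral_cong split: split_indicator)
  have "AE s in lborel. s \<noteq> (0::real)" by (rule AE_lborel_singleton)
  then have "(\<integral>\<^sup>+s. ennreal (\<bar>s\<bar> ^ n) * indicator {-a..a} s \<partial>lborel) =
     (\<integral>\<^sup>+s. ennreal (\<bar>s\<bar> ^ n) * indicator {-a..0} s + ennreal (\<bar>s\<bar> ^ n) * indicator {0..a} s \<partial>lborel)"
    by (intro nn_integral_cong_AE, elim eventually_mono) (use assms in \<open>auto split: split_indicator\<close>)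
  also have "\<dots> = (\<integral>\<^sup>+s. ennreal (\<bar>s\<bar> ^ n) * indicator {-a..0} s \<partial>lborel) + (\<integral>\<^sup>+s. ennreal (\<bar>s\<bar> ^ n) * indicator {0..a} s \<partial>lborel)"
    by (rule nn_integral_add) auto
  also have "\<dots> = ennreal (2 * a ^ Suc n / real (Suc n))"
    unfolding 2 3 1 using assms by (subst ennreal_plus[symmetric]) (simp_all del: power_Suc of_nat_Suc)
  finally show ?thesis .
qed

text \<open>The unit ball in one dimension more, as a union of line segments through the origin.\<close>

lemma nn_integral_projective_volume:
  "(\<integral>\<^sup>+x. ennreal ((1 / sqrt (1 + (norm x)\<^sup>2)) ^ Suc CARD('m)) \<partial>(lborel :: (real ^ 'm::finite) measure)) =
    ennreal (real (Suc CARD('m)) * unit_ball_vol (real (Suc CARD('m))) / 2)"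
proof -
  let ?m = "CARD('m)"
  let ?L = "lborel :: (real ^ 'm) measure"
  define a where "a x = 1 / sqrt (1 + (norm x)\<^sup>2)" for x :: "real ^ 'm"
  have r: "1 + (norm x)\<^sup>2 > 0" for x :: "real ^ 'm" by (simp add: add_pos_nonneg)
  have a0: "a x > 0" for x unfolding a_def using r[of x] by simp
  \<comment> \<open>The unit ball meets the line through \<open>(1, x)\<close> in the parameters
    \<open>s\<close> between \<open>- a x\<close> and \<open>a x\<close>.\<close>
  have key: "s\<^sup>2 + (norm (s *\<^sub>R x))\<^sup>2 \<le> 1 \<longleftrightarrow> s \<in> {- a x..a x}" for s and x :: "real ^ 'm"
  proof -
    have "s\<^sup>2 + (norm (s *\<^sub>R x))\<^sup>2 \<le> 1 \<longleftrightarrow> s\<^sup>2 * (1 + (norm x)\<^sup>2) \<le> 1"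
      by (simp add: power_mult_distrib distrib_left)
    also have "\<dots> \<longleftrightarrow> s\<^sup>2 \<le> (a x)\<^sup>2"
      using r[of x] by (simp add: a_def power_divide field_simps)
    also have "\<dots> \<longleftrightarrow> \<bar>s\<bar> \<le> \<bar>a x\<bar>" by (simp only: abs_le_square_iff)
    also have "\<dots> \<longleftrightarrow> s \<in> {- a x..a x}" using a0[of x] by auto
    finally show ?thesis .
  qed
  have [measurable]: "a \<in> borel_measurable borel" unfolding a_def by measurable
  have "ennreal (unit_ball_vol (real (Suc ?m))) = emeasure lborel (cball 0 1 :: (real \<times> (real ^ 'm)) set)"
    by (simp add: emeasure_cball add.commute)
  also have "\<dots> = (\<integral>\<^sup>+p. indicator (cball 0 1) p \<partial>((lborel :: real measure) \<Otimes>\<^sub>M ?L))"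
    by (simp add: lborel_prod)
  also have "\<dots> = (\<integral>\<^sup>+s. \<integral>\<^sup>+y. indicator (cball 0 1) (s, y) \<partial>?L \<partial>(lborel :: real measure))"
  proof (rule lborel.nn_integral_fst[symmetric])
    show "(indicator (cball 0 1) :: real \<times> (real ^ 'm) \<Rightarrow> ennreal) \<in> borel_measurable ((lborel :: real measure) \<Otimes>\<^sub>M ?L)"
      unfolding lborel_prod by (rule borel_measurable_indicator) simp
  qed
  \<comment> \<open>Substitution \<open>y = s *\<^sub>R x\<close> in the slice at height
    \<open>s\<close>, with Jacobian \<open>\<bar>s\<bar> ^ CARD('m)\<close>; the null set
    \<open>s = 0\<close> is left out.\<close>
  also have "\<dots> = (\<integral>\<^sup>+s. \<integral>\<^sup>+x. ennreal (\<bar>s\<bar> ^ ?m) * indicator {- a x..a x} s \<partial>?L \<partial>lborel)"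
  proof (rule nn_integral_cong_AE)
    have "AE s in lborel. s \<noteq> (0::real)" by (rule AE_lborel_singleton)
    then show "AE s in lborel. (\<integral>\<^sup>+y. indicator (cball 0 1) (s, y) \<partial>?L) =
      (\<integral>\<^sup>+x. ennreal (\<bar>s\<bar> ^ ?m) * indicator {- a x..a x} s \<partial>?L)"
    proof (rule eventually_mono)
      fix s :: real assume s: "s \<noteq> 0"
      have Lm: "?L = density (distr ?L borel (\<lambda>x. 0 + s *\<^sub>R x)) (\<lambda>_. \<bar>s\<bar> ^ DIM(real ^ 'm))"
        by (rule lborel_affine[OF s])
      have gm: "(\<lambda>y :: real ^ 'm. indicator (cball 0 1) (s, y) :: ennreal) \<in> borel_measurable borel"
      proof -
        have "{y :: real ^ 'm. (s, y) \<in> cball 0 1} = {y. s\<^sup>2 + (norm y)\<^sup>2 \<le> 1}"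
          by (simp add: norm_Pair)
        moreover have "closed {y :: real ^ 'm. s\<^sup>2 + (norm y)\<^sup>2 \<le> 1}"
          by (intro closed_Collect_le continuous_intros)
        ultimately have "{y :: real ^ 'm. (s, y) \<in> cball 0 1} \<in> sets borel" by simp
        then show ?thesis by (simp add: indicator_def[abs_def] measurable_If_set) 
      qed
      have "(\<integral>\<^sup>+y. indicator (cball 0 1) (s, y) \<partial>?L) =
          (\<integral>\<^sup>+x. ennreal (\<bar>s\<bar> ^ ?m) * indicator (cball 0 1) (s, s *\<^sub>R x) \<partial>?L)"
        using gm by (subst Lm) (simp add: nn_integral_density nn_integral_distr nn_integral_cmult)
      also have "\<dots> = (\<integral>\<^sup>+x. ennreal (\<bar>s\<bar> ^ ?m) * indicator {- a x..a x} s \<partial>?L)"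
      proof (rule nn_integral_cong)
        fix x :: "real ^ 'm"
        have "(s, s *\<^sub>R x) \<in> cball 0 1 \<longleftrightarrow> s\<^sup>2 + (norm (s *\<^sub>R x))\<^sup>2 \<le> 1"
          by (simp add: norm_Pair)
        then show "ennreal (\<bar>s\<bar> ^ ?m) * indicator (cball 0 1) (s, s *\<^sub>R x) = ennreal (\<bar>s\<bar> ^ ?m) * indicator {- a x..a x} s"
          unfolding key by (simp add: indicator_def)
      qed
      finally show "(\<integral>\<^sup>+y. indicator (cball 0 1) (s, y) \<partial>?L) =
        (\<integral>\<^sup>+x. ennreal (\<bar>s\<bar> ^ ?m) * indicator {- a x..a x} s \<partial>?L)" .
    qed
  qed
  also have "\<dots> = (\<integral>\<^sup>+x. \<integral>\<^sup>+s. ennreal (\<bar>s\<bar> ^ ?m) * indicator {- a x..a x} s \<partial>lborel \<partial>?L)"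
  proof (rule lborel_pair.Fubini'[symmetric])
    have "(\<lambda>p :: real \<times> (real ^ 'm). ennreal (\<bar>fst p\<bar> ^ ?m) * (if - a (snd p) \<le> fst p \<and> fst p \<le> a (snd p) then 1 else 0))
        \<in> borel_measurable (lborel \<Otimes>\<^sub>M lborel)"
      by measurable
    also have "(\<lambda>p :: real \<times> (real ^ 'm). ennreal (\<bar>fst p\<bar> ^ ?m) * (if - a (snd p) \<le> fst p \<and> fst p \<le> a (snd p) then 1 else 0)) =
       (\<lambda>(s, x). ennreal (\<bar>s\<bar> ^ ?m) * indicator {- a x..a x} s)"
      by (auto simp: fun_eq_iff split: split_indicator)
    finally show "(\<lambda>(s, x). ennreal (\<bar>s\<bar> ^ ?m) * indicator {- a x..a x} s) \<in> borel_measurable (lborel \<Otimes>\<^sub>M ?L)" .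
  qed
  also have "\<dots> = (\<integral>\<^sup>+x. ennreal (2 / real (Suc ?m)) * ennreal (a x ^ Suc ?m) \<partial>?L)"
    using a0 by (simp add: nn_integral_abs_power less_imp_le ennreal_mult'[symmetric] del: power_Suc)
  also have "\<dots> = ennreal (2 / real (Suc ?m)) * (\<integral>\<^sup>+x. ennreal (a x ^ Suc ?m) \<partial>?L)"
    by (rule nn_integral_cmult) measurable
  finally have "ennreal (real (Suc ?m) / 2) * ennreal (unit_ball_vol (real (Suc ?m))) =
     ennreal (real (Suc ?m) / 2) * (ennreal (2 / real (Suc ?m)) * (\<integral>\<^sup>+x. ennreal (a x ^ Suc ?m) \<partial>?L))"
    by simp
  also have "\<dots> = (\<integral>\<^sup>+x. ennreal (a x ^ Suc ?m) \<partial>?L)"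
    by (simp add: mult.assoc[symmetric] ennreal_mult'[symmetric] del: of_nat_Suc power_Suc)
  finally show ?thesis
    unfolding a_def by (simp add: ennreal_mult'[symmetric] mult.commute)
qed

lemma prod_Basis_coord:
  fixes v :: "real ^ 'm::finite"
  shows "(\<Prod>b\<in>Basis. g (v \<bullet> b)) = (\<Prod>j\<in>{..<CARD('m)}. g (v $ inv_into UNIV coord_index j))"
proof -
  have "(\<Prod>b\<in>Basis. g (v \<bullet> b)) = (\<Prod>k\<in>UNIV. g (v $ k))"
    by (rule prod.reindex_bij_witness[of _ "\<lambda>k. axis k 1" "\<lambda>b. SOME k. b = axis k 1"])
      (auto simp: Basis_vec_def inner_axis axis_eq_axis)
  also have "\<dots> = (\<Prod>j\<in>{..<CARD('m)}. g (v $ inv_into UNIV coord_index j))"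
    using prod.reindex_bij_betw[OF bij_coord_index[where 'm = 'm], of "\<lambda>j. g (v $ inv_into UNIV coord_index j)"]
      bij_coord_index[where 'm = 'm] by (simp add: bij_betw_def inv_into_f_f)
  finally show ?thesis .
qed

text \<open>The constant is read off the linear functions \<open>1, x\<^sub>1, \<dots>, x\<^sub>m\<close> on \<open>\<real>\<^sup>m\<close>, where a random
  system has almost surely exactly one solution.\<close>

lemma abs_det_mean_eq:
  "abs_det_mean TYPE('m::finite) * ennreal (1 / sqrt (2 * pi) ^ CARD('m)) = ennreal (zeros_constant CARD('m))"
proof -
  let ?m = "CARD('m)" and ?J = "{..<CARD('m)}"
  let ?M = "PiM ?J (\<lambda>_. PiM ?J (\<lambda>_. std_normal)) :: (nat \<Rightarrow> nat \<Rightarrow> real) measure"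
  interpret N: prob_space std_normal by (rule prob_space_std_normal)
  have pI: "prob_space (PiM ?J (\<lambda>_. std_normal))" by (intro prob_space_PiM N.prob_space_axioms)
  interpret W: prob_space ?M by (intro prob_space_PiM pI)
  interpret WL: pair_sigma_finite ?M "lborel :: (real ^ 'm) measure"
    by (simp add: pair_sigma_finite_def W.sigma_finite_measure_axioms lborel.sigma_finite_measure_axioms)
  define r :: "nat \<Rightarrow> 'm" where "r = inv_into UNIV coord_index"
  have r: "r (coord_index k) = k" "j < ?m \<Longrightarrow> coord_index (r j) = j" for k j
    using bij_coord_index[where 'm = 'm] unfolding r_def bij_betw_def
    by (auto intro: inv_into_f_f f_inv_into_f)
  have sumr: "(\<Sum>j\<in>?J. g (r j)) = (\<Sum>k\<in>UNIV. g k)" for g :: "'m \<Rightarrow> real"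
    using sum.reindex_bij_betw[OF bij_coord_index[where 'm = 'm], of "\<lambda>j. g (r j)"] by (simp add: r)
  have norm2: "(\<Sum>j\<in>?J. (u $ r j)\<^sup>2) = (norm u)\<^sup>2" for u :: "real ^ 'm"
    unfolding sumr[of "\<lambda>k. (u $ k)\<^sup>2"] by (simp add: norm_vec_def L2_set_def sum_nonneg)
  define L :: "nat \<Rightarrow> real ^ 'm" where "L j = axis (r j) 1" for j
  have L: "L j \<bullet> u = u $ r j" for j u by (simp add: L_def inner_axis')
  define Y where "Y W = (\<chi> k :: 'm. \<Sum>i\<in>?J. W (coord_index k) i *\<^sub>R L i)" for W :: "nat \<Rightarrow> nat \<Rightarrow> real"
  define G where "G W x = (\<Prod>j\<in>?J. ennreal (std_normal_density (\<Sum>i\<in>?J. W j i * x $ r i))) * ennreal \<bar>det (Y W)\<bar>"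
    for W :: "nat \<Rightarrow> nat \<Rightarrow> real" and x :: "real ^ 'm"
  define a where "a x = 1 / sqrt (1 + (norm x)\<^sup>2)" for x :: "real ^ 'm"
  \<comment> \<open>Here the values are the coordinates of \<open>x\<close> and the gradients are
    the unit vectors. The Gram matrix is \<open>1 / R\<close> times the identity minus an outer
    product with coefficient \<open>1 / R\<close>, so its determinant has
    \<open>CARD('m) + 1\<close> factors \<open>1 / R\<close>: one for each row, and one from the
    outer product.\<close>
  have D: "(\<integral>\<^sup>+W. G W x \<partial>?M) = abs_det_mean TYPE('m) * ennreal (1 / sqrt (2 * pi) ^ ?m) * ennreal (a x ^ Suc ?m)" for x
  proof -
    define R where "R = 1 + (norm x)\<^sup>2"
    have R: "R > 0" unfolding R_def by (simp add: add_pos_nonneg)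
    have "(\<integral>\<^sup>+W. G W x \<partial>?M) = abs_det_mean TYPE('m) * ennreal (sqrt (det (polar_matrix
       (\<lambda>u. (\<Sum>i\<in>?J. (L i \<bullet> u)\<^sup>2) / R - (\<Sum>i\<in>?J. x $ r i * (L i \<bullet> u))\<^sup>2 / R\<^sup>2))) / sqrt (2 * pi) ^ ?m)"
      unfolding G_def Y_def R_def norm2[symmetric] by (rule gaussian_det_expectation) simp
    also have "(\<lambda>u. (\<Sum>i\<in>?J. (L i \<bullet> u)\<^sup>2) / R - (\<Sum>i\<in>?J. x $ r i * (L i \<bullet> u))\<^sup>2 / R\<^sup>2) =
       (\<lambda>u. (norm u)\<^sup>2 / R - (x \<bullet> u)\<^sup>2 / R\<^sup>2)"
    proof -
      have "(\<Sum>i\<in>?J. x $ r i * u $ r i) = x \<bullet> u" for u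
        unfolding sumr[of "\<lambda>k. x $ k * u $ k"] by (simp add: inner_vec_def)
      then show ?thesis by (simp add: L norm2)
    qed
    also have "polar_matrix (\<lambda>u. (norm u)\<^sup>2 / R - (x \<bullet> u)\<^sup>2 / R\<^sup>2) =
       (1 / R) *\<^sub>R (\<chi> i j :: 'm. (if i = j then 1 else 0) + (- 1 / R) * (x $ i * x $ j))"
    proof -
      have 1: "(norm (u + v))\<^sup>2 - (norm u)\<^sup>2 - (norm v)\<^sup>2 = 2 * (u \<bullet> v)" for u v :: "real ^ 'm"
        by (simp add: power2_norm_eq_inner inner_simps inner_commute)
      have 2: "(x \<bullet> (u + v))\<^sup>2 - (x \<bullet> u)\<^sup>2 - (x \<bullet> v)\<^sup>2 = 2 * ((x \<bullet> u) * (x \<bullet> v))" for u v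
        by (simp add: inner_simps power2_sum)
      have "((norm (u + v))\<^sup>2 / R - (x \<bullet> (u + v))\<^sup>2 / R\<^sup>2 - ((norm u)\<^sup>2 / R - (x \<bullet> u)\<^sup>2 / R\<^sup>2) -
          ((norm v)\<^sup>2 / R - (x \<bullet> v)\<^sup>2 / R\<^sup>2)) / 2 = (u \<bullet> v) / R - ((x \<bullet> u) * (x \<bullet> v)) / R\<^sup>2" for u v
      proof -
        have 4: "((norm (u + v))\<^sup>2 / R - (x \<bullet> (u + v))\<^sup>2 / R\<^sup>2 - ((norm u)\<^sup>2 / R - (x \<bullet> u)\<^sup>2 / R\<^sup>2) -
          ((norm v)\<^sup>2 / R - (x \<bullet> v)\<^sup>2 / R\<^sup>2)) = ((norm (u + v))\<^sup>2 - (norm u)\<^sup>2 - (norm v)\<^sup>2) / R -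
            ((x \<bullet> (u + v))\<^sup>2 - (x \<bullet> u)\<^sup>2 - (x \<bullet> v)\<^sup>2) / R\<^sup>2"
          by (simp add: diff_divide_distrib)
        have 3: "X = 2 * p / R - 2 * q / S \<Longrightarrow> X / 2 = p / R - q / S" for X p q S :: real
          by (simp add: diff_divide_distrib)
        show ?thesis by (rule 3[OF 4[unfolded 1 2]])
      qed
      moreover have ax: "axis i (1::real) $ j = (if j = i then 1 else 0)" for i j :: 'm
        by (simp add: axis_def)
      ultimately show ?thesis
        unfolding polar_matrix_def
        by (simp only:) (simp add: vec_eq_iff inner_axis ax power2_eq_square right_diff_distrib)
    qed
    also have "det \<dots> = (1 / R) ^ Suc ?m"
    proof -
      have n: "(norm x)\<^sup>2 = R - 1" by (simp add: R_def)
      have "1 + - 1 / R * (norm x)\<^sup>2 = 1 / R" unfolding n using R by (simp add: field_simps)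
      then show ?thesis by (simp only: det_scaleR det_identity_plus_outer power_Suc2)
    qed
    also have "sqrt ((1 / R) ^ Suc ?m) = a x ^ Suc ?m"
      unfolding real_sqrt_power by (simp add: a_def R_def real_sqrt_divide)
    also have "ennreal (a x ^ Suc ?m / sqrt (2 * pi) ^ ?m) = ennreal (1 / sqrt (2 * pi) ^ ?m) * ennreal (a x ^ Suc ?m)"
      by (subst ennreal_mult'[symmetric]) simp_all
    finally show ?thesis by (simp only: mult.assoc)
  qed
  \<comment> \<open>For nonsingular \<open>Y W\<close> every value of the linear map
    \<open>Y W\<close> is taken exactly once, so the area formula returns the total Gaussian
    mass.\<close>
  have inner: "(\<integral>\<^sup>+x. G W x \<partial>lborel) = (if det (Y W) = 0 then 0 else 1)" for W
  proof (cases "det (Y W) = 0")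
    case True
    then show ?thesis by (simp add: G_def)
  next
    case False
    define dens where "dens v = ennreal (\<Prod>b\<in>Basis. std_normal_density (v \<bullet> b))" for v :: "real ^ 'm"
    have [measurable]: "dens \<in> borel_measurable borel" unfolding dens_def by measurable
    have Yx: "(Y W *v x) $ r j = (\<Sum>i\<in>?J. W j i * x $ r i)" if "j < ?m" for x j
      using that by (simp add: Y_def matrix_vector_mul_component inner_sum_left L r)
    have G: "G W x = dens (Y W *v x) * ennreal \<bar>det (Y W)\<bar>" for x
      unfolding G_def dens_def prod_Basis_coord r_def[symmetric] by (simp add: prod_ennreal Yx)
    have bij: "\<exists>y. {x \<in> UNIV. Y W *v x = z} = {y}" for z
    proof -
      obtain Z where Z: "Z ** Y W = mat 1" "Y W ** Z = mat 1"
        using False by (metis invertible_det_nz invertible_def)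
      have "Y W *v x = z \<longleftrightarrow> x = Z *v z" for x
        by (auto simp: matrix_vector_mul_assoc Z)
      then show ?thesis by auto
    qed
    have "(\<integral>\<^sup>+x. G W x \<partial>lborel) = (\<integral>\<^sup>+x. dens (Y W *v x) * ennreal \<bar>det (Y W)\<bar> * indicator UNIV x \<partial>lborel)"
      by (simp add: G)
    also have "\<dots> = (\<integral>\<^sup>+z. dens z * emeasure (count_space UNIV) {x \<in> UNIV. Y W *v x = z} \<partial>lborel)"
      by (rule area_formula[symmetric, where V = UNIV])
        (auto intro!: linear_imp_has_derivative matrix_vector_mul_linear)
    also have "\<dots> = emeasure (std_gaussian :: (real ^ 'm) measure) UNIV"
    proof -
      have "emeasure (count_space UNIV) {x \<in> UNIV. Y W *v x = z} = 1" for z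
        using bij[of z] by auto
      then show ?thesis by (simp add: std_gaussian_def emeasure_density dens_def)
    qed
    also have "\<dots> = 1"
      using prob_space.emeasure_space_1[OF prob_space_std_gaussian[where 'e = "real ^ 'm"]] by simp
    finally show ?thesis using False by simp
  qed
  have Ym: "(\<lambda>W. det (Y W)) \<in> borel_measurable ?M"
    unfolding Y_def
    by (intro borel_measurable_det borel_measurable_sum borel_measurable_scaleR measurable_matrix_entry) auto
  have Gm: "(\<lambda>(W, x). G W x) \<in> borel_measurable (?M \<Otimes>\<^sub>M lborel)"
  proof -
    have [measurable]: "(\<lambda>p. fst p j i) \<in> borel_measurable (?M \<Otimes>\<^sub>M (lborel :: (real ^ 'm) measure))"
      if "i \<in> ?J" "j \<in> ?J" for i j
      by (rule measurable_compose[OF measurable_fst measurable_matrix_entry[OF that(2,1)]])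
    have [measurable]: "(\<lambda>p. det (Y (fst p))) \<in> borel_measurable (?M \<Otimes>\<^sub>M (lborel :: (real ^ 'm) measure))"
      by (rule measurable_compose[OF measurable_fst Ym])
    show ?thesis unfolding G_def case_prod_unfold by measurable
  qed
  define C where "C = abs_det_mean TYPE('m) * ennreal (1 / sqrt (2 * pi) ^ ?m)"
  have [measurable]: "a \<in> borel_measurable borel" unfolding a_def by measurable
  \<comment> \<open>The double integral of \<open>G\<close> is evaluated in both orders: with the
    inner integral over \<open>W\<close> it is \<open>C\<close> times half the volume of the unit
    sphere, with the inner integral over \<open>x\<close> it is the probability of a unique
    solution.\<close>
  have "C * ennreal (real (Suc ?m) * unit_ball_vol (real (Suc ?m)) / 2) = (\<integral>\<^sup>+x. C * ennreal (a x ^ Suc ?m) \<partial>lborel)"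
    unfolding nn_integral_projective_volume[where 'm = 'm, symmetric] a_def
    by (rule nn_integral_cmult[symmetric]) measurable
  also have "\<dots> = (\<integral>\<^sup>+x. \<integral>\<^sup>+W. G W x \<partial>?M \<partial>lborel)" by (simp only: D C_def)
  also have "\<dots> = (\<integral>\<^sup>+W. \<integral>\<^sup>+x. G W x \<partial>lborel \<partial>?M)" by (rule WL.Fubini'[OF Gm])
  also have "\<dots> = (\<integral>\<^sup>+W. (if det (Y W) = 0 then 0 else 1) \<partial>?M)" unfolding inner ..
  also have "\<dots> = (\<integral>\<^sup>+g. (if det (\<chi> k :: 'm. (g (coord_index k) :: real ^ 'm)) = 0 then 0 else 1) \<partial>PiM ?J (\<lambda>_. std_gaussian))"
  proof -
    define F where "F y = (if det (\<chi> k :: 'm. (y (coord_index k) :: real ^ 'm)) = 0 then 0 else 1 :: ennreal)" for y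
    have Fm: "F \<in> borel_measurable (PiM ?J (\<lambda>_. borel))" unfolding F_def by measurable
    \<comment> \<open>With weight 1 the lemma on weighted rows just says that each row of
      \<open>Y W\<close> is a standard Gaussian vector, independent of the others.\<close>
    have "(\<integral>\<^sup>+W. (\<Prod>j\<in>?J. 1) * F (\<lambda>j\<in>?J. \<Sum>i\<in>?J. W j i *\<^sub>R L i) \<partial>?M) =
        1 ^ card ?J * (\<integral>\<^sup>+g. F (\<lambda>j\<in>?J. g j) \<partial>PiM ?J (\<lambda>_. std_gaussian))"
    proof (rule nn_integral_PiM_weighted[where M = borel and T = "\<lambda>y. y" and k = "\<lambda>_. 1"])
      fix H :: "real ^ 'm \<Rightarrow> ennreal" assume H: "H \<in> borel_measurable borel"
      show "(\<integral>\<^sup>+w. 1 * H (\<Sum>i\<in>?J. w i *\<^sub>R L i) \<partial>PiM ?J (\<lambda>_. std_normal)) = 1 * (\<integral>\<^sup>+y. H y \<partial>std_gaussian)"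
        using nn_integral_std_gaussian_orthonormal[OF _ _ H, of ?J L] by (simp add: L norm2)
    qed (use Fm pI prob_space_std_gaussian in simp_all)
    then show ?thesis by (simp add: F_def Y_def)
  qed
  also have "\<dots> = 1"
  proof -
    interpret G: prob_space "PiM ?J (\<lambda>_. std_gaussian :: (real ^ 'm) measure)"
      by (intro prob_space_PiM prob_space_std_gaussian)
    let ?d = "\<lambda>g. det (\<chi> k :: 'm. (g (coord_index k) :: real ^ 'm))"
    have [measurable]: "?d \<in> borel_measurable (PiM ?J (\<lambda>_. std_gaussian))" by measurable
    have "(\<integral>\<^sup>+g. (if ?d g = 0 then 0 else 1) \<partial>PiM ?J (\<lambda>_. std_gaussian)) =
      (\<integral>\<^sup>+g. (if ?d g = 0 then 0 else 1) \<partial>PiM ?J (\<lambda>_. std_gaussian)) + (\<integral>\<^sup>+g. (if ?d g = 0 then 1 else 0) \<partial>PiM ?J (\<lambda>_. std_gaussian))"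
      unfolding gaussian_matrix_nonsingular by simp
    also have "\<dots> = (\<integral>\<^sup>+g. (if ?d g = 0 then 0 else 1) + (if ?d g = 0 then 1 else 0) \<partial>PiM ?J (\<lambda>_. std_gaussian))"
      by (rule nn_integral_add[symmetric]) measurable
    also have "\<dots> = (\<integral>\<^sup>+g. 1 \<partial>PiM ?J (\<lambda>_. std_gaussian :: (real ^ 'm) measure))"
      by (rule nn_integral_cong) simp
    also have "\<dots> = 1" using G.emeasure_space_1 by simp
    finally show ?thesis .
  qed
  finally have 1: "C * ennreal (real (Suc ?m) * unit_ball_vol (real (Suc ?m)) / 2) = 1" .
  have pos: "real (Suc ?m) * unit_ball_vol (real (Suc ?m)) > 0" by simp
  have "x / 2 * (2 / x) = 1" if "x > 0" for x :: real using that by simp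
  from this[OF pos] have inv: "real (Suc ?m) * unit_ball_vol (real (Suc ?m)) / 2 * zeros_constant ?m = 1"
    unfolding zeros_constant_def Suc_eq_plus1 .
  have "C = C * ennreal (real (Suc ?m) * unit_ball_vol (real (Suc ?m)) / 2 * zeros_constant ?m)"
    unfolding inv by simp
  also have "\<dots> = C * ennreal (real (Suc ?m) * unit_ball_vol (real (Suc ?m)) / 2) * ennreal (zeros_constant ?m)"
  proof -
    have "0 \<le> real (Suc ?m) * unit_ball_vol (real (Suc ?m)) / 2" using pos by simp
    then show ?thesis by (simp only: ennreal_mult' mult.assoc)
  qed
  finally show ?thesis unfolding 1 by (simp add: C_def)
qed

section \<open>Smooth functions\<close>

lemma frechet_derivative_cong_open:
  assumes "open S" "x \<in> S" "\<And>y. y \<in> S \<Longrightarrow> f y = g y"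
  shows "frechet_derivative f (at x) = frechet_derivative g (at x)"
    and "f differentiable (at x) \<longleftrightarrow> g differentiable (at x)"
proof -
  have "(f has_derivative D) (at x) \<longleftrightarrow> (g has_derivative D) (at x)" for D
    using has_derivative_transform_within_open[of f D x UNIV S g] has_derivative_transform_within_open[of g D x UNIV S f]
      assms by auto
  then show "frechet_derivative f (at x) = frechet_derivative g (at x)"
    "f differentiable (at x) \<longleftrightarrow> g differentiable (at x)"
    by (simp_all add: frechet_derivative_def differentiable_def)
qed

text \<open>Derivative formulas are available at the points of \<open>S\<close> only. The closure
  lemmas below use this to replace a derivative by its formula on \<open>S\<close> before appealing
  to lower order.\<close>

lemma C_k_on_cong:
  assumes "open S" "\<And>x. x \<in> S \<Longrightarrow> f x = g x"
  shows "C_k_on k S f \<longleftrightarrow> C_k_on k S g"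
  using assms(2)
proof (induction k arbitrary: f g)
  case 0
  then show ?case by (simp cong: continuous_on_cong)
next
  case (Suc k)
  have 1: "frechet_derivative f (at x) = frechet_derivative g (at x)"
    "f differentiable (at x) \<longleftrightarrow> g differentiable (at x)" if "x \<in> S" for x
    using frechet_derivative_cong_open[OF assms(1) that, of f g] Suc.prems by auto
  have "C_k_on k S (\<lambda>x. frechet_derivative f (at x) v) \<longleftrightarrow> C_k_on k S (\<lambda>x. frechet_derivative g (at x) v)" for v
    by (rule Suc.IH) (simp add: 1)
  then show ?case using 1 by simp
qed

lemma C_k_on_Suc_imp: "C_k_on (Suc k) S f \<Longrightarrow> C_k_on k S f"
proof (induction k arbitrary: f)
  case 0
  then show ?case
    by (auto intro!: continuous_at_imp_continuous_on differentiable_imp_continuous_within)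
next
  case (Suc k)
  have "\<forall>x\<in>S. f differentiable (at x)" "C_k_on (Suc k) S (\<lambda>x. frechet_derivative f (at x) v)" for v
    using Suc.prems unfolding C_k_on.simps(2)[of "Suc k"] by blast+
  then show ?case using Suc.IH unfolding C_k_on.simps(2)[of k] by blast
qed

lemma C_k_on_const: "C_k_on k S (\<lambda>_. a)"
  by (induction k arbitrary: a) simp_all

lemma C_k_on_add:
  assumes S: "open S" and "C_k_on k S f" "C_k_on k S g"
  shows "C_k_on k S (\<lambda>x. f x + g x)"
  using assms(2,3)
proof (induction k arbitrary: f g)
  case (Suc k)
  have d: "((\<lambda>x. f x + g x) has_derivative (\<lambda>v. frechet_derivative f (at x) v + frechet_derivative g (at x) v)) (at x)"
    if "x \<in> S" for x
    using Suc.prems that by (intro has_derivative_add) (simp_all add: frechet_derivative_works[symmetric])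
  have "C_k_on k S (\<lambda>x. frechet_derivative (\<lambda>x. f x + g x) (at x) v)" for v
  proof -
    have "C_k_on k S (\<lambda>x. frechet_derivative f (at x) v + frechet_derivative g (at x) v)"
      by (rule Suc.IH) (use Suc.prems in auto)
    then show ?thesis
      using C_k_on_cong[OF S, of "\<lambda>x. frechet_derivative (\<lambda>x. f x + g x) (at x) v"
          "\<lambda>x. frechet_derivative f (at x) v + frechet_derivative g (at x) v"]
        frechet_derivative_at[OF d, symmetric] by simp
  qed
  then show ?case using d by (auto simp: differentiable_def)
qed (auto intro: continuous_intros)

lemma C_k_on_mult:
  fixes f g :: "'a::real_normed_vector \<Rightarrow> real"
  assumes S: "open S" and "C_k_on k S f" "C_k_on k S g"
  shows "C_k_on k S (\<lambda>x. f x * g x)"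
  using assms(2,3)
proof (induction k arbitrary: f g)
  case (Suc k)
  have d: "((\<lambda>x. f x * g x) has_derivative (\<lambda>v. f x * frechet_derivative g (at x) v + frechet_derivative f (at x) v * g x)) (at x)"
    if "x \<in> S" for x
    using Suc.prems that by (intro has_derivative_mult) (simp_all add: frechet_derivative_works[symmetric])
  have "C_k_on k S (\<lambda>x. frechet_derivative (\<lambda>x. f x * g x) (at x) v)" for v
  proof -
    have "C_k_on k S (\<lambda>x. f x * frechet_derivative g (at x) v + frechet_derivative f (at x) v * g x)"
      by (intro C_k_on_add[OF S] Suc.IH) (use Suc.prems C_k_on_Suc_imp in auto)
    then show ?thesis
      using C_k_on_cong[OF S, of "\<lambda>x. frechet_derivative (\<lambda>x. f x * g x) (at x) v"
          "\<lambda>x. f x * frechet_derivative g (at x) v + frechet_derivative f (at x) v * g x"]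
        frechet_derivative_at[OF d, symmetric] by simp
  qed
  then show ?case using d by (auto simp: differentiable_def)
qed (auto intro: continuous_intros)

lemma C_k_on_inverse:
  fixes f :: "'a::real_normed_vector \<Rightarrow> real"
  assumes S: "open S" and nz: "\<And>x. x \<in> S \<Longrightarrow> f x \<noteq> 0" and "C_k_on k S f"
  shows "C_k_on k S (\<lambda>x. inverse (f x))"
  using assms(3)
proof (induction k)
  case (Suc k)
  have d: "((\<lambda>x. inverse (f x)) has_derivative (\<lambda>v. - (inverse (f x) * frechet_derivative f (at x) v * inverse (f x)))) (at x)"
    if "x \<in> S" for x
    using Suc.prems that nz by (intro Deriv.has_derivative_inverse) (simp_all add: frechet_derivative_works[symmetric])
  have "C_k_on k S (\<lambda>x. frechet_derivative (\<lambda>x. inverse (f x)) (at x) v)" for v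
  proof -
    have "C_k_on k S (\<lambda>x. (- 1) * (inverse (f x) * frechet_derivative f (at x) v * inverse (f x)))"
      by (intro C_k_on_mult[OF S] C_k_on_const Suc.IH C_k_on_Suc_imp[OF Suc.prems]) (use Suc.prems in simp)
    then show ?thesis
      using C_k_on_cong[OF S, of "\<lambda>x. frechet_derivative (\<lambda>x. inverse (f x)) (at x) v"
          "\<lambda>x. (- 1) * (inverse (f x) * frechet_derivative f (at x) v * inverse (f x))"]
        frechet_derivative_at[OF d, symmetric] by simp
  qed
  then show ?case using d by (auto simp: differentiable_def)
qed (use nz in \<open>auto intro: continuous_intros\<close>)

text \<open>The derivative contains no logarithm any more, so the lemmas on products and inverses
  settle all higher orders at once.\<close>

lemma C_k_on_ln:
  fixes f :: "'a::real_normed_vector \<Rightarrow> real"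
  assumes S: "open S" and pos: "\<And>x. x \<in> S \<Longrightarrow> f x > 0" and "C_k_on k S f"
  shows "C_k_on k S (\<lambda>x. ln (f x))"
proof (cases k)
  case 0
  have "f x \<noteq> 0" if "x \<in> S" for x using pos[OF that] by simp
  then show ?thesis using assms(3) 0 by (auto intro!: continuous_intros)
next
  case (Suc n)
  have d: "((\<lambda>x. ln (f x)) has_derivative (\<lambda>v. inverse (f x) * frechet_derivative f (at x) v)) (at x)"
    if "x \<in> S" for x
  proof -
    have "(f has_derivative frechet_derivative f (at x)) (at x)"
      using assms(3) Suc that by (simp add: frechet_derivative_works[symmetric])
    from has_derivative_ln[OF pos[OF that] this] show ?thesis by (simp add: mult.commute)
  qed
  have "C_k_on n S (\<lambda>x. frechet_derivative (\<lambda>x. ln (f x)) (at x) v)" for v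
  proof -
    have "C_k_on n S (\<lambda>x. inverse (f x) * frechet_derivative f (at x) v)"
    proof (rule C_k_on_mult[OF S C_k_on_inverse[OF S]])
      show "f x \<noteq> 0" if "x \<in> S" for x using pos[OF that] by simp
      show "C_k_on n S f" using assms(3) Suc C_k_on_Suc_imp by blast
      show "C_k_on n S (\<lambda>x. frechet_derivative f (at x) v)" using assms(3) Suc by simp
    qed
    then show ?thesis
      using C_k_on_cong[OF S, of "\<lambda>x. frechet_derivative (\<lambda>x. ln (f x)) (at x) v"
          "\<lambda>x. inverse (f x) * frechet_derivative f (at x) v"]
        frechet_derivative_at[OF d, symmetric] by simp
  qed
  then show ?thesis using d Suc by (auto simp: differentiable_def)
qed

lemma C_k_on_inner_left:
  fixes f :: "'a::real_normed_vector \<Rightarrow> 'b::real_inner"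
  assumes S: "open S" and "C_k_on k S f"
  shows "C_k_on k S (\<lambda>x. w \<bullet> f x)"
  using assms(2)
proof (induction k arbitrary: f)
  case (Suc k)
  have d: "((\<lambda>x. w \<bullet> f x) has_derivative (\<lambda>v. w \<bullet> frechet_derivative f (at x) v)) (at x)"
    if "x \<in> S" for x
    using Suc.prems that by (intro has_derivative_inner_right) (simp_all add: frechet_derivative_works[symmetric])
  have "C_k_on k S (\<lambda>x. frechet_derivative (\<lambda>x. w \<bullet> f x) (at x) v)" for v
  proof -
    have "C_k_on k S (\<lambda>x. w \<bullet> frechet_derivative f (at x) v)"
      by (rule Suc.IH) (use Suc.prems in auto)
    then show ?thesis
      using C_k_on_cong[OF S, of "\<lambda>x. frechet_derivative (\<lambda>x. w \<bullet> f x) (at x) v"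
          "\<lambda>x. w \<bullet> frechet_derivative f (at x) v"]
        frechet_derivative_at[OF d, symmetric] by simp
  qed
  then show ?case using d by (auto simp: differentiable_def)
qed (auto intro: continuous_intros)

lemma smooth_on_sum:
  assumes "open S" "\<And>i. i \<in> K \<Longrightarrow> smooth_on S (f i)"
  shows "smooth_on S (\<lambda>x. \<Sum>i\<in>K. f i x)"
  using assms(2)
proof (induction K rule: infinite_finite_induct)
  case (insert j K)
  then have "smooth_on S (f j)" "smooth_on S (\<lambda>x. \<Sum>i\<in>K. f i x)" by simp_all
  then show ?case using insert.hyps by (simp add: smooth_on_def C_k_on_add[OF assms(1)])
qed (simp_all add: smooth_on_def C_k_on_const)

lemma smooth_on_mult:
  fixes f g :: "'a::real_normed_vector \<Rightarrow> real"
  shows "open S \<Longrightarrow> smooth_on S f \<Longrightarrow> smooth_on S g \<Longrightarrow> smooth_on S (\<lambda>x. f x * g x)"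
  by (simp add: smooth_on_def C_k_on_mult)

lemma smooth_on_const: "smooth_on S (\<lambda>_. a)"
  by (simp add: smooth_on_def C_k_on_const)

lemma smooth_on_ln:
  fixes f :: "'a::real_normed_vector \<Rightarrow> real"
  shows "open S \<Longrightarrow> smooth_on S f \<Longrightarrow> (\<And>x. x \<in> S \<Longrightarrow> f x > 0) \<Longrightarrow> smooth_on S (\<lambda>x. ln (f x))"
  by (simp add: smooth_on_def C_k_on_ln)

lemma smooth_on_imp_has_derivative:
  assumes "smooth_on S f" "x \<in> S"
  shows "(f has_derivative frechet_derivative f (at x)) (at x)"
proof -
  have "C_k_on (Suc 0) S f" using assms(1) unfolding smooth_on_def by blast
  then show ?thesis using assms(2) by (simp add: frechet_derivative_works[symmetric])
qed

lemma smooth_on_imp_continuous_derivative: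
  assumes "smooth_on S f"
  shows "continuous_on S (\<lambda>x. frechet_derivative f (at x) v)"
proof -
  have "C_k_on (Suc 0) S f" using assms unfolding smooth_on_def by blast
  then show ?thesis by simp
qed

lemma smooth_on_imp_continuous_on: "smooth_on S f \<Longrightarrow> continuous_on S f"
  unfolding smooth_on_def by (metis C_k_on.simps(1))

section \<open>Charts\<close>

locale manifold_atlas =
  fixes A :: "('a::{t2_space,second_countable_topology}, 'm::finite) chart set"
  assumes atlas: "smooth_atlas A"
begin

lemma ex_chart: "\<exists>c\<in>A. x \<in> fst c"
  using atlas unfolding smooth_atlas_def by blast

lemma open_fst: "c \<in> A \<Longrightarrow> open (fst c)"
  and open_range: "c \<in> A \<Longrightarrow> open (snd c ` fst c)"
  and chart_homeomorphism: "c \<in> A \<Longrightarrow> homeomorphism (fst c) (snd c ` fst c) (snd c) (chart_inv c)"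
  using conjunct1[OF conjunct2[OF atlas[unfolded smooth_atlas_def]], THEN bspec, of c] by simp_all

lemma smooth_transition:
  "c \<in> A \<Longrightarrow> c' \<in> A \<Longrightarrow> smooth_on (snd c ` (fst c \<inter> fst c')) (snd c' \<circ> chart_inv c)"
  by (rule conjunct2[OF conjunct2[OF atlas[unfolded smooth_atlas_def]], THEN bspec, THEN bspec])

lemma chart_inv_snd [simp]: "c \<in> A \<Longrightarrow> x \<in> fst c \<Longrightarrow> chart_inv c (snd c x) = x"
  by (rule homeomorphism_apply1[OF chart_homeomorphism])

lemma snd_chart_inv: "c \<in> A \<Longrightarrow> z \<in> snd c ` fst c \<Longrightarrow> snd c (chart_inv c z) = z"
  by (rule homeomorphism_apply2[OF chart_homeomorphism])

lemma chart_inv_mem: "c \<in> A \<Longrightarrow> z \<in> snd c ` fst c \<Longrightarrow> chart_inv c z \<in> fst c"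
  by auto

lemma continuous_on_chart: "c \<in> A \<Longrightarrow> continuous_on (fst c) (snd c)"
  by (rule homeomorphism_cont1[OF chart_homeomorphism])

lemma continuous_on_chart_inv: "c \<in> A \<Longrightarrow> continuous_on (snd c ` fst c) (chart_inv c)"
  by (rule homeomorphism_cont2[OF chart_homeomorphism])

lemma inj_on_chart: "c \<in> A \<Longrightarrow> inj_on (snd c) (fst c)"
  by (rule inj_on_inverseI[of _ "chart_inv c"]) simp

lemma chart_image_eq:
  assumes c: "c \<in> A" and S: "S \<subseteq> fst c"
  shows "snd c ` S = snd c ` fst c \<inter> chart_inv c -` S"
proof (intro set_eqI iffI)
  fix z assume "z \<in> snd c ` S"
  then obtain x where "x \<in> S" "z = snd c x" by blast
  then show "z \<in> snd c ` fst c \<inter> chart_inv c -` S" using c S by auto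
next
  fix z assume z: "z \<in> snd c ` fst c \<inter> chart_inv c -` S"
  then have "z = snd c (chart_inv c z)" using snd_chart_inv[OF c] by simp
  then show "z \<in> snd c ` S" using z by blast
qed

lemma open_chart_image:
  assumes c: "c \<in> A" and W: "open W"
  shows "open (snd c ` (fst c \<inter> W))"
proof -
  have "open (snd c ` fst c \<inter> chart_inv c -` W)"
    by (rule continuous_open_preimage[OF continuous_on_chart_inv[OF c] open_range[OF c] W])
  moreover have "snd c ` fst c \<inter> chart_inv c -` W = snd c ` (fst c \<inter> W)"
    unfolding chart_image_eq[OF c Int_lower1] using chart_inv_mem[OF c] by blast
  ultimately show ?thesis by simp
qed

lemma open_chart_preimage:
  assumes c: "c \<in> A" and W: "open W" "W \<subseteq> snd c ` fst c"
  shows "open (chart_inv c ` W)"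
proof -
  have "open (fst c \<inter> snd c -` W)"
    by (rule continuous_open_preimage[OF continuous_on_chart[OF c] open_fst[OF c] W(1)])
  moreover have "fst c \<inter> snd c -` W = chart_inv c ` W"
  proof safe
    fix x assume "x \<in> fst c" "snd c x \<in> W"
    moreover from this have "chart_inv c (snd c x) = x" using c by simp
    ultimately show "x \<in> chart_inv c ` W" by (metis image_eqI)
  next
    fix z assume "z \<in> W"
    then have z: "z \<in> snd c ` fst c" using W(2) by blast
    show "chart_inv c z \<in> fst c" by (rule chart_inv_mem[OF c z])
    show "chart_inv c z \<in> snd c -` W" using \<open>z \<in> W\<close> by (simp add: snd_chart_inv[OF c z])
  qed
  ultimately show ?thesis by simp
qed

text \<open>Preimages of small closed balls under charts give every point a compact neighbourhood
  inside the open set, and countably many of them suffice by second countability.\<close>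

lemma sigma_compact_traces_open:
  assumes U: "open (U :: 'a set)"
  shows "sigma_compact_traces U"
  unfolding sigma_compact_traces_def
proof (intro allI impI)
  fix W :: "'a set" assume "open W"
  then have O: "open (W \<inter> U)" using U by blast
  define \<F> where "\<F> = {V. open V \<and> (\<exists>K. compact K \<and> V \<subseteq> K \<and> K \<subseteq> W \<inter> U)}"
  have un: "\<Union>\<F> = W \<inter> U"
  proof
    show "W \<inter> U \<subseteq> \<Union>\<F>"
    proof
      fix x assume x: "x \<in> W \<inter> U"
      obtain c where c: "c \<in> A" "x \<in> fst c" using ex_chart by blast
      have "snd c x \<in> snd c ` (fst c \<inter> (W \<inter> U))" using x c by blast
      then obtain e where e: "e > 0" "cball (snd c x) e \<subseteq> snd c ` (fst c \<inter> (W \<inter> U))"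
        using open_chart_image[OF c(1) O] open_contains_cball by blast
      let ?K = "chart_inv c ` cball (snd c x) e" and ?V = "chart_inv c ` ball (snd c x) e"
      have sub: "cball (snd c x) e \<subseteq> snd c ` fst c" using e(2) by blast
      have "compact ?K"
        by (rule compact_continuous_image[OF continuous_on_subset[OF continuous_on_chart_inv[OF c(1)] sub] compact_cball])
      moreover have "open ?V"
        by (rule open_chart_preimage[OF c(1) open_ball]) (use sub ball_subset_cball in blast)
      moreover have "?V \<subseteq> ?K" by (intro image_mono ball_subset_cball)
      moreover have "?K \<subseteq> W \<inter> U"
      proof
        fix y assume "y \<in> ?K"
        then obtain z where "z \<in> cball (snd c x) e" "y = chart_inv c z" by blast
        then obtain y' where "y' \<in> fst c" "y' \<in> W \<inter> U" "z = snd c y'" using e(2) by blast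
        then show "y \<in> W \<inter> U" using \<open>y = chart_inv c z\<close> c(1) by simp
      qed
      ultimately have "?V \<in> \<F>" unfolding \<F>_def by blast
      moreover have "x \<in> ?V"
        using e(1) c by (intro image_eqI[of x _ "snd c x"]) auto
      ultimately show "x \<in> \<Union>\<F>" by blast
    qed
  qed (auto simp: \<F>_def)
  obtain \<G> where \<G>: "\<G> \<subseteq> \<F>" "countable \<G>" "\<Union>\<G> = W \<inter> U"
    using Lindelof[of \<F>] un unfolding \<F>_def by (metis (no_types, lifting) mem_Collect_eq)
  define k where "k V = (SOME K. compact K \<and> V \<subseteq> K \<and> K \<subseteq> W \<inter> U)" for V
  have k: "compact (k V) \<and> V \<subseteq> k V \<and> k V \<subseteq> W \<inter> U" if "V \<in> insert {} \<G>" for V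
    unfolding k_def
  proof (rule someI_ex[of "\<lambda>K. compact K \<and> V \<subseteq> K \<and> K \<subseteq> W \<inter> U"])
    show "\<exists>K. compact K \<and> V \<subseteq> K \<and> K \<subseteq> W \<inter> U"
    proof (cases "V = {}")
      case True
      then show ?thesis by (intro exI[of _ "{}"]) simp
    next
      case False
      then have "V \<in> \<F>" using that \<G>(1) by blast
      then show ?thesis unfolding \<F>_def by blast
    qed
  qed
  define n where "n = from_nat_into (insert {} \<G>)"
  have n: "range n = insert {} \<G>"
    unfolding n_def by (rule range_from_nat_into) (use \<G> in auto)
  have nk: "n i \<in> insert {} \<G>" for i unfolding n[symmetric] by simp
  have "W \<inter> U = (\<Union>i. k (n i))"
  proof
    show "(\<Union>i. k (n i)) \<subseteq> W \<inter> U" using k[OF nk] by blast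
    show "W \<inter> U \<subseteq> (\<Union>i. k (n i))"
    proof
      fix x assume "x \<in> W \<inter> U"
      then obtain V where "V \<in> \<G>" "x \<in> V" using \<G>(3) by blast
      moreover have "V \<in> range n" using \<open>V \<in> \<G>\<close> n by simp
      ultimately obtain i where "n i = V" by blast
      then show "x \<in> (\<Union>i. k (n i))" using k[OF nk[of i]] \<open>x \<in> V\<close> by blast
    qed
  qed
  then show "\<exists>K :: nat \<Rightarrow> 'a set. (\<forall>n. compact (K n)) \<and> W \<inter> U = (\<Union>n. K n)"
    using k[OF nk] by (intro exI[of _ "\<lambda>i. k (n i)"]) simp
qed

section \<open>Smooth functions and tangent vectors in coordinates\<close>

lemma smooth_funD:
  "smooth_fun A h \<Longrightarrow> c \<in> A \<Longrightarrow> smooth_on (snd c ` fst c) (h \<circ> chart_inv c)"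
  unfolding smooth_fun_on_def by auto

lemma smooth_funI:
  "(\<And>c. c \<in> A \<Longrightarrow> smooth_on (snd c ` fst c) (h \<circ> chart_inv c)) \<Longrightarrow> smooth_fun A h"
  unfolding smooth_fun_on_def by auto

lemma smooth_fun_sum:
  assumes "\<And>i. i \<in> K \<Longrightarrow> smooth_fun A (f i)"
  shows "smooth_fun A (\<lambda>x. \<Sum>i\<in>K. a i * f i x)"
proof (rule smooth_funI)
  fix c assume c: "c \<in> A"
  have "smooth_on (snd c ` fst c) (\<lambda>z. \<Sum>i\<in>K. a i * (f i \<circ> chart_inv c) z)"
    by (intro smooth_on_sum smooth_on_mult smooth_on_const open_range c smooth_funD assms)
  then show "smooth_on (snd c ` fst c) ((\<lambda>x. \<Sum>i\<in>K. a i * f i x) \<circ> chart_inv c)"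
    by (simp add: o_def)
qed

lemma smooth_fun_continuous:
  assumes "smooth_fun A h" shows "continuous_on UNIV h"
proof -
  have "isCont h x" for x
  proof -
    obtain c where c: "c \<in> A" "x \<in> fst c" using ex_chart by blast
    have "continuous_on (fst c) ((h \<circ> chart_inv c) \<circ> snd c)"
      by (intro continuous_on_compose continuous_on_chart c smooth_on_imp_continuous_on smooth_funD assms)
    then have "continuous_on (fst c) h"
      by (rule continuous_on_eq) (use c in simp)
    then show ?thesis using c open_fst by (simp add: continuous_on_eq_continuous_at)
  qed
  then show ?thesis by (simp add: continuous_at_imp_continuous_on)
qed

definition grad :: "('a, 'm) chart \<Rightarrow> ('a \<Rightarrow> real) \<Rightarrow> real ^ 'm \<Rightarrow> real ^ 'm" where
  "grad c h z = (\<chi> i. frechet_derivative (h \<circ> chart_inv c) (at z) (axis i 1))"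

lemma linear_eq_inner_axis:
  fixes f :: "real ^ 'n::finite \<Rightarrow> real"
  assumes "linear f" shows "f v = (\<chi> i. f (axis i 1)) \<bullet> v"
proof -
  have "f v = f (\<Sum>i\<in>UNIV. v $ i *\<^sub>R axis i 1)"
    using basis_expansion[of v] by (simp add: scalar_mult_eq_scaleR)
  also have "\<dots> = (\<Sum>i\<in>UNIV. v $ i * f (axis i 1))"
    by (simp add: linear_sum[OF assms] linear_scale[OF assms])
  finally have "f v = (\<Sum>i\<in>UNIV. v $ i * f (axis i 1))" .
  then show ?thesis by (simp add: inner_vec_def mult.commute)
qed

lemma frechet_derivative_eq_grad:
  assumes "(h \<circ> chart_inv c) differentiable (at z)"
  shows "frechet_derivative (h \<circ> chart_inv c) (at z) v = grad c h z \<bullet> v"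
  unfolding grad_def by (rule linear_eq_inner_axis) (rule linear_frechet_derivative[OF assms])

lemma has_derivative_grad:
  assumes "smooth_fun A h" "c \<in> A" "z \<in> snd c ` fst c"
  shows "((\<lambda>z. h (chart_inv c z)) has_derivative (\<lambda>v. grad c h z \<bullet> v)) (at z)"
proof -
  have d: "(h \<circ> chart_inv c has_derivative frechet_derivative (h \<circ> chart_inv c) (at z)) (at z)"
    by (rule smooth_on_imp_has_derivative[OF smooth_funD[OF assms(1,2)] assms(3)])
  then have "frechet_derivative (h \<circ> chart_inv c) (at z) = (\<lambda>v. grad c h z \<bullet> v)"
    by (intro ext frechet_derivative_eq_grad) (auto simp: differentiable_def)
  then show ?thesis using d by (simp add: o_def)
qed

lemma continuous_on_grad:
  assumes "smooth_fun A h" "c \<in> A"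
  shows "continuous_on (snd c ` fst c) (grad c h)"
  unfolding grad_def
  by (intro continuous_on_vec_lambda smooth_on_imp_continuous_derivative smooth_funD assms)

lemma chart_vector_apply:
  assumes "smooth_fun A h" "c \<in> A" "x \<in> fst c"
  shows "chart_vector A c x w h = grad c h (snd c x) \<bullet> w"
proof -
  have "\<exists>W. open W \<and> x \<in> W \<and> smooth_fun_on A W h" using assms(1) by (intro exI[of _ UNIV]) simp
  then have "chart_vector A c x w h = frechet_derivative (h \<circ> chart_inv c) (at (snd c x)) w"
    unfolding chart_vector_def by simp
  also have "\<dots> = grad c h (snd c x) \<bullet> w"
  proof (rule frechet_derivative_eq_grad)
    show "h \<circ> chart_inv c differentiable at (snd c x)"
      using has_derivative_grad[OF assms(1,2), of "snd c x"] assms(3) by (auto simp: differentiable_def o_def)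
  qed
  finally show ?thesis .
qed

text \<open>The vector is tested on the coordinate function \<open>w \<bullet> snd c y\<close>,
  where it takes the value \<open>w \<bullet> w\<close>. This function is smooth on the chart domain
  only, which is enough because tangent vectors act on all functions smooth near
  \<open>x\<close>.\<close>

lemma chart_vector_nonzero:
  assumes c: "c \<in> A" "x \<in> fst c" and w: "w \<noteq> 0"
  shows "chart_vector A c x w \<noteq> (\<lambda>_. 0)"
proof -
  define h where "h y = w \<bullet> snd c y" for y
  have "smooth_fun_on A (fst c) h"
    unfolding smooth_fun_on_def
  proof
    fix c' assume c': "c' \<in> A"
    have o: "open (snd c' ` (fst c' \<inter> fst c))" by (rule open_chart_image[OF c' open_fst[OF c(1)]])
    have "smooth_on (snd c' ` (fst c' \<inter> fst c)) (\<lambda>z. w \<bullet> (snd c \<circ> chart_inv c') z)"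
      using smooth_transition[OF c' c(1)] C_k_on_inner_left[OF o] unfolding smooth_on_def by blast
    then show "smooth_on (snd c' ` (fst c' \<inter> fst c)) (h \<circ> chart_inv c')"
      by (simp add: h_def o_def)
  qed
  then have "\<exists>W. open W \<and> x \<in> W \<and> smooth_fun_on A W h" using open_fst[OF c(1)] c(2) by blast
  then have "chart_vector A c x w h = frechet_derivative (h \<circ> chart_inv c) (at (snd c x)) w"
    unfolding chart_vector_def by simp
  also have "frechet_derivative (h \<circ> chart_inv c) (at (snd c x)) = frechet_derivative (\<lambda>z. w \<bullet> z) (at (snd c x))"
    by (rule frechet_derivative_cong_open(1)[OF open_range[OF c(1)]])
      (use c in \<open>auto simp: h_def\<close>)
  also have "\<dots> = (\<lambda>z. w \<bullet> z)"
    by (rule frechet_derivative_at[symmetric]) (auto intro!: derivative_eq_intros)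
  finally have "chart_vector A c x w h = w \<bullet> w" .
  then show ?thesis using w by (metis inner_eq_zero_iff)
qed

lemma has_derivative_transition:
  assumes c: "c \<in> A" and c': "c' \<in> A" and z: "z \<in> snd c ` (fst c \<inter> fst c')"
  shows "((snd c' \<circ> chart_inv c) has_derivative frechet_derivative (snd c' \<circ> chart_inv c) (at z)) (at z)"
  by (rule smooth_on_imp_has_derivative[OF smooth_transition[OF c c'] z])

lemma chart_vector_change:
  assumes c: "c \<in> A" "x \<in> fst c" and c': "c' \<in> A" "x \<in> fst c'"
  shows "chart_vector A c x w =
    chart_vector A c' x (frechet_derivative (snd c' \<circ> chart_inv c) (at (snd c x)) w)"
proof
  fix h
  let ?\<tau> = "snd c' \<circ> chart_inv c"
  show "chart_vector A c x w h = chart_vector A c' x (frechet_derivative ?\<tau> (at (snd c x)) w) h"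
  proof (cases "\<exists>W. open W \<and> x \<in> W \<and> smooth_fun_on A W h")
    case True
    then obtain W where W: "open W" "x \<in> W" "smooth_fun_on A W h" by blast
    have z: "snd c x \<in> snd c ` (fst c \<inter> fst c')" using c c' by blast
    have "snd c' x \<in> snd c' ` (fst c' \<inter> W)" using c' W by blast
    then have d: "(h \<circ> chart_inv c' has_derivative frechet_derivative (h \<circ> chart_inv c') (at (snd c' x))) (at (snd c' x))"
      using W(3) c'(1) smooth_on_imp_has_derivative unfolding smooth_fun_on_def by blast
    have tx: "?\<tau> (snd c x) = snd c' x" using c by simp
    have "((h \<circ> chart_inv c') \<circ> ?\<tau> has_derivative
        frechet_derivative (h \<circ> chart_inv c') (at (snd c' x)) \<circ> frechet_derivative ?\<tau> (at (snd c x))) (at (snd c x))"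
      by (rule diff_chain_at[OF has_derivative_transition[OF c(1) c'(1) z]]) (simp only: tx d)
    then have "(h \<circ> chart_inv c has_derivative
        frechet_derivative (h \<circ> chart_inv c') (at (snd c' x)) \<circ> frechet_derivative ?\<tau> (at (snd c x))) (at (snd c x))"
      by (rule has_derivative_transform_within_open[OF _ open_chart_image[OF c(1) open_fst[OF c'(1)]] z])
        (use c c' in auto)
    then have "frechet_derivative (h \<circ> chart_inv c) (at (snd c x)) =
        frechet_derivative (h \<circ> chart_inv c') (at (snd c' x)) \<circ> frechet_derivative ?\<tau> (at (snd c x))"
      by (rule frechet_derivative_at[symmetric])
    then show ?thesis using True by (simp add: chart_vector_def)
  next
    case False
    show ?thesis unfolding chart_vector_def if_not_P[OF False] by (rule refl)
  qed
qed

lemma tangent_space_chart: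
  assumes c: "c \<in> A" "x \<in> fst c"
  shows "tangent_space A x = range (chart_vector A c x)"
  unfolding tangent_space_def using chart_vector_change[OF _ _ c] c by blast

end

section \<open>Quadratic forms\<close>

lemma matrix_transform_component:
  "(transpose M ** N ** M) $ i $ j = (M *v axis i 1) \<bullet> (N *v (M *v axis j (1::real)))"
  for M N :: "real ^ 'm::finite ^ 'm"
proof -
  have "B $ i $ j = axis i 1 \<bullet> (B *v axis j 1)" for B :: "real ^ 'm ^ 'm"
    by (simp add: inner_axis' matrix_vector_mult_basis column_def)
  then have "(transpose M ** N ** M) $ i $ j = axis i 1 \<bullet> ((transpose M ** N ** M) *v axis j 1)" .
  also have "(transpose M ** N ** M) *v axis j 1 = transpose M *v (N *v (M *v axis j 1))"
    by (simp only: matrix_vector_mul_assoc matrix_mul_assoc)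
  also have "axis i 1 \<bullet> (transpose M *v (N *v (M *v axis j 1))) = (M *v axis i 1) \<bullet> (N *v (M *v axis j 1))"
    by (simp add: inner_commute[of "axis i 1"] inner_commute[of "M *v axis i 1"] dot_lmul_matrix)
  finally show ?thesis .
qed

text \<open>In the coordinates \<open>M *v w\<close> the form is the Euclidean square plus the
  square of one linear form, whose matrix is the identity plus an outer product; passing back to
  \<open>w\<close> multiplies the determinant by that of \<open>M\<close>, squared.\<close>

lemma det_polar_matrix_rank_one:
  fixes M :: "real ^ 'm::finite ^ 'm"
  shows "det (polar_matrix (\<lambda>w. (norm (M *v w))\<^sup>2 + (s \<bullet> (M *v w))\<^sup>2)) = (det M)\<^sup>2 * (1 + (norm s)\<^sup>2)"
proof -
  define N where "N = (\<chi> i j :: 'm. (if i = j then 1 else 0) + 1 * (s $ i * s $ j))"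
  have N: "N *v v = v + (s \<bullet> v) *\<^sub>R s" for v
    by (simp add: N_def vec_eq_iff matrix_vector_mult_def inner_vec_def sum.distrib algebra_simps
        sum_distrib_left sum_distrib_right if_distrib[of "\<lambda>u. _ * u"] cong: if_cong)
  have "polar_matrix (\<lambda>w. (norm (M *v w))\<^sup>2 + (s \<bullet> (M *v w))\<^sup>2) = transpose M ** N ** M"
    unfolding vec_eq_iff matrix_transform_component N polar_matrix_def
    by (simp add: matrix_vector_right_distrib power2_norm_eq_inner inner_simps inner_commute power2_sum field_simps)
  moreover have "det N = 1 + 1 * (norm s)\<^sup>2" unfolding N_def by (rule det_identity_plus_outer)
  ultimately show ?thesis by (simp add: det_mul det_transpose power2_eq_square mult_ac)
qed

lemma polar_matrix_cmult: "polar_matrix (\<lambda>w. k * p w) = k *\<^sub>R polar_matrix p"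
  by (simp add: polar_matrix_def vec_eq_iff algebra_simps diff_divide_distrib)

text \<open>A sum of any number of squares of linear forms is a single squared norm with a square
  matrix. The factor is the adjoint of the map that generates a Gaussian vector with this
  covariance.\<close>

lemma quadratic_form_factor:
  fixes a :: "'i \<Rightarrow> real ^ 'm::finite"
  assumes "finite K"
  obtains M :: "real ^ 'm ^ 'm" where "\<And>w. (norm (M *v w))\<^sup>2 = (\<Sum>i\<in>K. (a i \<bullet> w)\<^sup>2)"
proof -
  obtain T :: "real ^ 'm \<Rightarrow> real ^ 'm" where T: "linear T" "\<And>u. (norm (adjoint T u))\<^sup>2 = (\<Sum>i\<in>K. (a i \<bullet> u)\<^sup>2)"
    by (rule gaussian_reduce[OF assms, of a]) blast
  have "matrix (adjoint T) *v w = adjoint T w" for w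
    by (rule matrix_works) (simp add: linear_matrix_vector_mul_eq adjoint_linear[OF T(1)])
  then show ?thesis using that[of "matrix (adjoint T)"] T(2) by simp
qed

text \<open>The matrix \<open>M\<close> maps the ellipsoid onto the unit ball, where the supremum is
  that of Cauchy--Schwarz, attained at \<open>s /\<^sub>R norm s\<close>.\<close>

lemma Sup_rank_one:
  fixes M :: "real ^ 'm::finite ^ 'm"
  assumes det: "det M \<noteq> 0"
  shows "Sup {(s \<bullet> (M *v w))\<^sup>2 | w. (norm (M *v w))\<^sup>2 \<le> 1} = (norm s)\<^sup>2"
proof -
  obtain Z where Z: "M ** Z = mat 1" using det by (metis invertible_det_nz invertible_def)
  have MZ: "M *v (Z *v y) = y" for y :: "real ^ 'm" by (simp add: matrix_vector_mul_assoc Z)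
  have "{(s \<bullet> (M *v w))\<^sup>2 | w. (norm (M *v w))\<^sup>2 \<le> 1} = {(s \<bullet> y)\<^sup>2 | y. norm y \<le> 1}"
  proof safe
    fix w assume "(norm (M *v w))\<^sup>2 \<le> 1"
    then have "norm (M *v w) \<le> 1" by (simp add: abs_square_le_1)
    then show "\<exists>y. (s \<bullet> (M *v w))\<^sup>2 = (s \<bullet> y)\<^sup>2 \<and> norm y \<le> 1" by blast
  next
    fix y :: "real ^ 'm" assume "norm y \<le> 1"
    then have "(norm (M *v (Z *v y)))\<^sup>2 \<le> 1" by (simp add: MZ abs_square_le_1)
    then show "\<exists>w. (s \<bullet> y)\<^sup>2 = (s \<bullet> (M *v w))\<^sup>2 \<and> (norm (M *v w))\<^sup>2 \<le> 1"
      by (intro exI[of _ "Z *v y"]) (simp add: MZ)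
  qed
  also have "Sup {(s \<bullet> y)\<^sup>2 | y. norm y \<le> 1} = (norm s)\<^sup>2"
  proof (rule cSup_eq_maximum)
    show "(norm s)\<^sup>2 \<in> {(s \<bullet> y)\<^sup>2 | y. norm y \<le> 1}"
    proof -
      have "s \<bullet> (s /\<^sub>R norm s) = norm s" by (cases "s = 0") (auto simp: power2_norm_eq_inner[symmetric] power2_eq_square)
      moreover have "norm (s /\<^sub>R norm s) \<le> 1" by (cases "s = 0") auto
      ultimately show ?thesis by (metis (mono_tags, lifting) mem_Collect_eq)
    qed
    fix r assume "r \<in> {(s \<bullet> y)\<^sup>2 | y. norm y \<le> 1}"
    then obtain y where y: "r = (s \<bullet> y)\<^sup>2" "norm y \<le> 1" by blast
    have "\<bar>s \<bullet> y\<bar> \<le> norm s * norm y" by (rule Cauchy_Schwarz_ineq2)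
    also have "\<dots> \<le> norm s" using y(2) by (simp add: mult_left_le)
    finally have "\<bar>s \<bullet> y\<bar> \<le> norm s" .
    then have "\<bar>s \<bullet> y\<bar>\<^sup>2 \<le> (norm s)\<^sup>2" by (intro power_mono) simp_all
    then show "r \<le> (norm s)\<^sup>2" by (simp add: y)
  qed
  finally show ?thesis .
qed

lemma second_moment_gaussian_combination:
  fixes \<xi> :: "nat \<Rightarrow> 'w \<Rightarrow> real"
  assumes P: "prob_space P" and K: "finite K" "K \<noteq> {}"
    and gaussian: "\<forall>i\<in>K. distributed P lborel (\<xi> i) std_normal_density"
    and indep: "prob_space.indep_vars P (\<lambda>_. borel) \<xi> K"
  shows "(\<integral>\<omega>. (\<Sum>i\<in>K. \<xi> i \<omega> * a i)\<^sup>2 \<partial>P) = (\<Sum>i\<in>K. (a i)\<^sup>2)"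
proof -
  obtain T :: "real \<Rightarrow> real" where T: "linear T" "\<And>u. (norm (adjoint T u))\<^sup>2 = (\<Sum>i\<in>K. (a i \<bullet> u)\<^sup>2)"
    "\<And>F. F \<in> borel_measurable borel \<Longrightarrow>
       (\<integral>\<^sup>+w. F (\<Sum>i\<in>K. w i *\<^sub>R a i) \<partial>PiM K (\<lambda>_. std_normal)) = (\<integral>\<^sup>+x. F (T x) \<partial>std_gaussian)"
    by (rule gaussian_reduce[OF K(1), of a]) blast
  define t where "t = T 1"
  have Tx: "T x = t * x" for x using linear_scale[OF T(1), of x 1] by (simp add: t_def mult.commute)
  have "adjoint T 1 = t" using adjoint_works[OF T(1), of 1 1] by (simp add: t_def)
  then have t2: "t\<^sup>2 = (\<Sum>i\<in>K. (a i)\<^sup>2)" using T(2)[of 1] by simp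
  let ?X = "\<lambda>\<omega>. \<Sum>i\<in>K. \<xi> i \<omega> * a i"
  \<comment> \<open>A random variable is treated as a random function on a one-point set.\<close>
  note law = law_gaussian_combination[OF P K gaussian indep, of "\<lambda>i (_::unit). a i"]
  have Xm: "?X \<in> borel_measurable P"
    using measurable_compose[OF law(1) measurable_component_singleton[of "()"]] by simp
  have sq: "(\<integral>\<^sup>+x. ennreal (x\<^sup>2) \<partial>std_normal) = 1"
  proof -
    have hb: "has_bochner_integral lborel (\<lambda>x. std_normal_density x * x ^ (2 * 1)) (fact (2 * 1) / (2 ^ 1 * fact 1))"
      by (rule std_normal_moment_even)
    have "(\<integral>\<^sup>+x. ennreal (x\<^sup>2) \<partial>std_normal) = (\<integral>\<^sup>+x. ennreal (std_normal_density x * x ^ (2 * 1)) \<partial>lborel)"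
      by (subst nn_integral_density) (auto simp: ennreal_mult')
    also have "\<dots> = ennreal (\<integral>x. std_normal_density x * x ^ (2 * 1) \<partial>lborel)"
      by (rule nn_integral_eq_integral) (use hb in \<open>auto simp: has_bochner_integral_iff\<close>)
    also have "\<dots> = 1" using hb by (simp add: has_bochner_integral_iff)
    finally show ?thesis .
  qed
  have "(\<integral>\<^sup>+\<omega>. ennreal ((?X \<omega>)\<^sup>2) \<partial>P) = (\<integral>\<^sup>+h. ennreal ((h ())\<^sup>2) \<partial>distr P path_space (\<lambda>\<omega> _. ?X \<omega>))"
    using law(1) by (subst nn_integral_distr) auto
  also have "\<dots> = (\<integral>\<^sup>+w. ennreal ((\<Sum>i\<in>K. w i *\<^sub>R a i)\<^sup>2) \<partial>PiM K (\<lambda>_. std_normal))"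
    unfolding law(2) using measurable_linear_combination[OF K(1), of "\<lambda>i (_::unit). a i"]
    by (subst nn_integral_distr) auto
  also have "\<dots> = (\<integral>\<^sup>+x. ennreal ((T x)\<^sup>2) \<partial>std_gaussian)"
    by (rule T(3)) measurable
  also have "\<dots> = (\<integral>\<^sup>+x. ennreal (t\<^sup>2) * ennreal (x\<^sup>2) \<partial>std_normal)"
    unfolding std_gaussian_real by (simp add: Tx power_mult_distrib ennreal_mult')
  also have "\<dots> = ennreal (t\<^sup>2)" by (subst nn_integral_cmult) (simp_all add: sq)
  finally have nn: "(\<integral>\<^sup>+\<omega>. ennreal ((?X \<omega>)\<^sup>2) \<partial>P) = ennreal (t\<^sup>2)" .
  have "(\<integral>\<omega>. (?X \<omega>)\<^sup>2 \<partial>P) = enn2real (\<integral>\<^sup>+\<omega>. ennreal ((?X \<omega>)\<^sup>2) \<partial>P)"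
    by (rule integral_eq_nn_integral) (use Xm in auto)
  then show ?thesis unfolding nn t2[symmetric] by simp
qed

section \<open>Measures given by densities in charts\<close>

lemma countable_subcover:
  fixes G :: "'i \<Rightarrow> 'a::second_countable_topology set"
  assumes G: "\<And>i. i \<in> J \<Longrightarrow> open (G i)" "(\<Union>i\<in>J. G i) = UNIV"
  shows "\<exists>h :: nat \<Rightarrow> 'i. (\<forall>k. h k \<in> J) \<and> (\<Union>k. G (h k)) = UNIV"
proof -
  obtain \<G> where \<G>: "\<G> \<subseteq> G ` J" "countable \<G>" "\<Union>\<G> = \<Union>(G ` J)"
    using Lindelof[of "G ` J"] G(1) by (metis (no_types, lifting) imageE)
  have ne: "\<G> \<noteq> {}" using \<G>(3) G(2) by auto
  define h where "h k = (SOME i. i \<in> J \<and> G i = from_nat_into \<G> k)" for k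
  have h: "h k \<in> J \<and> G (h k) = from_nat_into \<G> k" for k
    unfolding h_def
    by (rule someI_ex[of "\<lambda>i. i \<in> J \<and> G i = from_nat_into \<G> k"])
      (use from_nat_into[OF ne, of k] \<G>(1) in blast)
  have "(\<Union>k. G (h k)) = \<Union>\<G>" using h range_from_nat_into[OF ne \<G>(2)] by simp
  then show ?thesis using h \<G>(3) G(2) by (intro exI[of _ h]) simp
qed

text \<open>Isolates what the construction of a volume needs from a metric: continuous densities in
  the charts that change by the absolute Jacobian of the transition map.\<close>

locale chart_density = manifold_atlas A
  for A :: "('a::{t2_space,second_countable_topology}, 'm::finite) chart set" +
  fixes dens :: "('a, 'm) chart \<Rightarrow> real ^ 'm \<Rightarrow> real"
  assumes cont_dens: "c \<in> A \<Longrightarrow> continuous_on (snd c ` fst c) (dens c)"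
    and dens_change: "\<lbrakk>c \<in> A; c' \<in> A; x \<in> fst c; x \<in> fst c'\<rbrakk> \<Longrightarrow>
      dens c (snd c x) = dens c' (snd c' x) *
        \<bar>det (matrix (frechet_derivative (snd c' \<circ> chart_inv c) (at (snd c x))))\<bar>"
begin

text \<open>The constant value outside the range of the chart makes this a Borel map on the whole
  coordinate space.\<close>

definition chart_param :: "('a, 'm) chart \<Rightarrow> real ^ 'm \<Rightarrow> 'a" where
  "chart_param c z = (if z \<in> snd c ` fst c then chart_inv c z else undefined)"

definition density_on :: "('a, 'm) chart \<Rightarrow> real ^ 'm \<Rightarrow> ennreal" where
  "density_on c z = ennreal (dens c z) * indicator (snd c ` fst c) z"

definition chart_measure :: "('a, 'm) chart \<Rightarrow> 'a measure" where
  "chart_measure c = distr (density lborel (density_on c)) borel (chart_param c)"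

text \<open>The property by which \<open>riemannian_volume\<close> is described, for a general
  density in place of the root of the Gram determinant.\<close>

definition is_volume :: "'a measure \<Rightarrow> bool" where
  "is_volume \<nu> \<longleftrightarrow> sets \<nu> = sets borel \<and> (\<forall>c\<in>A. \<forall>B\<in>sets borel. B \<subseteq> fst c \<longrightarrow>
     emeasure \<nu> B = (\<integral>\<^sup>+y\<in>snd c ` B. ennreal (dens c y) \<partial>lborel))"

lemma measurable_chart_param:
  assumes "c \<in> A" shows "chart_param c \<in> borel \<rightarrow>\<^sub>M borel"
  unfolding chart_param_def[abs_def]
  by (rule borel_measurable_continuous_on_if[OF _ continuous_on_chart_inv[OF assms] continuous_on_const])
    (use open_range[OF assms] in auto)

lemma measurable_density_on:
  assumes "c \<in> A" shows "density_on c \<in> borel_measurable borel"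
proof -
  have "(\<lambda>z. if z \<in> snd c ` fst c then dens c z else 0) \<in> borel_measurable borel"
    by (rule borel_measurable_continuous_on_if[OF _ cont_dens[OF assms] continuous_on_const])
      (use open_range[OF assms] in auto)
  then have "(\<lambda>z. ennreal (if z \<in> snd c ` fst c then dens c z else 0)) \<in> borel_measurable borel" by measurable
  also have "(\<lambda>z. ennreal (if z \<in> snd c ` fst c then dens c z else 0)) = density_on c"
    by (auto simp: density_on_def fun_eq_iff)
  finally show ?thesis .
qed

lemma indicator_chart_image:
  assumes "c \<in> A" "z \<in> snd c ` fst c"
  shows "indicator (snd c ` (B \<inter> fst c)) z = indicator B (chart_inv c z)"
proof -
  have "z \<in> snd c ` (B \<inter> fst c) \<longleftrightarrow> chart_inv c z \<in> B"
    unfolding chart_image_eq[OF assms(1) Int_lower2] using assms chart_inv_mem[OF assms] by blast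
  then show ?thesis by (simp add: indicator_def)
qed

lemma nn_integral_chart_measure:
  assumes c: "c \<in> A" and F: "F \<in> borel_measurable borel"
  shows "(\<integral>\<^sup>+x. F x \<partial>chart_measure c) = (\<integral>\<^sup>+z. F (chart_inv c z) * density_on c z \<partial>lborel)"
proof -
  note [measurable] = measurable_chart_param[OF c] measurable_density_on[OF c] F
  have "(\<integral>\<^sup>+x. F x \<partial>chart_measure c) = (\<integral>\<^sup>+z. density_on c z * F (chart_param c z) \<partial>lborel)"
    unfolding chart_measure_def by (simp add: nn_integral_distr nn_integral_density)
  also have "\<dots> = (\<integral>\<^sup>+z. F (chart_inv c z) * density_on c z \<partial>lborel)"
    by (rule nn_integral_cong) (auto simp: density_on_def chart_param_def mult_ac split: split_indicator)
  finally show ?thesis .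
qed

lemma emeasure_chart_measure:
  assumes c: "c \<in> A" and B: "B \<in> sets borel"
  shows "emeasure (chart_measure c) B = (\<integral>\<^sup>+y\<in>snd c ` (B \<inter> fst c). ennreal (dens c y) \<partial>lborel)"
proof -
  have "emeasure (chart_measure c) B = (\<integral>\<^sup>+x. indicator B x \<partial>chart_measure c)"
    using B by (simp add: chart_measure_def)
  also have "\<dots> = (\<integral>\<^sup>+z. indicator B (chart_inv c z) * density_on c z \<partial>lborel)"
    by (rule nn_integral_chart_measure[OF c]) (use B in auto)
  also have "\<dots> = (\<integral>\<^sup>+y\<in>snd c ` (B \<inter> fst c). ennreal (dens c y) \<partial>lborel)"
  proof (rule nn_integral_cong)
    fix z
    show "indicator B (chart_inv c z) * density_on c z = ennreal (dens c z) * indicator (snd c ` (B \<inter> fst c)) z"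
    proof (cases "z \<in> snd c ` fst c")
      case True
      then show ?thesis using indicator_chart_image[OF c True, of B, where 'b = ennreal]
        by (simp add: density_on_def mult.commute)
    next
      case False
      then have "z \<notin> snd c ` (B \<inter> fst c)" by blast
      then show ?thesis using False by (simp add: density_on_def)
    qed
  qed
  finally show ?thesis .
qed

lemma sets_chart_measure [simp]: "sets (chart_measure c) = sets borel"
  by (simp add: chart_measure_def)

text \<open>Change of variables along the transition map, whose Jacobian is absorbed by
  \<open>dens_change\<close>.\<close>

lemma chart_measure_overlap:
  assumes c: "c \<in> A" and c': "c' \<in> A" and B: "B \<in> sets borel" "B \<subseteq> fst c" "B \<subseteq> fst c'"
  shows "emeasure (chart_measure c) B = emeasure (chart_measure c') B"
proof -
  let ?U = "snd c ` (fst c \<inter> fst c')"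
  define h where "h = snd c' \<circ> chart_inv c"
  define g where "g = snd c \<circ> chart_inv c'"
  define J where "J z = matrix (frechet_derivative h (at z))" for z
  have U: "open ?U" by (rule open_chart_image[OF c open_fst[OF c']])
  have hx: "h (snd c x) = snd c' x" if "x \<in> fst c" for x using c that by (simp add: h_def)
  have hU: "h ` ?U = snd c' ` (fst c' \<inter> fst c)"
  proof -
    have "h ` ?U = (\<lambda>x. h (snd c x)) ` (fst c \<inter> fst c')" by (simp add: image_image)
    also have "\<dots> = snd c' ` (fst c \<inter> fst c')" by (rule image_cong) (auto simp: hx)
    finally show ?thesis by (simp add: Int_commute)
  qed
  have ohU: "open (h ` ?U)" unfolding hU by (rule open_chart_image[OF c' open_fst[OF c]])
  have hom: "homeomorphism ?U (h ` ?U) h g"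
  proof (rule homeomorphismI)
    show "continuous_on ?U h"
      unfolding h_def by (rule smooth_on_imp_continuous_on[OF smooth_transition[OF c c']])
    show "continuous_on (h ` ?U) g"
      unfolding hU g_def by (rule smooth_on_imp_continuous_on[OF smooth_transition[OF c' c]])
    show "h ` ?U \<subseteq> h ` ?U" ..
    show "g ` (h ` ?U) \<subseteq> ?U" unfolding hU g_def using c' by auto
    show "g (h z) = z" if "z \<in> ?U" for z using that c c' by (auto simp: g_def h_def)
    show "h (g y) = y" if "y \<in> h ` ?U" for y using that c c' unfolding hU by (auto simp: g_def h_def)
  qed
  have der: "(h has_derivative (\<lambda>v. J z *v v)) (at z)" if "z \<in> ?U" for z
  proof -
    have d: "(h has_derivative frechet_derivative h (at z)) (at z)"
      unfolding h_def by (rule has_derivative_transition[OF c c' that])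
    then have "linear (frechet_derivative h (at z))" by (rule has_derivative_linear)
    then have "J z *v v = frechet_derivative h (at z) v" for v
      unfolding J_def by (intro matrix_works) (simp add: linear_matrix_vector_mul_eq)
    then show ?thesis using d by simp
  qed
  have cJ: "continuous_on ?U J"
    unfolding J_def matrix_def h_def
    by (intro continuous_on_vec_lambda continuous_intros smooth_on_imp_continuous_derivative[OF smooth_transition[OF c c']])
  define F where "F y = indicator B (chart_param c' y) * density_on c' y" for y
  have F: "F \<in> borel_measurable borel"
    using measurable_chart_param[OF c'] measurable_density_on[OF c'] B(1) unfolding F_def by measurable
  have "emeasure (chart_measure c') B = (\<integral>\<^sup>+y\<in>snd c' ` (B \<inter> fst c'). ennreal (dens c' y) \<partial>lborel)"
    by (rule emeasure_chart_measure[OF c' B(1)])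
  also have "\<dots> = (\<integral>\<^sup>+y. F y * indicator (h ` ?U) y \<partial>lborel)"
  proof (rule nn_integral_cong)
    fix y
    show "ennreal (dens c' y) * indicator (snd c' ` (B \<inter> fst c')) y = F y * indicator (h ` ?U) y"
    proof (cases "y \<in> snd c' ` fst c'")
      case True
      have "y \<in> h ` ?U" if "chart_inv c' y \<in> B"
        unfolding hU chart_image_eq[OF c' Int_lower1] using that True B by auto
      then show ?thesis
        using True indicator_chart_image[OF c' True, of B, where 'b = ennreal]
        by (cases "chart_inv c' y \<in> B") (simp_all add: F_def chart_param_def density_on_def)
    next
      case False
      then have "y \<notin> snd c' ` (B \<inter> fst c')" by blast
      then show ?thesis using False by (simp add: F_def density_on_def)
    qed
  qed
  also have "\<dots> = (\<integral>\<^sup>+z. F (h z) * ennreal \<bar>det (J z)\<bar> * indicator ?U z \<partial>lborel)"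
    by (rule change_of_variables_homeomorphism[OF U ohU hom der cJ F])
  also have "\<dots> = (\<integral>\<^sup>+z\<in>snd c ` (B \<inter> fst c). ennreal (dens c z) \<partial>lborel)"
  proof (rule nn_integral_cong)
    fix z
    show "F (h z) * ennreal \<bar>det (J z)\<bar> * indicator ?U z = ennreal (dens c z) * indicator (snd c ` (B \<inter> fst c)) z"
    proof (cases "z \<in> ?U")
      case True
      then obtain x where x: "x \<in> fst c" "x \<in> fst c'" "z = snd c x" by blast
      have "dens c z = dens c' (snd c' x) * \<bar>det (J z)\<bar>"
        unfolding J_def h_def x(3) by (rule dens_change[OF c c' x(1,2)])
      moreover have "z \<in> snd c ` (B \<inter> fst c) \<longleftrightarrow> x \<in> B"
        using x inj_on_chart[OF c] by (auto dest: inj_onD)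
      ultimately show ?thesis
        using True x c c' by (simp add: F_def hx chart_param_def density_on_def ennreal_mult'' indicator_def)
    next
      case False
      then have "z \<notin> snd c ` (B \<inter> fst c)" using B by blast
      then show ?thesis using False by simp
    qed
  qed
  also have "\<dots> = emeasure (chart_measure c) B"
    by (rule emeasure_chart_measure[OF c B(1), symmetric])
  finally show ?thesis by simp
qed

lemma countable_charts:
  "\<exists>ch :: nat \<Rightarrow> ('a, 'm) chart. (\<forall>k. ch k \<in> A) \<and> (\<Union>k. fst (ch k)) = UNIV"
  by (rule countable_subcover) (use open_fst ex_chart in blast)+

lemma disjointed_domain_measurable:
  assumes "\<And>k. ch k \<in> A"
  shows "disjointed (\<lambda>k. fst (ch k)) k \<in> sets borel"
proof -
  have "range (\<lambda>k. fst (ch k)) \<subseteq> sets borel"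
    by (rule image_subsetI) (rule borel_open, rule open_fst, rule assms)
  then have "range (disjointed (\<lambda>k. fst (ch k))) \<subseteq> sets borel"
    by (rule sets.range_disjointed_sets)
  then show ?thesis by (rule subsetD) (rule rangeI)
qed

text \<open>A Borel set is cut into countably many disjoint pieces, each inside one chart. Both
  measures are prescribed on every piece, and countable additivity adds up the values, finite or
  not.\<close>

lemma is_volume_unique:
  assumes "is_volume \<mu>" "is_volume \<nu>" shows "\<mu> = \<nu>"
proof (rule measure_eqI)
  show "sets \<mu> = sets \<nu>" using assms by (simp add: is_volume_def)
  fix B assume "B \<in> sets \<mu>"
  then have B: "B \<in> sets borel" using assms(1) by (simp add: is_volume_def)
  obtain ch :: "nat \<Rightarrow> ('a, 'm) chart" where "(\<forall>k. ch k \<in> A) \<and> (\<Union>k. fst (ch k)) = UNIV"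
    using countable_charts by blast
  then have ch: "\<And>k. ch k \<in> A" "(\<Union>k. fst (ch k)) = UNIV" by simp_all
  define D where "D = disjointed (\<lambda>k. fst (ch k))"
  have D: "D k \<in> sets borel" "D k \<subseteq> fst (ch k)" for k
  proof -
    show "D k \<in> sets borel" unfolding D_def by (rule disjointed_domain_measurable[OF ch(1)])
    show "D k \<subseteq> fst (ch k)" unfolding D_def by (rule disjointed_subset)
  qed
  have disj: "disjoint_family (\<lambda>k. B \<inter> D k)"
    using disjoint_family_disjointed[of "\<lambda>k. fst (ch k)"] unfolding D_def disjoint_family_on_def by blast
  have un: "(\<Union>k. B \<inter> D k) = B"
    using UN_disjointed_eq[of "\<lambda>k. fst (ch k)"] ch(2) by (simp add: D_def flip: Int_UN_distrib)
  have piece: "emeasure \<mu> (B \<inter> D k) = emeasure \<nu> (B \<inter> D k)" for k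
  proof -
    have "B \<inter> D k \<in> sets borel" "B \<inter> D k \<subseteq> fst (ch k)" using B D by auto
    then show ?thesis using assms ch(1)[of k] unfolding is_volume_def by simp
  qed
  have rng: "range (\<lambda>k. B \<inter> D k) \<subseteq> sets borel"
    by (rule image_subsetI) (rule sets.Int[OF B D(1)])
  have "emeasure \<mu> B = (\<Sum>k. emeasure \<mu> (B \<inter> D k))"
    using suminf_emeasure[of "\<lambda>k. B \<inter> D k" \<mu>] disj un rng assms(1) by (simp add: is_volume_def)
  also have "\<dots> = emeasure \<nu> B"
    unfolding piece using suminf_emeasure[of "\<lambda>k. B \<inter> D k" \<nu>] disj un rng assms(2) by (simp add: is_volume_def)
  finally show "emeasure \<mu> B = emeasure \<nu> B" .
qed

text \<open>The measures of countably many charts are glued along a disjoint decomposition of the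
  manifold. The result has the right values in every chart, not only in the chosen ones, because
  chart measures agree on overlaps.\<close>

lemma ex_is_volume: "\<exists>\<nu>. is_volume \<nu>"
proof -
  obtain ch :: "nat \<Rightarrow> ('a, 'm) chart" where "(\<forall>k. ch k \<in> A) \<and> (\<Union>k. fst (ch k)) = UNIV"
    using countable_charts by blast
  then have ch: "\<And>k. ch k \<in> A" "(\<Union>k. fst (ch k)) = UNIV" by simp_all
  define D where "D = disjointed (\<lambda>k. fst (ch k))"
  have D: "D k \<in> sets borel" "D k \<subseteq> fst (ch k)" for k
  proof -
    show "D k \<in> sets borel" unfolding D_def by (rule disjointed_domain_measurable[OF ch(1)])
    show "D k \<subseteq> fst (ch k)" unfolding D_def by (rule disjointed_subset)
  qed
  have disjD: "disjoint_family D" unfolding D_def by (rule disjoint_family_disjointed)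
  have unD: "(\<Union>k. D k) = UNIV" using UN_disjointed_eq[of "\<lambda>k. fst (ch k)"] ch(2) by (simp add: D_def)
  \<comment> \<open>The sum over the pieces is written as an integral so that it can be exchanged
    with the series in countable additivity.\<close>
  define \<mu> where "\<mu> B = (\<integral>\<^sup>+k. emeasure (chart_measure (ch k)) (B \<inter> D k) \<partial>count_space (UNIV :: nat set))" for B
  define \<nu> where "\<nu> = measure_of UNIV (sets borel) \<mu>"
  have sets: "sets \<nu> = sets borel"
    unfolding \<nu>_def using sets.sets_measure_of_eq[of borel] by simp
  have em: "emeasure \<nu> B = \<mu> B" if B: "B \<in> sets borel" for B
    unfolding \<nu>_def
  proof (rule emeasure_measure_of_sigma)
    show "sigma_algebra UNIV (sets (borel :: 'a measure))"
      using sets.sigma_algebra_axioms[of "borel :: 'a measure"] by simp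
    show "positive (sets borel) \<mu>" by (simp add: positive_def \<mu>_def)
    show "countably_additive (sets borel) \<mu>"
    proof (rule countably_additiveI)
      fix S :: "nat \<Rightarrow> 'a set" assume S: "range S \<subseteq> sets borel" "disjoint_family S"
      have "(\<Sum>i. \<mu> (S i)) = (\<integral>\<^sup>+k. (\<Sum>i. emeasure (chart_measure (ch k)) (S i \<inter> D k)) \<partial>count_space UNIV)"
        unfolding \<mu>_def by (rule nn_integral_suminf[symmetric]) simp
      also have "\<dots> = (\<integral>\<^sup>+k. emeasure (chart_measure (ch k)) ((\<Union>i. S i) \<inter> D k) \<partial>count_space UNIV)"
      proof (rule nn_integral_cong)
        fix k
        have "disjoint_family (\<lambda>i. S i \<inter> D k)" using S(2) unfolding disjoint_family_on_def by blast
        moreover have "range (\<lambda>i. S i \<inter> D k) \<subseteq> sets (chart_measure (ch k))" using S(1) D(1)[of k] by auto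
        ultimately have "(\<Sum>i. emeasure (chart_measure (ch k)) (S i \<inter> D k)) = emeasure (chart_measure (ch k)) (\<Union>i. S i \<inter> D k)"
          by (intro suminf_emeasure)
        then show "(\<Sum>i. emeasure (chart_measure (ch k)) (S i \<inter> D k)) = emeasure (chart_measure (ch k)) ((\<Union>i. S i) \<inter> D k)"
          by (simp add: Int_UN_distrib2)
      qed
      finally show "(\<Sum>i. \<mu> (S i)) = \<mu> (\<Union> (range S))" unfolding \<mu>_def .
    qed
  qed (rule B)
  have "is_volume \<nu>"
    unfolding is_volume_def
  proof (intro conjI ballI impI)
    show "sets \<nu> = sets borel" by (rule sets)
    fix c B assume c: "c \<in> A" and B: "B \<in> sets borel" "B \<subseteq> fst c"
    have "emeasure \<nu> B = (\<Sum>k. emeasure (chart_measure (ch k)) (B \<inter> D k))"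
      unfolding em[OF B(1)] \<mu>_def by (rule nn_integral_count_space_nat)
    also have "\<dots> = (\<Sum>k. emeasure (chart_measure c) (B \<inter> D k))"
    proof (rule suminf_cong)
      fix k
      show "emeasure (chart_measure (ch k)) (B \<inter> D k) = emeasure (chart_measure c) (B \<inter> D k)"
        by (rule chart_measure_overlap[OF ch(1) c]) (use B D in auto)
    qed
    also have "\<dots> = emeasure (chart_measure c) (\<Union>k. B \<inter> D k)"
    proof (rule suminf_emeasure)
      show "range (\<lambda>k. B \<inter> D k) \<subseteq> sets (chart_measure c)"
        unfolding sets_chart_measure by (rule image_subsetI) (rule sets.Int[OF B(1) D(1)])
      show "disjoint_family (\<lambda>k. B \<inter> D k)"
        using disjD unfolding disjoint_family_on_def by blast
    qed
    also have "(\<Union>k. B \<inter> D k) = B \<inter> fst c" using B(2) unD by (auto simp flip: Int_UN_distrib)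
    also have "emeasure (chart_measure c) (B \<inter> fst c) = (\<integral>\<^sup>+y\<in>snd c ` B. ennreal (dens c y) \<partial>lborel)"
      using B emeasure_chart_measure[OF c B(1)] by (simp add: Int_absorb2)
    finally show "emeasure \<nu> B = (\<integral>\<^sup>+y\<in>snd c ` B. ennreal (dens c y) \<partial>lborel)" .
  qed
  then show ?thesis by blast
qed

lemma nn_integral_volume:
  assumes \<nu>: "is_volume \<nu>" and c: "c \<in> A" and S: "S \<in> sets borel" "S \<subseteq> fst c"
    and F: "F \<in> borel_measurable borel"
  shows "(\<integral>\<^sup>+x\<in>S. F x \<partial>\<nu>) = (\<integral>\<^sup>+z\<in>snd c ` S. F (chart_inv c z) * ennreal (dens c z) \<partial>lborel)"
proof -
  have sets: "sets \<nu> = sets borel" using \<nu> by (simp add: is_volume_def)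
  have dom: "fst c \<in> sets borel" using open_fst[OF c] by simp
  note m = measurable_cong_sets[OF sets refl]
  have eq: "density \<nu> (indicator (fst c)) = chart_measure c"
  proof (rule measure_eqI)
    fix B assume "B \<in> sets (density \<nu> (indicator (fst c)))"
    then have B: "B \<in> sets borel" by (simp add: sets)
    have "emeasure (density \<nu> (indicator (fst c))) B = (\<integral>\<^sup>+x. indicator (fst c) x * indicator B x \<partial>\<nu>)"
      by (rule emeasure_density) (use B dom in \<open>auto simp: sets m\<close>)
    also have "\<dots> = (\<integral>\<^sup>+x. indicator (B \<inter> fst c) x \<partial>\<nu>)"
      by (rule nn_integral_cong) (auto split: split_indicator)
    also have "\<dots> = emeasure \<nu> (B \<inter> fst c)" using B dom by (simp add: sets)
    also have "\<dots> = (\<integral>\<^sup>+y\<in>snd c ` (B \<inter> fst c). ennreal (dens c y) \<partial>lborel)"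
      using \<nu> c B dom unfolding is_volume_def by simp
    also have "\<dots> = emeasure (chart_measure c) B" by (rule emeasure_chart_measure[OF c B, symmetric])
    finally show "emeasure (density \<nu> (indicator (fst c))) B = emeasure (chart_measure c) B" .
  qed (simp add: sets)
  have "(\<integral>\<^sup>+x\<in>S. F x \<partial>\<nu>) = (\<integral>\<^sup>+x. indicator (fst c) x * (F x * indicator S x) \<partial>\<nu>)"
    by (rule nn_integral_cong) (use S(2) in \<open>auto split: split_indicator\<close>)
  also have "\<dots> = (\<integral>\<^sup>+x. F x * indicator S x \<partial>chart_measure c)"
    unfolding eq[symmetric] using F S dom by (subst nn_integral_density) (auto simp: m)
  also have "\<dots> = (\<integral>\<^sup>+z. (F (chart_inv c z) * indicator S (chart_inv c z)) * density_on c z \<partial>lborel)"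
    by (rule nn_integral_chart_measure[OF c]) (use F S in auto)
  also have "\<dots> = (\<integral>\<^sup>+z\<in>snd c ` S. F (chart_inv c z) * ennreal (dens c z) \<partial>lborel)"
  proof (rule nn_integral_cong)
    fix z
    show "(F (chart_inv c z) * indicator S (chart_inv c z)) * density_on c z =
        F (chart_inv c z) * ennreal (dens c z) * indicator (snd c ` S) z"
    proof (cases "z \<in> snd c ` fst c")
      case True
      then show ?thesis using indicator_chart_image[OF c True, of S, where 'b = ennreal] S(2)
        by (simp add: density_on_def mult_ac Int_absorb2)
    next
      case False
      then have "z \<notin> snd c ` S" using S(2) by blast
      then show ?thesis using False by (simp add: density_on_def)
    qed
  qed
  finally show ?thesis .
qed

end

text \<open>The Adler--Taylor form at one point, computed from values \<open>y i\<close> and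
  gradients \<open>a i\<close>. It is the round metric of projective space pulled back along the map
  whose homogeneous coordinates are the functions, hence the name.\<close>

definition projective_form :: "'i set \<Rightarrow> ('i \<Rightarrow> real) \<Rightarrow> ('i \<Rightarrow> real ^ 'm::finite) \<Rightarrow> real ^ 'm \<Rightarrow> real" where
  "projective_form K y a w = (\<Sum>i\<in>K. (a i \<bullet> w)\<^sup>2) / (\<Sum>i\<in>K. (y i)\<^sup>2) -
     (\<Sum>i\<in>K. y i * (a i \<bullet> w))\<^sup>2 / (\<Sum>i\<in>K. (y i)\<^sup>2)\<^sup>2"

lemma projective_form_factor:
  fixes a :: "'i \<Rightarrow> real ^ 'm::finite"
  assumes K: "finite K" and pos: "(\<Sum>i\<in>K. (y i)\<^sup>2) > 0"
  obtains M :: "real ^ 'm ^ 'm" where "projective_form K y a = (\<lambda>w. (norm (M *v w))\<^sup>2)"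
proof -
  define S where "S = (\<Sum>i\<in>K. (y i)\<^sup>2)"
  \<comment> \<open>The gradient of the component \<open>y i / sqrt S\<close> of the normalised
    vector; the form is the sum of the squares of these linear forms.\<close>
  define b where "b i = (1 / sqrt S) *\<^sub>R (a i - (y i / S) *\<^sub>R (\<Sum>j\<in>K. y j *\<^sub>R a j))" for i
  obtain M :: "real ^ 'm ^ 'm" where M: "\<And>w. (norm (M *v w))\<^sup>2 = (\<Sum>i\<in>K. (b i \<bullet> w)\<^sup>2)"
    by (rule quadratic_form_factor[OF K, of b]) (rule that)
  have "projective_form K y a w = (norm (M *v w))\<^sup>2" for w
  proof -
    define s where "s = (\<Sum>j\<in>K. y j * (a j \<bullet> w))"
    have S: "S > 0" using pos by (simp add: S_def)
    have "(norm (M *v w))\<^sup>2 = (\<Sum>i\<in>K. (1 / S) * (a i \<bullet> w - y i / S * s)\<^sup>2)"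
      unfolding M b_def s_def
      by (rule sum.cong) (use S in \<open>simp_all add: inner_diff_left inner_sum_left power_mult_distrib power_divide\<close>)
    also have "\<dots> = (1 / S) * (\<Sum>i\<in>K. (a i \<bullet> w)\<^sup>2 - 2 * s / S * (y i * (a i \<bullet> w)) + s\<^sup>2 / S\<^sup>2 * (y i)\<^sup>2)"
      unfolding sum_distrib_left[symmetric]
      by (rule arg_cong[where f = "\<lambda>u. 1 / S * u"], rule sum.cong) (use S in \<open>simp_all add: power2_eq_square field_simps\<close>)
    also have "\<dots> = (1 / S) * ((\<Sum>i\<in>K. (a i \<bullet> w)\<^sup>2) - 2 * s / S * s + s\<^sup>2 / S\<^sup>2 * S)"
      by (simp only: sum.distrib sum_subtractf sum_distrib_left[symmetric] s_def[symmetric] S_def[symmetric])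
    also have "\<dots> = projective_form K y a w"
      unfolding projective_form_def S_def[symmetric] s_def[symmetric]
      using S by (simp add: field_simps power2_eq_square)
    finally show ?thesis ..
  qed
  then show thesis by (intro that[of M]) auto
qed

text \<open>With \<open>y k\<close> and \<open>a k\<close> the value and gradient of
  \<open>f0\<close>, the quotient by \<open>S\<close> inside the square is the moment map in
  coordinates, so the squared expression is \<open>tau\<close>.\<close>

lemma projective_form_insert:
  fixes a :: "'i \<Rightarrow> real ^ 'm::finite"
  assumes K: "finite K" "k \<notin> K" and pos: "(\<Sum>i\<in>K. (y i)\<^sup>2) > 0"
  defines "S \<equiv> \<Sum>i\<in>K. (y i)\<^sup>2"
  shows "projective_form (insert k K) y a w = S / (S + (y k)\<^sup>2) * (projective_form K y a w +
    (1 / sqrt (S + (y k)\<^sup>2) * (y k * ((\<Sum>i\<in>K. y i * (a i \<bullet> w)) / S) - a k \<bullet> w))\<^sup>2)"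
proof -
  define s where "s = (\<Sum>i\<in>K. y i * (a i \<bullet> w))"
  define r where "r = (\<Sum>i\<in>K. (a i \<bullet> w)\<^sup>2)"
  define \<delta> where "\<delta> = a k \<bullet> w"
  define K0 where "K0 = S + (y k)\<^sup>2"
  have S: "S > 0" using pos by (simp add: S_def)
  have K0: "K0 > 0" using S by (simp add: K0_def add_pos_nonneg)
  have ins: "(\<Sum>i\<in>insert k K. (y i)\<^sup>2) = K0" "(\<Sum>i\<in>insert k K. y i * (a i \<bullet> w)) = s + y k * \<delta>"
     "(\<Sum>i\<in>insert k K. (a i \<bullet> w)\<^sup>2) = r + \<delta>\<^sup>2"
    using K by (simp_all add: K0_def S_def s_def r_def \<delta>_def)
  have "(r + \<delta>\<^sup>2) / K0 - (s + y k * \<delta>)\<^sup>2 / K0\<^sup>2 =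
      S / K0 * ((r / S - s\<^sup>2 / S\<^sup>2) + (1 / K0) * (y k * (s / S) - \<delta>)\<^sup>2)"
  proof -
    \<comment> \<open>Multiplication by \<open>K0\<^sup>2 * S\<close> clears the denominators; what
      remains is a polynomial identity once \<open>K0\<close> is replaced by
      \<open>S + (y k)\<^sup>2\<close>.\<close>
    have "K0\<^sup>2 * S * ((r + \<delta>\<^sup>2) / K0 - (s + y k * \<delta>)\<^sup>2 / K0\<^sup>2) = S * (K0 * (r + \<delta>\<^sup>2) - (s + y k * \<delta>)\<^sup>2)"
      using S K0 by (simp add: field_simps power2_eq_square)
    also have "\<dots> = K0 * (r * S - s\<^sup>2) + (y k * s - \<delta> * S)\<^sup>2"
      unfolding K0_def by algebra
    also have "\<dots> = K0\<^sup>2 * S * (S / K0 * ((r / S - s\<^sup>2 / S\<^sup>2) + (1 / K0) * (y k * (s / S) - \<delta>)\<^sup>2))"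
      using S K0 by (simp add: field_simps power2_eq_square)
    finally have "K0\<^sup>2 * S * ((r + \<delta>\<^sup>2) / K0 - (s + y k * \<delta>)\<^sup>2 / K0\<^sup>2) =
      K0\<^sup>2 * S * (S / K0 * ((r / S - s\<^sup>2 / S\<^sup>2) + (1 / K0) * (y k * (s / S) - \<delta>)\<^sup>2))" .
    moreover have "K0\<^sup>2 * S \<noteq> 0" using S K0 by simp
    ultimately show ?thesis by (rule mult_left_cancel[THEN iffD1, rotated])
  qed
  then show ?thesis
    using K0 unfolding projective_form_def ins S_def[symmetric] s_def[symmetric] r_def[symmetric] \<delta>_def[symmetric] K0_def[symmetric]
    by (simp add: power_mult_distrib power_divide)
qed

lemma continuous_on_det_projective_form:
  fixes a :: "'i \<Rightarrow> 'z::topological_space \<Rightarrow> real ^ 'm::finite"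
  assumes y: "\<And>i. i \<in> K \<Longrightarrow> continuous_on U (y i)" and a: "\<And>i. i \<in> K \<Longrightarrow> continuous_on U (a i)"
    and pos: "\<And>z. z \<in> U \<Longrightarrow> (\<Sum>i\<in>K. (y i z)\<^sup>2) > 0"
  shows "continuous_on U (\<lambda>z. det (polar_matrix (projective_form K (\<lambda>i. y i z) (\<lambda>i. a i z))))"
proof -
  have [continuous_intros]: "continuous_on U (\<lambda>z. projective_form K (\<lambda>i. y i z) (\<lambda>i. a i z) w)" for w
    unfolding projective_form_def
    by (intro continuous_intros y a ballI) (auto dest: pos)
  show ?thesis
    unfolding polar_matrix_def by (intro continuous_on_det continuous_on_vec_lambda continuous_intros) auto
qed

section \<open>Gaussian random functions on a manifold\<close>

context manifold_atlas begin

lemma grad_sum: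
  assumes f: "\<And>i. i \<in> K \<Longrightarrow> smooth_fun A (f i)" and c: "c \<in> A" and z: "z \<in> snd c ` fst c"
  shows "grad c (\<lambda>x. \<Sum>i\<in>K. a i * f i x) z \<bullet> w = (\<Sum>i\<in>K. a i * (grad c (f i) z \<bullet> w))"
proof -
  have 1: "((\<lambda>z. \<Sum>i\<in>K. a i * f i (chart_inv c z)) has_derivative
      (\<lambda>v. grad c (\<lambda>x. \<Sum>i\<in>K. a i * f i x) z \<bullet> v)) (at z)"
    by (rule has_derivative_grad[OF smooth_fun_sum[OF f] c z])
  have 2: "((\<lambda>z. \<Sum>i\<in>K. a i * f i (chart_inv c z)) has_derivative
      (\<lambda>v. \<Sum>i\<in>K. a i * (grad c (f i) z \<bullet> v))) (at z)"
    by (rule has_derivative_sum) (rule has_derivative_mult_right, rule has_derivative_grad[OF f c z])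
  show ?thesis by (rule fun_cong[OF has_derivative_unique[OF 1 2]])
qed

end

locale gaussian_field = manifold_atlas A
  for A :: "('a::{t2_space,second_countable_topology}, 'm::finite) chart set" +
  fixes I :: "nat set" and f :: "nat \<Rightarrow> 'a \<Rightarrow> real" and P :: "'w measure" and \<xi> :: "nat \<Rightarrow> 'w \<Rightarrow> real"
  assumes finite_I: "finite I" and smooth: "i \<in> I \<Longrightarrow> smooth_fun A (f i)"
    and no_zero: "\<exists>i\<in>I. f i x \<noteq> 0" and prob: "prob_space P"
    and gaussian: "\<forall>i\<in>I. distributed P lborel (\<xi> i) std_normal_density"
    and indep: "prob_space.indep_vars P (\<lambda>_. borel) \<xi> I"
    and nondeg: "nondegenerate A P (\<lambda>\<omega> x. \<Sum>i\<in>I. \<xi> i \<omega> * f i x)"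
begin

definition X :: "'w \<Rightarrow> 'a \<Rightarrow> real" where "X \<omega> x = (\<Sum>i\<in>I. \<xi> i \<omega> * f i x)"

abbreviation S :: "'a \<Rightarrow> real" where "S x \<equiv> \<Sum>i\<in>I. (f i x)\<^sup>2"

text \<open>The index set is a parameter: \<open>I\<close> gives the metric of \<open>X\<close>, and
  one more index gives that of the enlarged random function, in the same charts.\<close>

definition form :: "nat set \<Rightarrow> ('a, 'm) chart \<Rightarrow> real ^ 'm \<Rightarrow> real ^ 'm \<Rightarrow> real" where
  "form K c z = projective_form K (\<lambda>i. f i (chart_inv c z)) (\<lambda>i. grad c (f i) z)"

lemma I_nonempty: "I \<noteq> {}" using no_zero by auto

lemma S_pos: "S x > 0"
proof -
  obtain i where "i \<in> I" "f i x \<noteq> 0" using no_zero by blast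
  then show ?thesis by (intro sum_pos2[OF finite_I]) auto
qed

lemma second_moment_X: "second_moment P X x = S x"
  unfolding second_moment_def X_def
  by (rule second_moment_gaussian_combination[OF prob finite_I I_nonempty gaussian indep])

lemma X_chart_vector:
  assumes c: "c \<in> A" "x \<in> fst c"
  shows "differential (X \<omega>) (chart_vector A c x w) = (\<Sum>i\<in>I. \<xi> i \<omega> * (grad c (f i) (snd c x) \<bullet> w))"
proof -
  have "differential (X \<omega>) (chart_vector A c x w) = grad c (X \<omega>) (snd c x) \<bullet> w"
    unfolding differential_def X_def
    by (rule chart_vector_apply[OF smooth_fun_sum[OF smooth] c])
  also have "\<dots> = (\<Sum>i\<in>I. \<xi> i \<omega> * (grad c (f i) (snd c x) \<bullet> w))"
    unfolding X_def by (rule grad_sum[OF smooth c(1)]) (use c in auto)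
  finally show ?thesis .
qed

lemma moment_map_chart_vector:
  assumes c: "c \<in> A" "x \<in> fst c"
  shows "moment_map P X (chart_vector A c x w) = (\<Sum>i\<in>I. f i x * (grad c (f i) (snd c x) \<bullet> w)) / S x"
proof -
  define h where "h y = 1 / 2 * ln (S y)" for y
  have "smooth_on (snd c ` fst c) (\<lambda>z. 1 / 2 * ln (\<Sum>i\<in>I. (f i \<circ> chart_inv c) z * (f i \<circ> chart_inv c) z))"
    if c: "c \<in> A" for c
    by (intro smooth_on_mult smooth_on_const smooth_on_ln smooth_on_sum open_range c smooth_funD smooth)
      (use S_pos in \<open>simp_all add: power2_eq_square\<close>)
  then have h: "smooth_fun A h"
    by (intro smooth_funI) (simp add: h_def o_def power2_eq_square)
  have z: "snd c x \<in> snd c ` fst c" using c by blast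
  have "((\<lambda>z. h (chart_inv c z)) has_derivative
      (\<lambda>v. 1 / 2 * ((\<Sum>i\<in>I. 2 * (f i x * (grad c (f i) (snd c x) \<bullet> v))) / S x))) (at (snd c x))"
  proof -
    have "((\<lambda>z. (f i (chart_inv c z))\<^sup>2) has_derivative (\<lambda>v. 2 * (f i x * (grad c (f i) (snd c x) \<bullet> v)))) (at (snd c x))"
      if "i \<in> I" for i
      using has_derivative_mult[OF has_derivative_grad[OF smooth[OF that] c(1) z] has_derivative_grad[OF smooth[OF that] c(1) z]]
      by (rule back_subst[of "\<lambda>(g, g'). (g has_derivative g') (at (snd c x))" "(_, _)" "(_, _)", unfolded prod.case])
        (use c in \<open>auto simp: power2_eq_square fun_eq_iff\<close>)
    then have "((\<lambda>z. S (chart_inv c z)) has_derivative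
        (\<lambda>v. \<Sum>i\<in>I. 2 * (f i x * (grad c (f i) (snd c x) \<bullet> v)))) (at (snd c x))"
      by (rule has_derivative_sum)
    then have "((\<lambda>z. ln (S (chart_inv c z))) has_derivative
        (\<lambda>v. (\<Sum>i\<in>I. 2 * (f i x * (grad c (f i) (snd c x) \<bullet> v))) * inverse (S x))) (at (snd c x))"
      using has_derivative_ln[of "\<lambda>z. S (chart_inv c z)" "snd c x" _ UNIV] S_pos[of x] c by simp
    then show ?thesis unfolding h_def
      by (intro has_derivative_mult_right) (simp add: divide_inverse)
  qed
  from has_derivative_unique[OF has_derivative_grad[OF h c(1) z] this]
  have "grad c h (snd c x) \<bullet> w = (\<Sum>i\<in>I. f i x * (grad c (f i) (snd c x) \<bullet> w)) / S x"
    by (simp add: fun_eq_iff sum_distrib_left[symmetric])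
  moreover have "moment_map P X (chart_vector A c x w) = chart_vector A c x w h"
    unfolding moment_map_def differential_def second_moment_X h_def[abs_def] ..
  ultimately show ?thesis using chart_vector_apply[OF h c] by simp
qed

lemma metric_chart_vector:
  assumes c: "c \<in> A" "x \<in> fst c"
  shows "adler_taylor_metric P X x (chart_vector A c x w) = form I c (snd c x) w"
proof -
  have "(\<integral>\<omega>. (differential (X \<omega>) (chart_vector A c x w))\<^sup>2 \<partial>P) = (\<Sum>i\<in>I. (grad c (f i) (snd c x) \<bullet> w)\<^sup>2)"
    unfolding X_chart_vector[OF c]
    by (rule second_moment_gaussian_combination[OF prob finite_I I_nonempty gaussian indep])
  then show ?thesis
    unfolding adler_taylor_metric_def second_moment_X moment_map_chart_vector[OF c] form_def projective_form_def
    using c by (simp add: power_divide)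
qed

text \<open>Non-degeneracy enters here: a nonzero vector in the kernel of \<open>M\<close> would
  give a tangent vector of length 0, and this tangent vector is nonzero by
  \<open>chart_vector_nonzero\<close>.\<close>

lemma form_factor:
  assumes c: "c \<in> A" "x \<in> fst c"
  obtains M :: "real ^ 'm ^ 'm" where "form I c (snd c x) = (\<lambda>w. (norm (M *v w))\<^sup>2)" "det M \<noteq> 0"
proof -
  obtain M :: "real ^ 'm ^ 'm" where
    "projective_form I (\<lambda>i. f i (chart_inv c (snd c x))) (\<lambda>i. grad c (f i) (snd c x)) = (\<lambda>w. (norm (M *v w))\<^sup>2)"
    by (rule projective_form_factor[OF finite_I, of "\<lambda>i. f i (chart_inv c (snd c x))" "\<lambda>i. grad c (f i) (snd c x)"])
      (rule S_pos, rule that)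
  then have M: "form I c (snd c x) = (\<lambda>w. (norm (M *v w))\<^sup>2)" by (simp only: form_def)
  have "w = 0" if "M *v w = 0" for w
  proof (rule ccontr)
    assume w: "w \<noteq> 0"
    have "chart_vector A c x w \<in> tangent_space A x" unfolding tangent_space_def using c by blast
    moreover have "nondegenerate A P X" using nondeg unfolding X_def[abs_def] .
    ultimately have "adler_taylor_metric P X x (chart_vector A c x w) > 0"
      using chart_vector_nonzero[OF c w] unfolding nondegenerate_def positive_definite_form_def by blast
    then show False using metric_chart_vector[OF c, of w] M that by simp
  qed
  then have "\<exists>B. B ** M = mat 1" unfolding matrix_left_invertible_ker by blast
  then have "det M \<noteq> 0" using invertible_left_inverse invertible_det_nz by blast
  with M show thesis by (rule that)
qed

lemma gram_matrix_form:
  assumes c: "c \<in> A" "x \<in> fst c"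
  shows "gram_matrix A (adler_taylor_metric P X) c x = polar_matrix (form I c (snd c x))"
  unfolding gram_matrix_def polar_matrix_def Let_def metric_chart_vector[OF c] ..

definition dens :: "('a, 'm) chart \<Rightarrow> real ^ 'm \<Rightarrow> real" where
  "dens c z = sqrt (det (polar_matrix (form I c z)))"

lemma det_gram_factor:
  fixes M :: "real ^ 'm ^ 'm"
  shows "det (polar_matrix (\<lambda>w. (norm (M *v w))\<^sup>2)) = (det M)\<^sup>2"
  using det_polar_matrix_rank_one[of M 0] by simp

lemma dens_pos:
  assumes c: "c \<in> A" "x \<in> fst c"
  shows "dens c (snd c x) > 0"
proof -
  obtain M :: "real ^ 'm ^ 'm" where "form I c (snd c x) = (\<lambda>w. (norm (M *v w))\<^sup>2)" "det M \<noteq> 0"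
    by (rule form_factor[OF c]) (rule that)
  then show ?thesis by (simp add: dens_def det_gram_factor)
qed

lemma continuous_on_det_form:
  assumes K: "I \<subseteq> K" "finite K" "\<And>i. i \<in> K \<Longrightarrow> smooth_fun A (f i)" and c: "c \<in> A"
  shows "continuous_on (snd c ` fst c) (\<lambda>z. det (polar_matrix (form K c z)))"
  unfolding form_def
proof (rule continuous_on_det_projective_form)
  fix i assume i: "i \<in> K"
  show "continuous_on (snd c ` fst c) (\<lambda>z. f i (chart_inv c z))"
    using smooth_on_imp_continuous_on[OF smooth_funD[OF K(3)[OF i] c]] by (simp add: o_def)
  show "continuous_on (snd c ` fst c) (grad c (f i))"
    by (rule continuous_on_grad[OF K(3)[OF i] c])
next
  fix z
  have "0 < S (chart_inv c z)" by (rule S_pos)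
  also have "\<dots> \<le> (\<Sum>i\<in>K. (f i (chart_inv c z))\<^sup>2)"
    by (rule sum_mono2[OF K(2,1)]) simp
  finally show "0 < (\<Sum>i\<in>K. (f i (chart_inv c z))\<^sup>2)" .
qed

sublocale chart_density A dens
proof
  fix c assume c: "c \<in> A"
  show "continuous_on (snd c ` fst c) (dens c)"
    unfolding dens_def[abs_def]
    by (intro continuous_on_real_sqrt continuous_on_det_form[OF subset_refl finite_I smooth c])
next
  fix c c' x assume c: "c \<in> A" "c' \<in> A" and x: "x \<in> fst c" "x \<in> fst c'"
  define J where "J = matrix (frechet_derivative (snd c' \<circ> chart_inv c) (at (snd c x)))"
  obtain M :: "real ^ 'm ^ 'm" where M: "form I c' (snd c' x) = (\<lambda>w. (norm (M *v w))\<^sup>2)"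
    by (rule form_factor[OF c(2) x(2)]) (rule that)
  have "snd c x \<in> snd c ` (fst c \<inter> fst c')" using x by blast
  from has_derivative_linear[OF has_derivative_transition[OF c this]]
  have J: "frechet_derivative (snd c' \<circ> chart_inv c) (at (snd c x)) w = J *v w" for w
    unfolding J_def by (simp add: matrix_works linear_matrix_vector_mul_eq)
  \<comment> \<open>The metric lives on tangent vectors, without reference to charts. So a factor
    \<open>M\<close> of its form in one chart becomes \<open>M ** J\<close> in the other, and the
    densities differ by \<open>\<bar>det J\<bar>\<close>.\<close>
  have "form I c (snd c x) w = (norm ((M ** J) *v w))\<^sup>2" for w
  proof -
    have "form I c (snd c x) w = adler_taylor_metric P X x (chart_vector A c x w)"
      by (rule metric_chart_vector[OF c(1) x(1), symmetric])
    also have "\<dots> = adler_taylor_metric P X x (chart_vector A c' x (J *v w))"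
      unfolding chart_vector_change[OF c(1) x(1) c(2) x(2)] J ..
    also have "\<dots> = (norm (M *v (J *v w)))\<^sup>2"
      unfolding metric_chart_vector[OF c(2) x(2)] M ..
    finally show ?thesis by (simp add: matrix_vector_mul_assoc)
  qed
  then have M': "form I c (snd c x) = (\<lambda>w. (norm ((M ** J) *v w))\<^sup>2)" by blast
  show "dens c (snd c x) = dens c' (snd c' x) *
      \<bar>det (matrix (frechet_derivative (snd c' \<circ> chart_inv c) (at (snd c x))))\<bar>"
    unfolding dens_def M M' det_gram_factor J_def[symmetric] by (simp add: det_mul abs_mult)
qed

text \<open>Existence and uniqueness make the definite description meaningful. The two expressions
  for the density are compared on chart images only, as the integrals do not see other
  points.\<close>

lemma riemannian_volume_is_volume: "is_volume (riemannian_volume A (adler_taylor_metric P X))"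
proof -
  have "is_volume \<nu> \<longleftrightarrow> sets \<nu> = sets borel \<and>
        (\<forall>c\<in>A. \<forall>B\<in>sets borel. B \<subseteq> fst c \<longrightarrow> emeasure \<nu> B =
           (\<integral>\<^sup>+y\<in>snd c ` B. ennreal (sqrt (det (gram_matrix A (adler_taylor_metric P X) c (chart_inv c y)))) \<partial>lborel))" for \<nu>
  proof -
    have "(\<integral>\<^sup>+y\<in>snd c ` B. ennreal (dens c y) \<partial>lborel) =
        (\<integral>\<^sup>+y\<in>snd c ` B. ennreal (sqrt (det (gram_matrix A (adler_taylor_metric P X) c (chart_inv c y)))) \<partial>lborel)"
      if c: "c \<in> A" "B \<subseteq> fst c" for c B
    proof (rule nn_integral_cong)
      fix y
      show "ennreal (dens c y) * indicator (snd c ` B) y =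
        ennreal (sqrt (det (gram_matrix A (adler_taylor_metric P X) c (chart_inv c y)))) * indicator (snd c ` B) y"
      proof (cases "y \<in> snd c ` B")
        case True
        then obtain x where "x \<in> fst c" "y = snd c x" using c(2) by blast
        then show ?thesis using c(1) by (simp add: dens_def gram_matrix_form)
      qed simp
    qed
    then show ?thesis unfolding is_volume_def by (metis (no_types, lifting))
  qed
  then have "riemannian_volume A (adler_taylor_metric P X) = (THE \<nu>. is_volume \<nu>)"
    unfolding riemannian_volume_def by presburger
  moreover have "is_volume (THE \<nu>. is_volume \<nu>)"
  proof -
    obtain \<nu> where "is_volume \<nu>" using ex_is_volume by blast
    then show ?thesis by (rule theI) (rule is_volume_unique[OF _ \<open>is_volume \<nu>\<close>])
  qed
  ultimately show ?thesis by simp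
qed

text \<open>In the coordinates \<open>M *v w\<close> the metric is Euclidean and \<open>tau\<close>
  is represented by a vector \<open>s\<close>. The dual form of \<open>tau\<close> is then the
  square of \<open>norm s\<close>, the same number that appears in the determinant of the rank-one
  perturbation.\<close>

lemma Psi_density:
  assumes k: "k \<notin> I" and f0: "smooth_fun A (f k)" and c: "c \<in> A" "x \<in> fst c"
  shows "Psi A P X (f k) x * dens c (snd c x) = sqrt (det (polar_matrix (form (insert k I) c (snd c x))))"
    and "Psi A P X (f k) x \<ge> 0"
proof -
  define K0 where "K0 = S x + (f k x)\<^sup>2"
  have K0: "K0 > 0" using S_pos[of x] by (simp add: K0_def add_pos_nonneg)
  define t where "t = (1 / sqrt K0) *\<^sub>R ((f k x / S x) *\<^sub>R (\<Sum>i\<in>I. f i x *\<^sub>R grad c (f i) (snd c x)) - grad c (f k) (snd c x))"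
  have tw: "t \<bullet> w = 1 / sqrt K0 * (f k x * ((\<Sum>i\<in>I. f i x * (grad c (f i) (snd c x) \<bullet> w)) / S x) - grad c (f k) (snd c x) \<bullet> w)" for w
    by (simp add: t_def inner_diff_left inner_sum_left)
  have tau: "tau P X (f k) x (chart_vector A c x w) = t \<bullet> w" for w
    unfolding tau_def second_moment_X moment_map_chart_vector[OF c] tw K0_def differential_def
      chart_vector_apply[OF f0 c] ..
  obtain M :: "real ^ 'm ^ 'm" where M: "form I c (snd c x) = (\<lambda>w. (norm (M *v w))\<^sup>2)" "det M \<noteq> 0"
    by (rule form_factor[OF c]) (rule that)
  have "invertible (transpose M)" using M(2) by (simp add: invertible_det_nz)
  then obtain N where N: "transpose M ** N = mat 1" unfolding invertible_def by blast
  define s where "s = N *v t"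
  have "transpose M *v s = t" unfolding s_def by (simp add: matrix_vector_mul_assoc N)
  then have ts: "t \<bullet> w = s \<bullet> (M *v w)" for w
    by (metis dot_lmul_matrix transpose_matrix_vector)
  have "dual_form A (adler_taylor_metric P X) x (tau P X (f k) x) =
      Sup {(s \<bullet> (M *v w))\<^sup>2 | w. (norm (M *v w))\<^sup>2 \<le> 1}"
  proof -
    have "{(tau P X (f k) x v)\<^sup>2 | v. v \<in> tangent_space A x \<and> adler_taylor_metric P X x v \<le> 1} =
        {(tau P X (f k) x (chart_vector A c x w))\<^sup>2 | w. adler_taylor_metric P X x (chart_vector A c x w) \<le> 1}"
      unfolding tangent_space_chart[OF c] by blast
    then show ?thesis unfolding dual_form_def tau metric_chart_vector[OF c] M(1) ts by simp
  qed
  then have dual: "dual_form A (adler_taylor_metric P X) x (tau P X (f k) x) = (norm s)\<^sup>2"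
    using Sup_rank_one[OF M(2)] by simp
  \<comment> \<open>The first factor of \<open>Psi\<close> is the root of the power of
    \<open>S x / K0\<close> that scaling the form by \<open>S x / K0\<close> brings into the
    determinant.\<close>
  have "(S x / K0) powr (real CARD('m) / 2) = sqrt ((S x / K0) ^ CARD('m))"
    using S_pos[of x] K0 by (simp add: powr_half_sqrt[symmetric] powr_powr powr_realpow[symmetric])
  then have Psi: "Psi A P X (f k) x = sqrt ((S x / K0) ^ CARD('m)) * sqrt (1 + (norm s)\<^sup>2)"
    unfolding Psi_def dual second_moment_X K0_def by simp
  then show "Psi A P X (f k) x \<ge> 0" using S_pos[of x] K0 by simp
  have "form (insert k I) c (snd c x) w = S x / K0 * ((norm (M *v w))\<^sup>2 + (s \<bullet> (M *v w))\<^sup>2)" for w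
  proof -
    have "form (insert k I) c (snd c x) w = S x / K0 * (form I c (snd c x) w + (t \<bullet> w)\<^sup>2)"
      unfolding tw K0_def form_def
      using projective_form_insert[OF finite_I k, of "\<lambda>i. f i x" "\<lambda>i. grad c (f i) (snd c x)" w] S_pos[of x] c
      by simp
    then show ?thesis unfolding M(1) ts .
  qed
  then have "det (polar_matrix (form (insert k I) c (snd c x))) = (S x / K0) ^ CARD('m) * ((det M)\<^sup>2 * (1 + (norm s)\<^sup>2))"
    unfolding det_polar_matrix_rank_one[symmetric] det_scaleR[symmetric] polar_matrix_cmult[symmetric] by presburger
  then show "Psi A P X (f k) x * dens c (snd c x) = sqrt (det (polar_matrix (form (insert k I) c (snd c x))))"
    unfolding Psi dens_def M(1) det_gram_factor by (simp add: real_sqrt_mult)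
qed

text \<open>\<open>Psi\<close> involves a supremum over a tangent space. As a quotient of two
  continuous volume densities with positive denominator it is continuous.\<close>

lemma borel_measurable_Psi:
  assumes k: "k \<notin> I" and f0: "smooth_fun A (f k)"
  shows "Psi A P X (f k) \<in> borel_measurable borel"
proof (rule borel_measurable_continuous_onI)
  have "isCont (Psi A P X (f k)) x" for x
  proof -
    obtain c where c: "c \<in> A" "x \<in> fst c" using ex_chart by blast
    have *: "continuous_on (snd c ` fst c) (\<lambda>z. sqrt (det (polar_matrix (form (insert k I) c z))) / dens c z)"
    proof (intro continuous_on_divide continuous_on_real_sqrt cont_dens c(1) continuous_on_det_form)
      show "smooth_fun A (f i)" if "i \<in> insert k I" for i using that f0 smooth by blast
      show "\<forall>z\<in>snd c ` fst c. dens c z \<noteq> 0" using dens_pos[OF c(1)] by force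
    qed (use finite_I in auto)
    have "continuous_on (fst c) (\<lambda>y. sqrt (det (polar_matrix (form (insert k I) c (snd c y)))) / dens c (snd c y))"
      by (rule continuous_on_compose2[OF * continuous_on_chart[OF c(1)]]) simp
    then have "continuous_on (fst c) (Psi A P X (f k))"
    proof (rule continuous_on_eq)
      fix y assume y: "y \<in> fst c"
      show "sqrt (det (polar_matrix (form (insert k I) c (snd c y)))) / dens c (snd c y) = Psi A P X (f k) y"
        using Psi_density(1)[OF k f0 c(1) y] dens_pos[OF c(1) y] by (simp add: field_simps)
    qed
    then show ?thesis using c open_fst by (simp add: continuous_on_eq_continuous_at)
  qed
  then show "continuous_on UNIV (Psi A P X (f k))" by (simp add: continuous_at_imp_continuous_on)
qed

end

section \<open>Expected zeros as an integral over the manifold\<close>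

lemma sigma_compact_traces_borel:
  fixes B :: "'a::t2_space set"
  assumes "sigma_compact_traces B" shows "B \<in> sets borel"
proof -
  obtain K :: "nat \<Rightarrow> 'a set" where K: "\<And>n. compact (K n)" "UNIV \<inter> B = (\<Union>n. K n)"
    using assms open_UNIV unfolding sigma_compact_traces_def by meson
  have "K n \<in> sets borel" for n by (rule borel_closed) (rule compact_imp_closed[OF K(1)])
  then have "(\<Union>n. K n) \<in> sets borel" by blast
  then show ?thesis using K(2) by simp
qed

lemma emeasure_count_space_image:
  assumes "inj_on g S"
  shows "emeasure (count_space UNIV) (g ` S) = emeasure (count_space UNIV) S"
proof (cases "finite S")
  case True
  then show ?thesis by (simp add: card_image[OF assms])
next
  case False
  then show ?thesis using finite_image_iff[OF assms] by simp
qed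

text \<open>\<open>a\<close> and \<open>b\<close> stand for two nonnegative integrals,
  \<open>p\<close> and \<open>n\<close> for those of the positive and negative part of the
  difference of the integrands. The relation between them is additive and needs no subtraction;
  unless \<open>a\<close> and \<open>b\<close> are both infinite, \<open>p\<close> or
  \<open>n\<close> is finite and the terms can be rearranged.\<close>

lemma ennreal_difference_scaled:
  fixes a b p n :: ennreal and r :: real
  assumes r: "r > 0" and eq: "p + b = a + n" and le: "p \<le> a" "n \<le> b"
    and fin: "\<not> (ennreal r * a = \<infinity> \<and> ennreal r * b = \<infinity>)"
  shows "enn2ereal (ennreal r * a) - enn2ereal (ennreal r * b) = ereal r * (enn2ereal p - enn2ereal n)"
proof -
  have z: "enn2ereal (ennreal r * x) = ereal r * enn2ereal x" for x
    using r by (simp add: times_ennreal.rep_eq enn2ereal_ennreal)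
  have top: "ennreal r * top = top" using r by (simp add: ennreal_mult_top)
  show ?thesis
  proof (cases a rule: ennreal_cases)
    case (real a')
    then obtain p' where p: "p = ennreal p'" "p' \<ge> 0" using le(1) by (cases p rule: ennreal_cases) (auto simp: top_unique)
    show ?thesis
    proof (cases b rule: ennreal_cases)
      case (real b')
      then obtain n' where n: "n = ennreal n'" "n' \<ge> 0" using le(2) by (cases n rule: ennreal_cases) (auto simp: top_unique)
      have "a' - b' = p' - n'"
        using eq p n real \<open>a = ennreal a'\<close> \<open>0 \<le> a'\<close> by (simp flip: ennreal_plus)
      then have "r * a' - r * b' = r * (p' - n')" by (simp flip: right_diff_distrib)
      then show ?thesis using p n real \<open>a = ennreal a'\<close> \<open>0 \<le> a'\<close> unfolding z by (simp add: enn2ereal_ennreal)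
    next
      case top
      then have "n = top" using eq p real by (cases n rule: ennreal_cases) (auto simp flip: ennreal_plus)
      then show ?thesis using p real top r unfolding z by (simp add: enn2ereal_ennreal)
    qed
  next
    case top
    then have b: "b \<noteq> top" using fin \<open>ennreal r * top = top\<close> by auto
    then obtain b' where b': "b = ennreal b'" "b' \<ge> 0" by (cases b rule: ennreal_cases) auto
    then obtain n' where n: "n = ennreal n'" "n' \<ge> 0" using le(2) by (cases n rule: ennreal_cases) (auto simp: top_unique)
    have "p = top" using eq b' top by (cases p rule: ennreal_cases) (auto simp flip: ennreal_plus)
    then show ?thesis using b' n top r unfolding z by (simp add: enn2ereal_ennreal)
  qed
qed

lemma zeros_constant_pos: "zeros_constant m > 0"
  unfolding zeros_constant_def by (intro divide_pos_pos mult_pos_pos unit_ball_vol_pos) auto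

context manifold_atlas begin

lemma sigma_compact_traces_chart_image:
  assumes c: "c \<in> A" and B: "B \<subseteq> fst c" "sigma_compact_traces B"
  shows "sigma_compact_traces (snd c ` B)"
  unfolding sigma_compact_traces_def
proof (intro allI impI)
  fix W :: "(real ^ 'm) set" assume W: "open W"
  have "open (fst c \<inter> snd c -` W)"
    by (rule continuous_open_preimage[OF continuous_on_chart[OF c] open_fst[OF c] W])
  then obtain K :: "nat \<Rightarrow> 'a set" where K: "\<And>n. compact (K n)" "(fst c \<inter> snd c -` W) \<inter> B = (\<Union>n. K n)"
    using B(2) unfolding sigma_compact_traces_def by meson
  have "compact (snd c ` K n)" for n
    by (rule compact_continuous_image[OF continuous_on_subset[OF continuous_on_chart[OF c]] K(1)])
      (use K(2) in blast)
  moreover have "W \<inter> snd c ` B = (\<Union>n. snd c ` K n)"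
  proof -
    have "W \<inter> snd c ` B = snd c ` ((fst c \<inter> snd c -` W) \<inter> B)" using B(1) by blast
    then show ?thesis unfolding K(2) by blast
  qed
  ultimately show "\<exists>K :: nat \<Rightarrow> (real ^ 'm) set. (\<forall>n. compact (K n)) \<and> W \<inter> snd c ` B = (\<Union>n. K n)"
    by (intro exI[of _ "\<lambda>n. snd c ` K n"]) simp
qed

end

context gaussian_field begin

text \<open>\<open>p\<close> may be any index in \<open>K\<close> whose function has no zero on the
  piece, and the integrand on the right does not mention it. Hence pieces with different
  \<open>p\<close> fit together to one integral.\<close>

lemma expected_zeros_piece:
  assumes K: "finite K" "\<And>i. i \<in> K \<Longrightarrow> smooth_fun A (f i)" and p: "p \<in> K" and c: "c \<in> A"
    and B: "B \<subseteq> fst c \<inter> {x. f p x \<noteq> 0}" "sigma_compact_traces B"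
  shows "expected_zeros (PiM K (\<lambda>_. std_normal)) CARD('m) (\<lambda>w x. \<Sum>i\<in>K. w i * f i x) B =
    (\<integral>\<^sup>+z\<in>snd c ` B. ennreal (zeros_constant CARD('m)) * ennreal (sqrt (det (polar_matrix (form K c z)))) \<partial>lborel)"
proof -
  define V where "V = snd c ` (fst c \<inter> {x. f p x \<noteq> 0})"
  have "open {x. f p x \<noteq> 0}"
    using smooth_fun_continuous[OF K(2)[OF p]] by (simp add: open_Collect_neq)
  then have V: "open V" unfolding V_def by (rule open_chart_image[OF c])
  have VU: "V \<subseteq> snd c ` fst c" unfolding V_def by blast
  have Bc: "B \<subseteq> fst c" using B(1) by blast
  have Bs: "sigma_compact_traces (snd c ` B)" by (rule sigma_compact_traces_chart_image[OF c Bc B(2)])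
  have BV: "snd c ` B \<subseteq> V" unfolding V_def by (rule image_mono[OF B(1)])
  have ins: "insert p (K - {p}) = K" using p by blast
  have count: "emeasure (count_space UNIV) {x \<in> B. \<forall>j<CARD('m). (\<Sum>i\<in>K. Z j i * f i x) = 0} =
      emeasure (count_space UNIV) {z \<in> snd c ` B. \<forall>j<CARD('m). (\<Sum>i\<in>K. Z j i * f i (chart_inv c z)) = 0}"
    for Z :: "nat \<Rightarrow> nat \<Rightarrow> real"
  proof -
    have inv: "chart_inv c (snd c x) = x" if "x \<in> B" for x using that Bc c by auto
    have "{z \<in> snd c ` B. \<forall>j<CARD('m). (\<Sum>i\<in>K. Z j i * f i (chart_inv c z)) = 0} =
      snd c ` {x \<in> B. \<forall>j<CARD('m). (\<Sum>i\<in>K. Z j i * f i x) = 0}"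
      using inv by (auto simp: image_iff)
    moreover have "inj_on (snd c) {x \<in> B. \<forall>j<CARD('m). (\<Sum>i\<in>K. Z j i * f i x) = 0}"
      by (rule inj_on_subset[OF inj_on_chart[OF c]]) (use Bc in blast)
    ultimately show ?thesis by (simp add: emeasure_count_space_image)
  qed
  have "expected_zeros (PiM K (\<lambda>_. std_normal)) CARD('m) (\<lambda>w x. \<Sum>i\<in>K. w i * f i x) B =
      (\<integral>\<^sup>+Z. emeasure (count_space UNIV) {z \<in> snd c ` B. \<forall>j<CARD('m).
         (\<Sum>i\<in>insert p (K - {p}). Z j i * f i (chart_inv c z)) = 0}
         \<partial>PiM {..<CARD('m)} (\<lambda>_. PiM (insert p (K - {p})) (\<lambda>_. std_normal)))"
    unfolding expected_zeros_def ins count ..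
  also have "\<dots> = (\<integral>\<^sup>+z. abs_det_mean TYPE('m) * ennreal (sqrt (det (polar_matrix (form (insert p (K - {p})) c z))) / sqrt (2 * pi) ^ CARD('m)) *
      indicator (snd c ` B) z \<partial>lborel)"
    unfolding form_def projective_form_def
  proof (rule kac_rice_local[where f = "\<lambda>i z. f i (chart_inv c z)" and D = "\<lambda>i. grad c (f i)" and V = V and I = "K - {p}"])
    show "snd c ` B \<in> sets borel" by (rule sigma_compact_traces_borel[OF Bs])
    show "((\<lambda>z. f i (chart_inv c z)) has_derivative (\<lambda>v. grad c (f i) z \<bullet> v)) (at z)"
      if "i \<in> insert p (K - {p})" "z \<in> V" for i z
      using that VU by (intro has_derivative_grad K(2) c) (use p in auto)
    show "continuous_on V (grad c (f i))" if "i \<in> insert p (K - {p})" for i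
      using that by (intro continuous_on_subset[OF continuous_on_grad VU] K(2) c) (use p in auto)
    show "f p (chart_inv c z) \<noteq> 0" if "z \<in> V" for z
      using that c unfolding V_def by auto
  qed (use V BV Bs K in auto)
  also have "\<dots> = (\<integral>\<^sup>+z\<in>snd c ` B. ennreal (zeros_constant CARD('m)) * ennreal (sqrt (det (polar_matrix (form K c z)))) \<partial>lborel)"
  proof -
    have "abs_det_mean TYPE('m) * ennreal (u / sqrt (2 * pi) ^ CARD('m)) = ennreal (zeros_constant CARD('m)) * ennreal u" for u
    proof -
      have "ennreal (u / sqrt (2 * pi) ^ CARD('m)) = ennreal (1 / sqrt (2 * pi) ^ CARD('m)) * ennreal u"
        by (subst ennreal_mult'[symmetric]) simp_all
      then show ?thesis unfolding abs_det_mean_eq[symmetric] by (simp only: mult.assoc)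
    qed
    then show ?thesis unfolding ins by simp
  qed
  finally show ?thesis .
qed

text \<open>\<open>F\<close> is the ratio of the volume density belonging to \<open>K\<close> to
  that of the metric of \<open>X\<close>. The lemma serves twice, with \<open>F = 1\<close> for
  \<open>X\<close> and with \<open>F = Psi\<close> for the enlarged function, so that both integrals
  are taken with respect to the same volume.\<close>

lemma expected_zeros_eq_integral:
  fixes Y :: "'v \<Rightarrow> 'a \<Rightarrow> real" and F :: "'a \<Rightarrow> real"
  assumes K: "finite K" "I \<subseteq> K" "\<And>i. i \<in> K \<Longrightarrow> smooth_fun A (f i)"
    and Q: "prob_space Q" and Y: "Y \<in> Q \<rightarrow>\<^sub>M path_space" "\<And>\<omega>. continuous_on UNIV (Y \<omega>)"
    and law: "distr Q path_space Y = distr (PiM K (\<lambda>_. std_normal)) path_space (\<lambda>w x. \<Sum>i\<in>K. w i * f i x)"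
    and F: "F \<in> borel_measurable borel" "\<And>x. F x \<ge> 0"
      "\<And>c x. c \<in> A \<Longrightarrow> x \<in> fst c \<Longrightarrow> F x * dens c (snd c x) = sqrt (det (polar_matrix (form K c (snd c x))))"
    and U: "open U"
  shows "expected_zeros Q CARD('m) Y U = ennreal (zeros_constant CARD('m)) *
    (\<integral>\<^sup>+x\<in>U. ennreal (F x) \<partial>riemannian_volume A (adler_taylor_metric P X))"
proof -
  let ?\<nu> = "riemannian_volume A (adler_taylor_metric P X)" and ?z = "ennreal (zeros_constant CARD('m))"
  \<comment> \<open>A cell is a chart domain cut down to the points where one chosen function does
    not vanish. Functions with index in \<open>I\<close> suffice for a cover, also when
    \<open>K\<close> is larger.\<close>
  define G where "G q = fst (snd q) \<inter> {x. f (fst q) x \<noteq> 0}" for q :: "nat \<times> ('a, 'm) chart"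
  have oG: "open (G q)" if "q \<in> I \<times> A" for q
  proof -
    have "open {x. f (fst q) x \<noteq> 0}"
      using smooth_fun_continuous[OF smooth] that by (auto simp: open_Collect_neq)
    then show ?thesis using that open_fst unfolding G_def by (intro open_Int) auto
  qed
  have "(\<Union>q\<in>I \<times> A. G q) = UNIV"
  proof -
    have "x \<in> (\<Union>q\<in>I \<times> A. G q)" for x
    proof -
      obtain c where "c \<in> A" "x \<in> fst c" using ex_chart by blast
      moreover obtain i where "i \<in> I" "f i x \<noteq> 0" using no_zero by blast
      ultimately show ?thesis by (intro UN_I[of "(i, c)"]) (auto simp: G_def)
    qed
    then show ?thesis by blast
  qed
  from countable_subcover[OF oG this] obtain h :: "nat \<Rightarrow> nat \<times> ('a, 'm) chart"
    where h: "\<And>k. h k \<in> I \<times> A" "(\<Union>k. G (h k)) = UNIV" by auto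
  define B where "B k = U \<inter> disjointed (\<lambda>k. G (h k)) k" for k
  have disj: "disjoint_family B"
    using disjoint_family_disjointed[of "\<lambda>k. G (h k)"] unfolding B_def disjoint_family_on_def by blast
  have un: "(\<Union>k. B k) = U"
    using UN_disjointed_eq[of "\<lambda>k. G (h k)"] h(2) by (simp add: B_def flip: Int_UN_distrib)
  have BG: "B k \<subseteq> fst (snd (h k)) \<inter> {x. f (fst (h k)) x \<noteq> 0}" for k
    using disjointed_subset[of "\<lambda>k. G (h k)" k] unfolding B_def G_def by blast
  \<comment> \<open>The pieces of the disjoint decomposition are no longer open, but each is an open
    set intersected with a closed one.\<close>
  have Bs: "sigma_compact_traces (B k)" for k
  proof -
    have "B k = (U \<inter> G (h k)) \<inter> - (\<Union>i\<in>{0..<k}. G (h i))"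
      unfolding B_def disjointed_def by blast
    moreover have "open (U \<inter> G (h k))" using U oG[OF h(1)] by (rule open_Int)
    moreover have "closed (- (\<Union>i\<in>{0..<k}. G (h i)))"
      by (rule closed_Compl) (rule open_UN, rule ballI, rule oG[OF h(1)])
    ultimately show ?thesis
      by (simp only: sigma_compact_traces_Int_closed[OF sigma_compact_traces_open])
  qed
  have "K \<noteq> {}" using K(2) I_nonempty by blast
  have \<nu>: "is_volume ?\<nu>" by (rule riemannian_volume_is_volume)
  have sets\<nu>: "sets ?\<nu> = sets borel" using \<nu> by (simp add: is_volume_def)
  have piece: "expected_zeros Q CARD('m) Y (B k) = ?z * (\<integral>\<^sup>+x\<in>B k. ennreal (F x) \<partial>?\<nu>)" for k
  proof -
    let ?c = "snd (h k)"
    have c: "?c \<in> A" and p: "fst (h k) \<in> K" using h(1)[of k] K(2) by auto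
    have Bc: "B k \<subseteq> fst ?c" using BG by blast
    have contK: "continuous_on UNIV (\<lambda>x. \<Sum>i\<in>K. w i * f i x)" for w
      by (intro smooth_fun_continuous smooth_fun_sum K(3))
    have "expected_zeros Q CARD('m) Y (B k) =
        expected_zeros (PiM K (\<lambda>_. std_normal)) CARD('m) (\<lambda>w x. \<Sum>i\<in>K. w i * f i x) (B k)"
    proof (rule expected_zeros_cong_law[OF Bs Q _ Y(1) measurable_linear_combination[OF K(1)] _ _ law])
      show "prob_space (PiM K (\<lambda>_. std_normal))" by (intro prob_space_PiM prob_space_std_normal)
      show "continuous_on (B k) (Y \<omega>)" for \<omega> by (rule continuous_on_subset[OF Y(2) subset_UNIV])
      show "continuous_on (B k) (\<lambda>x. \<Sum>i\<in>K. w i * f i x)" for w by (rule continuous_on_subset[OF contK subset_UNIV])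
    qed
    also have "\<dots> = (\<integral>\<^sup>+z\<in>snd ?c ` B k. ?z * ennreal (sqrt (det (polar_matrix (form K ?c z)))) \<partial>lborel)"
      by (rule expected_zeros_piece[OF K(1,3) p c BG Bs])
    also have "\<dots> = (\<integral>\<^sup>+z\<in>snd ?c ` B k. (?z * ennreal (F (chart_inv ?c z))) * ennreal (dens ?c z) \<partial>lborel)"
    proof (rule nn_integral_cong)
      fix z
      show "?z * ennreal (sqrt (det (polar_matrix (form K ?c z)))) * indicator (snd ?c ` B k) z =
        (?z * ennreal (F (chart_inv ?c z))) * ennreal (dens ?c z) * indicator (snd ?c ` B k) z"
      proof (cases "z \<in> snd ?c ` B k")
        case True
        then obtain x where x: "x \<in> fst ?c" "z = snd ?c x" using Bc by blast
        show ?thesis using F(3)[OF c x(1), symmetric] F(2)[of x] x c by (simp add: ennreal_mult' mult.assoc)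
      qed simp
    qed
    also have "\<dots> = (\<integral>\<^sup>+x\<in>B k. ?z * ennreal (F x) \<partial>?\<nu>)"
      by (rule nn_integral_volume[OF \<nu> c sigma_compact_traces_borel[OF Bs] Bc, symmetric]) (use F(1) in measurable)
    also have "\<dots> = ?z * (\<integral>\<^sup>+x\<in>B k. ennreal (F x) \<partial>?\<nu>)"
      unfolding mult.assoc
      by (rule nn_integral_cmult)
        (use F(1) sigma_compact_traces_borel[OF Bs[of k]] in \<open>simp add: measurable_cong_sets[OF sets\<nu> refl]\<close>)
    finally show ?thesis .
  qed
  have "expected_zeros Q CARD('m) Y U = (\<Sum>k. expected_zeros Q CARD('m) Y (B k))"
    unfolding un[symmetric] by (rule expected_zeros_UN[OF Bs Y disj])
  also have "\<dots> = ?z * (\<Sum>k. \<integral>\<^sup>+x\<in>B k. ennreal (F x) \<partial>?\<nu>)"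
    unfolding piece by (rule ennreal_suminf_cmult)
  also have "(\<Sum>k. \<integral>\<^sup>+x\<in>B k. ennreal (F x) \<partial>?\<nu>) = (\<integral>\<^sup>+x. (\<Sum>k. ennreal (F x) * indicator (B k) x) \<partial>?\<nu>)"
    by (rule nn_integral_suminf[symmetric])
      (use F(1) sigma_compact_traces_borel[OF Bs] in \<open>simp add: measurable_cong_sets[OF sets\<nu> refl]\<close>)
  also have "\<dots> = (\<integral>\<^sup>+x\<in>U. ennreal (F x) \<partial>?\<nu>)"
    by (simp add: suminf_indicator[OF disj] un)
  finally show ?thesis .
qed

end

theorem theorem4:
  fixes A :: "('a::{t2_space,second_countable_topology}, 'm::finite) chart set"
    and d :: nat
    and f :: "nat \<Rightarrow> 'a \<Rightarrow> real"
    and f0 :: "'a \<Rightarrow> real"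
    and P :: "'w measure"
    and \<xi> :: "nat \<Rightarrow> 'w \<Rightarrow> real"
    and \<xi>0 :: "'w \<Rightarrow> real"
    and X X0 :: "'w \<Rightarrow> 'a \<Rightarrow> real"
  assumes manifold: "smooth_atlas A"
    and f_smooth: "\<forall>i\<in>{1..d}. smooth_fun A (f i)"
    and no_common_zero: "\<not> (\<exists>x. \<forall>i\<in>{1..d}. f i x = 0)"
    and prob: "prob_space P"
    and gaussian: "\<forall>i\<in>{1..d}. distributed P lborel (\<xi> i) std_normal_density"
    and indep: "prob_space.indep_vars P (\<lambda>_. borel) \<xi> {1..d}"
    and X_def: "X = (\<lambda>\<omega> x. \<Sum>i=1..d. \<xi> i \<omega> * f i x)"
    and nondeg: "nondegenerate A P X"
    and f0_smooth: "smooth_fun A f0"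
    and f0_indep: "\<not> (\<exists>a :: nat \<Rightarrow> real. \<forall>x. f0 x = (\<Sum>i=1..d. a i * f i x))"
    and gaussian0: "distributed P lborel \<xi>0 std_normal_density"
    and indep0: "prob_space.indep_set P
        {\<xi>0 -` B \<inter> space P | B. B \<in> sets borel}
        {X -` C \<inter> space P | C. C \<in> sets (\<Pi>\<^sub>M x\<in>UNIV. borel)}"
    and X0_def: "X0 = (\<lambda>\<omega> x. X \<omega> x + \<xi>0 \<omega> * f0 x)"
  shows "0 < zeros_constant CARD('m) \<and>
    (\<forall>U. open U \<longrightarrow>
       \<not> (expected_zeros P CARD('m) X0 U = \<infinity> \<and> expected_zeros P CARD('m) X U = \<infinity>) \<longrightarrow>
       enn2ereal (expected_zeros P CARD('m) X0 U) - enn2ereal (expected_zeros P CARD('m) X U) =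
       ereal (zeros_constant CARD('m)) *
         extended_integral (riemannian_volume A (adler_taylor_metric P X)) U
           (\<lambda>x. Psi A P X f0 x - 1))"
proof (intro conjI allI impI)
  show "0 < zeros_constant CARD('m)" by (rule zeros_constant_pos)
  fix U :: "'a set"
  assume U: "open U"
    and fin: "\<not> (expected_zeros P CARD('m) X0 U = \<infinity> \<and> expected_zeros P CARD('m) X U = \<infinity>)"
  \<comment> \<open>The given functions carry the indices from 1 to \<open>d\<close>, so the index 0
    is free for \<open>f0\<close>.\<close>
  define F where "F i = (if i = 0 then f0 else f i)" for i :: nat
  have F0: "F 0 = f0" by (simp add: F_def)
  have X_F: "X = (\<lambda>\<omega> x. \<Sum>i\<in>{1..d}. \<xi> i \<omega> * F i x)"
    unfolding X_def F_def by (intro ext sum.cong) auto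
  have X0_F: "X0 = (\<lambda>\<omega> x. X \<omega> x + \<xi>0 \<omega> * F 0 x)" by (simp add: X0_def F0)
  have F_smooth: "smooth_fun A (F i)" if "i \<in> insert 0 {1..d}" for i
    using that f_smooth f0_smooth by (auto simp: F_def)
  interpret G: gaussian_field A "{1..d}" F P \<xi>
  proof (intro gaussian_field.intro gaussian_field_axioms.intro manifold_atlas.intro)
    show "\<exists>i\<in>{1..d}. F i x \<noteq> 0" for x using no_common_zero by (force simp: F_def)
    show "nondegenerate A P (\<lambda>\<omega> x. \<Sum>i\<in>{1..d}. \<xi> i \<omega> * F i x)" using nondeg unfolding X_F .
    show "smooth_fun A (F i)" if "i \<in> {1..d}" for i by (rule F_smooth) (use that in simp)
  qed (rule manifold finite_atLeastAtMost prob gaussian indep)+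
  have GX: "G.X = X" unfolding G.X_def[abs_def] X_F ..
  define \<nu> where "\<nu> = riemannian_volume A (adler_taylor_metric P X)"
  have volume: "\<nu> = riemannian_volume A (adler_taylor_metric P G.X)" unfolding \<nu>_def GX ..
  have \<nu>: "sets \<nu> = sets borel"
    using G.riemannian_volume_is_volume unfolding volume[symmetric] G.is_volume_def by (rule conjunct1)
  have X_meas: "X \<in> P \<rightarrow>\<^sub>M path_space"
    and X_law: "distr P path_space X = distr (PiM {1..d} (\<lambda>_. std_normal)) path_space (\<lambda>w x. \<Sum>i\<in>{1..d}. w i * F i x)"
    unfolding X_F by (rule law_gaussian_combination[OF prob finite_atLeastAtMost G.I_nonempty gaussian indep])+
  have X0_meas: "X0 \<in> P \<rightarrow>\<^sub>M path_space"
    and X0_law: "distr P path_space X0 =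
      distr (PiM (insert 0 {1..d}) (\<lambda>_. std_normal)) path_space (\<lambda>w x. \<Sum>i\<in>insert 0 {1..d}. w i * F i x)"
    unfolding X0_F
    by (rule law_gaussian_combination_add[OF prob finite_atLeastAtMost _ X_meas X_law gaussian0 indep0], simp)+
  have contX: "continuous_on UNIV (X \<omega>)" for \<omega>
    unfolding X_F by (intro G.smooth_fun_continuous G.smooth_fun_sum F_smooth) simp
  have contX0: "continuous_on UNIV (X0 \<omega>)" for \<omega>
    unfolding X0_F by (intro continuous_intros contX G.smooth_fun_continuous F_smooth) simp
  define \<Psi> where "\<Psi> = Psi A P X f0"
  have Psi_borel: "\<Psi> \<in> borel_measurable borel"
    using G.borel_measurable_Psi[of 0] F_smooth[of 0] unfolding GX F0 \<Psi>_def by simp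
  have Psi_nonneg: "\<Psi> x \<ge> 0" for x
  proof -
    obtain c where "c \<in> A" "x \<in> fst c" using G.ex_chart by blast
    then show ?thesis using G.Psi_density(2)[of 0 c x] F_smooth[of 0] unfolding GX F0 \<Psi>_def by simp
  qed
  have ES0: "expected_zeros P CARD('m) X0 U =
      ennreal (zeros_constant CARD('m)) * (\<integral>\<^sup>+x\<in>U. ennreal (\<Psi> x) \<partial>\<nu>)"
    unfolding volume
  proof (rule G.expected_zeros_eq_integral[OF _ _ F_smooth prob X0_meas contX0 X0_law Psi_borel Psi_nonneg _ U])
    show "\<Psi> x * G.dens c (snd c x) = sqrt (det (polar_matrix (G.form (insert 0 {1..d}) c (snd c x))))"
      if "c \<in> A" "x \<in> fst c" for c x
      using G.Psi_density(1)[of 0 c x] that F_smooth[of 0] unfolding GX F0 \<Psi>_def by simp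
  qed auto
  have ES: "expected_zeros P CARD('m) X U = ennreal (zeros_constant CARD('m)) * (\<integral>\<^sup>+x\<in>U. ennreal 1 \<partial>\<nu>)"
    unfolding volume
    by (rule G.expected_zeros_eq_integral[OF finite_atLeastAtMost subset_refl G.smooth prob X_meas contX X_law _ _ _ U])
      (simp_all add: G.dens_def del: One_nat_def)
  have [measurable]: "\<Psi> \<in> borel_measurable \<nu>" "indicator U \<in> borel_measurable \<nu>"
    using Psi_borel U by (simp_all add: measurable_cong_sets[OF \<nu> refl])
  \<comment> \<open>The splitting of \<open>\<Psi> - 1\<close> into positive and negative part, in
    additive form since none of the integrals is known to be finite.\<close>
  have balance: "(\<integral>\<^sup>+x\<in>U. ennreal (\<Psi> x - 1) \<partial>\<nu>) + (\<integral>\<^sup>+x\<in>U. ennreal 1 \<partial>\<nu>) =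
      (\<integral>\<^sup>+x\<in>U. ennreal (\<Psi> x) \<partial>\<nu>) + (\<integral>\<^sup>+x\<in>U. ennreal (- (\<Psi> x - 1)) \<partial>\<nu>)"
  proof -
    have "ennreal (\<Psi> x - 1) + ennreal 1 = ennreal (\<Psi> x) + ennreal (- (\<Psi> x - 1))" for x
    proof (cases "\<Psi> x \<le> 1")
      case True
      then show ?thesis using Psi_nonneg[of x] by (subst (2) ennreal_plus[symmetric]) (simp_all add: ennreal_neg)
    next
      case False
      then show ?thesis using Psi_nonneg[of x] by (subst ennreal_plus[symmetric]) (simp_all add: ennreal_neg)
    qed
    then have "(ennreal (\<Psi> x - 1) + ennreal 1) * indicator U x = (ennreal (\<Psi> x) + ennreal (- (\<Psi> x - 1))) * indicator U x" for x
      by (rule arg_cong)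
    then show ?thesis by (subst (1 2) nn_integral_add[symmetric]) (simp_all only: distrib_right, measurable)
  qed
  have "enn2ereal (expected_zeros P CARD('m) X0 U) - enn2ereal (expected_zeros P CARD('m) X U) =
      ereal (zeros_constant CARD('m)) * (enn2ereal (\<integral>\<^sup>+x\<in>U. ennreal (\<Psi> x - 1) \<partial>\<nu>) -
        enn2ereal (\<integral>\<^sup>+x\<in>U. ennreal (- (\<Psi> x - 1)) \<partial>\<nu>))"
    unfolding ES ES0
  proof (rule ennreal_difference_scaled[OF zeros_constant_pos balance])
    show "(\<integral>\<^sup>+x\<in>U. ennreal (\<Psi> x - 1) \<partial>\<nu>) \<le> (\<integral>\<^sup>+x\<in>U. ennreal (\<Psi> x) \<partial>\<nu>)"
      by (intro nn_integral_mono mult_right_mono ennreal_leI) auto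
    show "(\<integral>\<^sup>+x\<in>U. ennreal (- (\<Psi> x - 1)) \<partial>\<nu>) \<le> (\<integral>\<^sup>+x\<in>U. ennreal 1 \<partial>\<nu>)"
      using Psi_nonneg by (intro nn_integral_mono mult_right_mono ennreal_leI) auto
    show "\<not> (ennreal (zeros_constant CARD('m)) * (\<integral>\<^sup>+x\<in>U. ennreal (\<Psi> x) \<partial>\<nu>) = \<infinity> \<and>
        ennreal (zeros_constant CARD('m)) * (\<integral>\<^sup>+x\<in>U. ennreal 1 \<partial>\<nu>) = \<infinity>)"
      using fin unfolding ES ES0 .
  qed
  then show "enn2ereal (expected_zeros P CARD('m) X0 U) - enn2ereal (expected_zeros P CARD('m) X U) =
       ereal (zeros_constant CARD('m)) *
         extended_integral (riemannian_volume A (adler_taylor_metric P X)) U (\<lambda>x. Psi A P X f0 x - 1)"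
    unfolding extended_integral_def \<nu>_def \<Psi>_def .
qed

end
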